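(* Let $\tau_E:E\to Q$ be a real vector bundle with an algebroid structure $(B_E,\rho^l_E,\rho^r_E)$. Let $D^l$ be a $\rho^l_E$-connection and $D^r$ a $\rho^r_E$-connection on $E$ with $B_E(\sigma,\bar\sigma)=D^l_\sigma\bar\sigma-D^r_{\bar\sigma}\sigma$ for all $\sigma,\bar\sigma\in\Gamma(\tau_E)$, let $R$ be a tensor of type $(1,3)$ on $E$, and consider the associated algebroid structure $(B_{\mathcal{T}_l^EE^*},\rho^l_{\mathcal{T}_l^EE^*},\rho^r_{\mathcal{T}_l^EE^*})$ on the left $E$-tangent bundle $\tau_{\mathcal{T}_l^EE^*}:\mathcal{T}_l^EE^*\to E^*$, with exact symplectic section $\Omega_{\mathcal{T}_l^EE^*}=-d^{lr}_{\mathcal{T}_l^EE^*}\lambda_{\mathcal{T}_l^EE^*}$, $\lambda_{\mathcal{T}_l^EE^*}$ being the Liouville section. If $R$ satisfies $$R(\sigma,\bar\sigma)\bar{\bar\sigma}=-R(\bar\sigma,\sigma)\bar{\bar\sigma}$$ and $$R(\sigma,\bar\sigma)\bar{\bar\sigma}+R(\bar\sigma,\bar{\bar\sigma})\sigma+R(\bar{\bar\sigma},\sigma)\bar\sigma=0$$ for all $\sigma,\bar\sigma,\bar{\bar\sigma}\in\Gamma(\tau_E)$, then $\Omega_{\mathcal{T}_l^EE^*}$ is closed, that is, $$d^{A}_{\mathcal{T}_l^EE^*}\,\Omega_{\mathcal{T}_l^EE^*}=0.$$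
   Context: All objects are smooth; $\Gamma(\tau)$ is the space of sections of a vector bundle $\tau$; anchors cover the identity of the base. Algebroid structure on $\tau_{\bar E}:\bar E\to\bar Q$: an $\mathbb{R}$-bilinear bracket $B_{\bar E}$ on $\Gamma(\tau_{\bar E})$ and vector bundle morphisms $\rho^l_{\bar E},\rho^r_{\bar E}:\bar E\to T\bar Q$ with $B_{\bar E}(f\sigma,f'\sigma')=f\rho^l_{\bar E}(\sigma)(f')\sigma'-f'\rho^r_{\bar E}(\sigma')(f)\sigma+ff'B_{\bar E}(\sigma,\sigma')$ for $f,f'\in C^\infty(\bar Q)$. Connections: for a vector bundle morphism $\rho_E:E\to TQ$, a $\rho_E$-connection on $E$ is an $\mathbb{R}$-bilinear map $D:\Gamma(\tau_E)\times\Gamma(\tau_E)\to\Gamma(\tau_E)$ with $D_{f\sigma}\gamma=fD_\sigma\gamma$ and $D_\sigma(g\gamma)=\rho_E(\sigma)(g)\gamma+gD_\sigma\gamma$. It acts on $\kappa\in\Gamma(\tau_{E^*})$ by $(D_\sigma\kappa)(\gamma)=\rho_E(\sigma)(\kappa(\gamma))-\kappa(D_\sigma\gamma)$. For $\gamma\in\Gamma(\tau_E)$, $\widehat\gamma\in C^\infty(E^* )$ is the linear function $\widehat\gamma(\kappa)=\langle\kappa,\gamma(\tau_{E^*}(\kappa))\rangle$. The $D$-horizontal lift of $\sigma_q\in E_q$ at $\kappa_q\in E_q^*$ is the vector $(\sigma_q)^{D\mathbf{h}}_{\kappa_q}\in T_{\kappa_q}E^*$ characterized by $(\sigma_q)^{D\mathbf{h}}_{\kappa_q}(f\circ\tau_{E^*})=\rho_E(\sigma_q)(f)$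 and $(\sigma_q)^{D\mathbf{h}}_{\kappa_q}(\widehat\gamma)=\kappa_q(D_{\sigma_q}\gamma)$; for $\sigma\in\Gamma(\tau_E)$ it defines a vector field $\sigma^{D\mathbf{h}}$ on $E^*$. The vertical lift of $\nu\in\Gamma(\tau_{E^*})$ is the vector field $\nu^{\mathbf{v}}$ on $E^*$ with $\nu^{\mathbf{v}}(f\circ\tau_{E^*})=0$, $\nu^{\mathbf{v}}(\widehat\gamma)=\nu(\gamma)\circ\tau_{E^*}$. The vertical lift of a $(1,1)$-tensor $S:\Gamma(\tau_E)\to\Gamma(\tau_E)$ is the vector field $S^{\mathbf{v}}$ on $E^*$ with $S^{\mathbf{v}}(f\circ\tau_{E^*})=0$, $S^{\mathbf{v}}(\widehat\gamma)=\widehat{S(\gamma)}$. A $(1,3)$-tensor on $E$ is a $C^\infty(Q)$-trilinear map $R:\Gamma(\tau_E)^3\to\Gamma(\tau_E)$; one writes $R(\sigma,\bar\sigma)\bar{\bar\sigma}=R(\sigma,\bar\sigma,\bar{\bar\sigma})$, and $R(\sigma,\bar\sigma,\cdot)$ is a $(1,1)$-tensor. The bundle $\mathcal{T}_l^EE^*\to E^*$ has fiber at $\kappa_q\in E_q^*$ equal to $\{(\sigma_q,\tilde X_{\kappa_q})\in E_q\times T_{\kappa_q}E^*:\rho^l_E(\sigma_q)=(T_{\kappa_q}\tau_{E^*})(\tilde X_{\kappa_q})\}$. Sections of it: $\sigma^{(D^l)\mathbf{h}}_l=(\sigma,\sigma^{D^l\mathbf{h}})$, $\nu^{\mathbf{v}}_l=(0,\nu^{\mathbf{v}})$,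 $S^{\mathbf{v}}_l=(0,S^{\mathbf{v}})$. Associated algebroid structure on $\mathcal{T}_l^EE^*$: the anchors are $\rho^l_{\mathcal{T}_l^EE^*}(\sigma_q,\tilde X_{\kappa_q})=\tilde X_{\kappa_q}$ and $\rho^r_{\mathcal{T}_l^EE^*}(\sigma_q,\tilde X_{\kappa_q})=\tilde X_{\kappa_q}-(\sigma_q)^{D^l\mathbf{h}}_{\kappa_q}+(\sigma_q)^{D^r\mathbf{h}}_{\kappa_q}$, and the bracket is the unique one compatible with these anchors such that, for $\sigma,\bar\sigma\in\Gamma(\tau_E)$, $\kappa,\nu\in\Gamma(\tau_{E^*})$: $$B_{\mathcal{T}_l^EE^*}(\sigma^{(D^l)\mathbf{h}}_l,\bar\sigma^{(D^l)\mathbf{h}}_l)=B_E(\sigma,\bar\sigma)^{(D^l)\mathbf{h}}_l+R(\sigma,\bar\sigma,\cdot)^{\mathbf{v}}_l,\quad B_{\mathcal{T}_l^EE^*}(\sigma^{(D^l)\mathbf{h}}_l,\nu^{\mathbf{v}}_l)=(D^l_\sigma\nu)^{\mathbf{v}}_l,$$ $$B_{\mathcal{T}_l^EE^*}(\kappa^{\mathbf{v}}_l,\bar\sigma^{(D^l)\mathbf{h}}_l)=-(D^r_{\bar\sigma}\kappa)^{\mathbf{v}}_l,\quad B_{\mathcal{T}_l^EE^*}(\kappa^{\mathbf{v}}_l,\nu^{\mathbf{v}}_l)=0.$$ Liouville section: $\lambda_{\mathcal{T}_l^EE^*}(\kappa_q)(\sigma_q,\tilde X_{\kappa_q})=\kappa_q(\sigma_q)$.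 Differentials on an algebroid $\bar E\to\bar Q$: for $\kappa\in\Gamma(\tau_{\bar E^*})$, $(d^{lr}_{\bar E}\kappa)(\sigma,\sigma')=\rho^l_{\bar E}(\sigma)(\kappa(\sigma'))-\rho^r_{\bar E}(\sigma')(\kappa(\sigma))-\kappa(B_{\bar E}(\sigma,\sigma'))$. The tensor $\Omega_{\mathcal{T}_l^EE^*}=-d^{lr}_{\mathcal{T}_l^EE^*}\lambda_{\mathcal{T}_l^EE^*}$ is skew-symmetric and nondegenerate. Skew-symmetric differential: put $B^A_{\bar E}(\sigma,\bar\sigma)=\frac12(B_{\bar E}(\sigma,\bar\sigma)-B_{\bar E}(\bar\sigma,\sigma))$ and $\rho^A_{\bar E}=\frac12(\rho^l_{\bar E}+\rho^r_{\bar E})$. For a skew-symmetric $(0,2)$-tensor $T$ on $\bar E$, $$(d^A_{\bar E}T)(\sigma,\bar\sigma,\bar{\bar\sigma})=\rho^A_{\bar E}(\sigma)(T(\bar\sigma,\bar{\bar\sigma}))-\rho^A_{\bar E}(\bar\sigma)(T(\sigma,\bar{\bar\sigma}))+\rho^A_{\bar E}(\bar{\bar\sigma})(T(\sigma,\bar\sigma))-T(B^A_{\bar E}(\sigma,\bar\sigma),\bar{\bar\sigma})+T(B^A_{\bar E}(\sigma,\bar{\bar\sigma}),\bar\sigma)-T(B^A_{\bar E}(\bar\sigma,\bar{\bar\sigma}),\sigma).$$ *)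

theory Defs
  imports "HOL-Analysis.Analysis" "HOL-Library.Function_Algebras"
begin

section \<open>Linear algebra preliminaries\<close>

instantiation "fun" :: (type, real_vector) real_vector
begin

definition scaleR_fun :: "real \<Rightarrow> ('a \<Rightarrow> 'b) \<Rightarrow> 'a \<Rightarrow> 'b"
  where "scaleR_fun c f = (\<lambda>x. c *\<^sub>R f x)"

instance
  by standard (simp_all add: scaleR_fun_def plus_fun_def fun_eq_iff algebra_simps)

end

text \<open>Finite-dimensional real inner product spaces.  This is \<open>euclidean_space\<close> without the
  requirement of positive dimension, so that zero-dimensional base manifolds and bundles of rank zero
  are not excluded; the type \<open>unit\<close> is the zero space.\<close>

class coordinate_space = real_inner +
  assumes ex_orthonormal_basis:
    "\<exists>B. finite B \<and> (\<forall>u\<in>B. \<forall>v\<in>B. inner u v = (if u = v then 1 else 0)) \<and>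
         (\<forall>x. (\<forall>u\<in>B. inner x u = 0) \<longleftrightarrow> x = 0)"

instance euclidean_space \<subseteq> coordinate_space
  by (standard, rule exI[of _ Basis]) (auto simp: inner_Basis euclidean_all_zero_iff)

instance prod :: (coordinate_space, coordinate_space) coordinate_space
proof
  obtain B :: "'a set" where B: "finite B" "\<forall>u\<in>B. \<forall>v\<in>B. inner u v = (if u = v then 1 else 0)"
    "\<forall>x. (\<forall>u\<in>B. inner x u = 0) \<longleftrightarrow> x = 0" using ex_orthonormal_basis[where 'a = 'a] by (elim exE conjE)
  obtain C :: "'b set" where C: "finite C" "\<forall>u\<in>C. \<forall>v\<in>C. inner u v = (if u = v then 1 else 0)"
    "\<forall>x. (\<forall>u\<in>C. inner x u = 0) \<longleftrightarrow> x = 0" using ex_orthonormal_basis[where 'a = 'b] by (elim exE conjE)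
  let ?D = "(\<lambda>u. (u, 0::'b)) ` B \<union> (\<lambda>v. (0::'a, v)) ` C"
  have nzB: "u \<noteq> 0" if "u \<in> B" for u using bspec[OF bspec[OF B(2) that] that] by auto
  have nzC: "u \<noteq> 0" if "u \<in> C" for u using bspec[OF bspec[OF C(2) that] that] by auto
  have "inner u v = (if u = v then 1 else 0)" if u: "u \<in> ?D" and v: "v \<in> ?D" for u v
  proof -
    consider u1 v1 where "u = (u1, 0)" "v = (v1, 0)" "u1 \<in> B" "v1 \<in> B"
      | u1 v1 where "u = (u1, 0)" "v = (0, v1)" "u1 \<in> B" "v1 \<in> C"
      | u1 v1 where "u = (0, u1)" "v = (v1, 0)" "u1 \<in> C" "v1 \<in> B"
      | u1 v1 where "u = (0, u1)" "v = (0, v1)" "u1 \<in> C" "v1 \<in> C"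
      using u v by blast
    then show ?thesis
      by cases (use B(2) C(2) nzB nzC in \<open>simp_all only: inner_Pair prod.inject inner_zero_left
        inner_zero_right add_0_left add_0_right simp_thms if_True if_False\<close>)
  qed
  moreover have "(\<forall>u\<in>?D. inner x u = 0) \<longleftrightarrow> x = 0" for x :: "'a \<times> 'b"
  proof -
    have "(\<forall>u\<in>?D. inner x u = 0) \<longleftrightarrow>
        (\<forall>u\<in>B. inner (fst x) u = 0) \<and> (\<forall>u\<in>C. inner (snd x) u = 0)"
      by (simp add: inner_prod_def ball_Un)
    also have "\<dots> \<longleftrightarrow> fst x = 0 \<and> snd x = 0"
      by (simp only: B(3)[rule_format] C(3)[rule_format])
    finally show ?thesis by (simp add: prod_eq_iff)
  qed
  ultimately show "\<exists>B::('a \<times> 'b) set. finite B \<and>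
      (\<forall>u\<in>B. \<forall>v\<in>B. inner u v = (if u = v then 1 else 0)) \<and>
      (\<forall>x. (\<forall>u\<in>B. inner x u = 0) \<longleftrightarrow> x = 0)"
    using B(1) C(1) by (intro exI[of _ ?D] conjI ballI allI) simp_all
qed

lemma unit_ext: "x = y" for x y :: unit
  by simp

instantiation unit :: coordinate_space
begin

definition "0 = ()"
definition "(x::unit) + y = ()"
definition "c *\<^sub>R (x::unit) = ()"
definition "norm (x::unit) = (0::real)"
definition "sgn (x::unit) = ()"
definition "dist (x::unit) (y::unit) = (0::real)"
definition "(uniformity :: (unit \<times> unit) filter) = principal UNIV"
definition "open (U :: unit set) = True"
definition "inner (x::unit) (y::unit) = (0::real)"

instance
proof
  show "(uniformity :: (unit \<times> unit) filter) = (INF e\<in>{0<..}. principal {(x, y). dist x y < e})"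
  proof -
    have "(INF e\<in>{0<..}. principal {(x, y). dist (x::unit) y < e}) =
        (INF e\<in>{0::real<..}. principal UNIV)"
      by (rule INF_cong) (auto simp only: dist_unit_def split_def Collect_const greaterThan_iff if_True)
    also have "\<dots> = principal UNIV"
      by (rule INF_const) (auto intro: exI[of _ 1])
    finally show ?thesis by (simp only: uniformity_unit_def)
  qed
  show "open U = (\<forall>x\<in>U. \<forall>\<^sub>F (x', y) in uniformity. x' = x \<longrightarrow> y \<in> U)" for U :: "unit set"
    by (auto simp only: open_unit_def uniformity_unit_def eventually_principal split_def
        intro: back_subst[of "\<lambda>z. z \<in> U", OF _ unit_ext])
  show "\<exists>B::unit set. finite B \<and> (\<forall>u\<in>B. \<forall>v\<in>B. inner u v = (if u = v then 1 else 0)) \<and>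
      (\<forall>x. (\<forall>u\<in>B. inner x u = 0) \<longleftrightarrow> x = 0)"
    by (rule exI[of _ "{}"]) (blast intro: unit_ext)
  fix x y z :: unit and a b r :: real
  show "inner x y = inner y x" "inner (x + y) z = inner x z + inner y z"
    "inner (r *\<^sub>R x) y = r * inner x y" "0 \<le> inner x x" "norm x = sqrt (inner x x)"
    by (simp_all only: inner_unit_def norm_unit_def real_sqrt_zero)
  show "inner x x = 0 \<longleftrightarrow> x = 0"
    by (simp only: inner_unit_def) (blast intro: unit_ext)
  show "dist x y = norm (x - y)" by (simp only: dist_unit_def norm_unit_def)
qed (rule unit_ext)+

end

definition linear_on :: "'v::real_vector set \<Rightarrow> ('v \<Rightarrow> 'w::real_vector) \<Rightarrow> bool" where
  "linear_on S h \<longleftrightarrow> (\<forall>x\<in>S. \<forall>y\<in>S. h (x + y) = h x + h y) \<and> (\<forall>c. \<forall>x\<in>S. h (c *\<^sub>R x) = c *\<^sub>R h x)"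


section \<open>Smooth manifolds\<close>

text \<open>Continuous differentiability of order \<open>k\<close> on an open set, by way of directional derivatives.\<close>

primrec cont_diff_on ::
    "nat \<Rightarrow> 'm::real_normed_vector set \<Rightarrow> ('m \<Rightarrow> 'b::real_normed_vector) \<Rightarrow> bool" where
  "cont_diff_on 0 S f \<longleftrightarrow> continuous_on S f"
| "cont_diff_on (Suc k) S f \<longleftrightarrow>
     (\<exists>f'. (\<forall>x\<in>S. (f has_derivative f' x) (at x)) \<and> (\<forall>v. cont_diff_on k S (\<lambda>x. f' x v)))"

definition smooth_on ::
    "'m::real_normed_vector set \<Rightarrow> ('m \<Rightarrow> 'b::real_normed_vector) \<Rightarrow> bool" where
  "smooth_on S f \<longleftrightarrow> (\<forall>k. cont_diff_on k S f)"

text \<open>A chart is a pair of its domain and its coordinate map; the value of the coordinate map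
  outside the domain is irrelevant.  The atlas need not be maximal.\<close>

record ('a, 'm) manifold =
  pts :: "'a set"
  atlas :: "('a set \<times> ('a \<Rightarrow> 'm)) set"

definition mtopology :: "('a, 'm::coordinate_space) manifold \<Rightarrow> 'a topology" where
  "mtopology M = topology (\<lambda>W. W \<subseteq> pts M \<and> (\<forall>(U, \<phi>)\<in>atlas M. open (\<phi> ` (W \<inter> U))))"

definition smooth_manifold :: "('a, 'm::coordinate_space) manifold \<Rightarrow> bool" where
  "smooth_manifold M \<longleftrightarrow>
     (\<forall>(U, \<phi>)\<in>atlas M. U \<subseteq> pts M \<and> inj_on \<phi> U \<and> open (\<phi> ` U)) \<and>
     (\<Union>(U, \<phi>)\<in>atlas M. U) = pts M \<and>
     (\<forall>(U, \<phi>)\<in>atlas M. \<forall>(V, \<psi>)\<in>atlas M.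
        open (\<phi> ` (U \<inter> V)) \<and> smooth_on (\<phi> ` (U \<inter> V)) (\<psi> \<circ> inv_into U \<phi>)) \<and>
     Hausdorff_space (mtopology M) \<and> second_countable (mtopology M)"

text \<open>\<open>W\<close> is meant to be open in \<open>M\<close>.\<close>

definition smooth_fun_on ::
    "('a, 'm::coordinate_space) manifold \<Rightarrow> 'a set \<Rightarrow> ('a \<Rightarrow> 'b::real_normed_vector) \<Rightarrow> bool" where
  "smooth_fun_on M W f \<longleftrightarrow> (\<forall>(U, \<phi>)\<in>atlas M. smooth_on (\<phi> ` (U \<inter> W)) (f \<circ> inv_into U \<phi>))"

text \<open>Elements of \<open>Cinf M\<close> may take arbitrary values outside \<open>pts M\<close>.  These values never matter:
  a function vanishing on \<open>pts M\<close> is annihilated by every derivation, as it is its own product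
  with the indicator function of the complement, which is smooth as well.\<close>

definition Cinf :: "('a, 'm::coordinate_space) manifold \<Rightarrow> ('a \<Rightarrow> real) set" where
  "Cinf M = {f. smooth_fun_on M (pts M) f}"

definition smooth_map ::
    "('a, 'm::coordinate_space) manifold \<Rightarrow> ('b, 'n::coordinate_space) manifold \<Rightarrow> ('a \<Rightarrow> 'b) \<Rightarrow> bool"
  where
  "smooth_map M N F \<longleftrightarrow>
     F ` pts M \<subseteq> pts N \<and>
     (\<forall>(U, \<phi>)\<in>atlas M. \<forall>(V, \<psi>)\<in>atlas N.
        open (\<phi> ` (U \<inter> F -` V)) \<and>
        smooth_on (\<phi> ` (U \<inter> F -` V)) (\<psi> \<circ> F \<circ> inv_into U \<phi>))"

text \<open>Tangent vectors are the derivations of \<open>Cinf M\<close> at a point, extended by zero to all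
  functions.\<close>

type_synonym 'a tvec = "('a \<Rightarrow> real) \<Rightarrow> real"

definition tangent :: "('a, 'm::coordinate_space) manifold \<Rightarrow> 'a \<Rightarrow> 'a tvec set" where
  "tangent M p = {v.
     (\<forall>f\<in>Cinf M. \<forall>g\<in>Cinf M. v (\<lambda>x. f x + g x) = v f + v g) \<and>
     (\<forall>c. \<forall>f\<in>Cinf M. v (\<lambda>x. c * f x) = c * v f) \<and>
     (\<forall>f\<in>Cinf M. \<forall>g\<in>Cinf M. v (\<lambda>x. f x * g x) = f p * v g + g p * v f) \<and>
     (\<forall>f. f \<notin> Cinf M \<longrightarrow> v f = 0)}"

definition tangent_map ::
    "('a, 'm::coordinate_space) manifold \<Rightarrow> ('b, 'n::coordinate_space) manifold \<Rightarrow> ('a \<Rightarrow> 'b) \<Rightarrow>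
     'a tvec \<Rightarrow> 'b tvec" where
  "tangent_map M N F v = (\<lambda>f. if f \<in> Cinf N then v (f \<circ> F) else 0)"

text \<open>The tangent vector at \<open>p\<close> with coordinates \<open>a\<close> in the chart \<open>(U, \<phi>)\<close>.\<close>

definition coord_vec ::
    "('a, 'm::coordinate_space) manifold \<Rightarrow> 'a set \<Rightarrow> ('a \<Rightarrow> 'm) \<Rightarrow> 'a \<Rightarrow> 'm \<Rightarrow> 'a tvec" where
  "coord_vec M U \<phi> p a =
     (\<lambda>f. if f \<in> Cinf M then frechet_derivative (f \<circ> inv_into U \<phi>) (at (\<phi> p)) a else 0)"


section \<open>Vector bundles\<close>

text \<open>The fibres are linear subspaces of a common, possibly infinite-dimensional, vector space, and
  the total space is their disjoint union.  A local trivialization \<open>(V, \<Phi>)\<close> has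
  \<open>\<Phi> q\<close> as its fibre component over \<open>q \<in> V\<close>.\<close>

record ('a, 'm, 'v, 'f) vbundle =
  base :: "('a, 'm) manifold"
  fibre :: "'a \<Rightarrow> 'v set"
  trivs :: "('a set \<times> ('a \<Rightarrow> 'v \<Rightarrow> 'f)) set"

definition vector_bundle ::
    "('a, 'm::coordinate_space, 'v::real_vector, 'f::coordinate_space) vbundle \<Rightarrow> bool" where
  "vector_bundle E \<longleftrightarrow>
     smooth_manifold (base E) \<and>
     (\<forall>q\<in>pts (base E). subspace (fibre E q)) \<and>
     (\<Union>(V, \<Phi>)\<in>trivs E. V) = pts (base E) \<and>
     (\<forall>(V, \<Phi>)\<in>trivs E. openin (mtopology (base E)) V \<and>
        (\<forall>q\<in>V. linear_on (fibre E q) (\<Phi> q) \<and> bij_betw (\<Phi> q) (fibre E q) UNIV)) \<and>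
     (\<forall>(V, \<Phi>)\<in>trivs E. \<forall>(W, \<Psi>)\<in>trivs E. \<forall>y.
        smooth_fun_on (base E) (V \<inter> W) (\<lambda>q. \<Psi> q (inv_into (fibre E q) (\<Phi> q) y)))"

definition sections ::
    "('a, 'm::coordinate_space, 'v::real_vector, 'f::coordinate_space) vbundle \<Rightarrow> ('a \<Rightarrow> 'v) set" where
  "sections E = {\<sigma>.
     (\<forall>q\<in>pts (base E). \<sigma> q \<in> fibre E q) \<and> (\<forall>q. q \<notin> pts (base E) \<longrightarrow> \<sigma> q = 0) \<and>
     (\<forall>(V, \<Phi>)\<in>trivs E. smooth_fun_on (base E) V (\<lambda>q. \<Phi> q (\<sigma> q)))}"

definition fmult :: "('a \<Rightarrow> real) \<Rightarrow> ('a \<Rightarrow> 'v::real_vector) \<Rightarrow> 'a \<Rightarrow> 'v" (infixr "\<star>" 75) where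
  "f \<star> \<sigma> = (\<lambda>q. f q *\<^sub>R \<sigma> q)"

definition total_chart :: "('a \<Rightarrow> 'm) \<Rightarrow> ('a \<Rightarrow> 'v \<Rightarrow> 'f) \<Rightarrow> 'a \<times> 'v \<Rightarrow> 'm \<times> 'f" where
  "total_chart \<phi> \<Phi> = (\<lambda>(q, e). (\<phi> q, \<Phi> q e))"

definition total_space ::
    "('a, 'm::coordinate_space, 'v::real_vector, 'f::coordinate_space) vbundle \<Rightarrow>
     ('a \<times> 'v, 'm \<times> 'f) manifold" where
  "total_space E = \<lparr>pts = Sigma (pts (base E)) (fibre E),
     atlas = {(Sigma (U \<inter> V) (fibre E), total_chart \<phi> \<Phi>) | U \<phi> V \<Phi>.
                (U, \<phi>) \<in> atlas (base E) \<and> (V, \<Phi>) \<in> trivs E}\<rparr>"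

definition tangent_bundle ::
    "('a, 'm::coordinate_space) manifold \<Rightarrow> ('a, 'm, 'a tvec, 'm) vbundle" where
  "tangent_bundle M = \<lparr>base = M, fibre = tangent M,
     trivs = {(U, \<lambda>p. inv (coord_vec M U \<phi> p)) | U \<phi>. (U, \<phi>) \<in> atlas M}\<rparr>"

text \<open>The dual of a trivialization, where the model fibre is identified with its dual by means of
  the inner product.\<close>

definition dual_triv ::
    "('a, 'm, 'v::real_vector, 'f::coordinate_space) vbundle \<Rightarrow> ('a \<Rightarrow> 'v \<Rightarrow> 'f) \<Rightarrow>
     'a \<Rightarrow> ('v \<Rightarrow> real) \<Rightarrow> 'f" where
  "dual_triv E \<Phi> q k = (THE y. \<forall>e\<in>fibre E q. k e = inner y (\<Phi> q e))"

definition dual_bundle ::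
    "('a, 'm, 'v::real_vector, 'f::coordinate_space) vbundle \<Rightarrow> ('a, 'm, 'v \<Rightarrow> real, 'f) vbundle" where
  "dual_bundle E = \<lparr>base = base E,
     fibre = (\<lambda>q. {k. linear_on (fibre E q) k \<and> (\<forall>e. e \<notin> fibre E q \<longrightarrow> k e = 0)}),
     trivs = {(V, dual_triv E \<Phi>) | V \<Phi>. (V, \<Phi>) \<in> trivs E}\<rparr>"

definition pairing :: "('a \<Rightarrow> 'v \<Rightarrow> real) \<Rightarrow> ('a \<Rightarrow> 'v) \<Rightarrow> 'a \<Rightarrow> real" where
  "pairing \<kappa> \<sigma> = (\<lambda>q. \<kappa> q (\<sigma> q))"

text \<open>Vector bundle morphisms over the identity of the base.\<close>

definition bundle_morphism ::
    "('a, 'm::coordinate_space, 'v::real_vector, 'f::coordinate_space) vbundle \<Rightarrow>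
     ('a, 'm, 'w::real_vector, 'g::coordinate_space) vbundle \<Rightarrow> ('a \<Rightarrow> 'v \<Rightarrow> 'w) \<Rightarrow> bool" where
  "bundle_morphism E F h \<longleftrightarrow>
     (\<forall>q\<in>pts (base E). linear_on (fibre E q) (h q) \<and> h q ` fibre E q \<subseteq> fibre F q) \<and>
     smooth_map (total_space E) (total_space F) (\<lambda>(q, e). (q, h q e))"


section \<open>Algebroids and connections\<close>

type_synonym ('a, 'v) anchor = "'a \<Rightarrow> 'v \<Rightarrow> 'a tvec"
type_synonym ('a, 'v) sec_op = "('a \<Rightarrow> 'v) \<Rightarrow> ('a \<Rightarrow> 'v) \<Rightarrow> 'a \<Rightarrow> 'v"

text \<open>\<open>act \<rho> \<sigma> f\<close> is the function \<open>\<rho>(\<sigma>)(f)\<close>.\<close>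

definition act :: "('a, 'v) anchor \<Rightarrow> ('a \<Rightarrow> 'v) \<Rightarrow> ('a \<Rightarrow> real) \<Rightarrow> 'a \<Rightarrow> real" where
  "act \<rho> \<sigma> f = (\<lambda>q. \<rho> q (\<sigma> q) f)"

definition bilinear_sections ::
    "('a, 'm::coordinate_space, 'v::real_vector, 'f::coordinate_space) vbundle \<Rightarrow>
     ('a, 'v) sec_op \<Rightarrow> bool" where
  "bilinear_sections E B \<longleftrightarrow>
     (\<forall>\<sigma>\<in>sections E. \<forall>\<tau>\<in>sections E. B \<sigma> \<tau> \<in> sections E) \<and>
     (\<forall>\<tau>\<in>sections E. linear_on (sections E) (\<lambda>\<sigma>. B \<sigma> \<tau>)) \<and>
     (\<forall>\<sigma>\<in>sections E. linear_on (sections E) (\<lambda>\<tau>. B \<sigma> \<tau>))"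

definition algebroid ::
    "('a, 'm::coordinate_space, 'v::real_vector, 'f::coordinate_space) vbundle \<Rightarrow>
     ('a, 'v) sec_op \<Rightarrow> ('a, 'v) anchor \<Rightarrow> ('a, 'v) anchor \<Rightarrow> bool" where
  "algebroid E B \<rho>l \<rho>r \<longleftrightarrow>
     bilinear_sections E B \<and>
     bundle_morphism E (tangent_bundle (base E)) \<rho>l \<and>
     bundle_morphism E (tangent_bundle (base E)) \<rho>r \<and>
     (\<forall>f\<in>Cinf (base E). \<forall>f'\<in>Cinf (base E). \<forall>\<sigma>\<in>sections E. \<forall>\<sigma>'\<in>sections E.
        B (f \<star> \<sigma>) (f' \<star> \<sigma>') =
          f \<star> act \<rho>l \<sigma> f' \<star> \<sigma>' - f' \<star> act \<rho>r \<sigma>' f \<star> \<sigma> + f \<star> f' \<star> B \<sigma> \<sigma>')"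

definition connection ::
    "('a, 'm::coordinate_space, 'v::real_vector, 'f::coordinate_space) vbundle \<Rightarrow>
     ('a, 'v) anchor \<Rightarrow> ('a, 'v) sec_op \<Rightarrow> bool" where
  "connection E \<rho> D \<longleftrightarrow>
     bilinear_sections E D \<and>
     (\<forall>f\<in>Cinf (base E). \<forall>\<sigma>\<in>sections E. \<forall>\<gamma>\<in>sections E. D (f \<star> \<sigma>) \<gamma> = f \<star> D \<sigma> \<gamma>) \<and>
     (\<forall>g\<in>Cinf (base E). \<forall>\<sigma>\<in>sections E. \<forall>\<gamma>\<in>sections E.
        D \<sigma> (g \<star> \<gamma>) = act \<rho> \<sigma> g \<star> \<gamma> + g \<star> D \<sigma> \<gamma>)"

text \<open>The value \<open>D\<^bsub>e\<^esub> \<gamma>\<close> at \<open>q\<close> for \<open>e\<close> in the fibre over \<open>q\<close>; it is well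
  defined because \<open>D\<close> is tensorial in its first argument.\<close>

definition conn_at ::
    "('a, 'm::coordinate_space, 'v::real_vector, 'f::coordinate_space) vbundle \<Rightarrow>
     ('a, 'v) sec_op \<Rightarrow> 'a \<Rightarrow> 'v \<Rightarrow> ('a \<Rightarrow> 'v) \<Rightarrow> 'v" where
  "conn_at E D q e \<gamma> = (THE w. \<forall>\<sigma>\<in>sections E. \<sigma> q = e \<longrightarrow> D \<sigma> \<gamma> q = w)"

definition dual_conn ::
    "('a, 'm::coordinate_space, 'v::real_vector, 'f::coordinate_space) vbundle \<Rightarrow>
     ('a, 'v) anchor \<Rightarrow> ('a, 'v) sec_op \<Rightarrow> ('a \<Rightarrow> 'v) \<Rightarrow> ('a \<Rightarrow> 'v \<Rightarrow> real) \<Rightarrow> 'a \<Rightarrow> 'v \<Rightarrow> real" where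
  "dual_conn E \<rho> D \<sigma> \<kappa> = (\<lambda>q. if q \<in> pts (base E)
     then (THE k. k \<in> fibre (dual_bundle E) q \<and>
             (\<forall>\<gamma>\<in>sections E. k (\<gamma> q) = act \<rho> \<sigma> (pairing \<kappa> \<gamma>) q - pairing \<kappa> (D \<sigma> \<gamma>) q))
     else 0)"

definition tensor13 ::
    "('a, 'm::coordinate_space, 'v::real_vector, 'f::coordinate_space) vbundle \<Rightarrow>
     (('a \<Rightarrow> 'v) \<Rightarrow> ('a, 'v) sec_op) \<Rightarrow> bool" where
  "tensor13 E R \<longleftrightarrow>
     (\<forall>\<sigma>\<in>sections E. \<forall>\<tau>\<in>sections E. \<forall>\<upsilon>\<in>sections E.
        R \<sigma> \<tau> \<upsilon> \<in> sections E \<and>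
        (\<forall>\<sigma>'\<in>sections E.
           R (\<sigma> + \<sigma>') \<tau> \<upsilon> = R \<sigma> \<tau> \<upsilon> + R \<sigma>' \<tau> \<upsilon> \<and>
           R \<tau> (\<sigma> + \<sigma>') \<upsilon> = R \<tau> \<sigma> \<upsilon> + R \<tau> \<sigma>' \<upsilon> \<and>
           R \<tau> \<upsilon> (\<sigma> + \<sigma>') = R \<tau> \<upsilon> \<sigma> + R \<tau> \<upsilon> \<sigma>') \<and>
        (\<forall>f\<in>Cinf (base E).
           R (f \<star> \<sigma>) \<tau> \<upsilon> = f \<star> R \<sigma> \<tau> \<upsilon> \<and>
           R \<sigma> (f \<star> \<tau>) \<upsilon> = f \<star> R \<sigma> \<tau> \<upsilon> \<and>
           R \<sigma> \<tau> (f \<star> \<upsilon>) = f \<star> R \<sigma> \<tau> \<upsilon>))"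

definition dlr ::
    "('a, 'v) sec_op \<Rightarrow> ('a, 'v) anchor \<Rightarrow> ('a, 'v) anchor \<Rightarrow> ('a \<Rightarrow> 'v \<Rightarrow> real) \<Rightarrow>
     ('a \<Rightarrow> 'v) \<Rightarrow> ('a \<Rightarrow> 'v) \<Rightarrow> 'a \<Rightarrow> real" where
  "dlr B \<rho>l \<rho>r \<kappa> \<sigma> \<sigma>' =
     act \<rho>l \<sigma> (pairing \<kappa> \<sigma>') - act \<rho>r \<sigma>' (pairing \<kappa> \<sigma>) - pairing \<kappa> (B \<sigma> \<sigma>')"

definition skew_bracket :: "('a, 'v::real_vector) sec_op \<Rightarrow> ('a, 'v) sec_op" where
  "skew_bracket B \<sigma> \<sigma>' = (1/2) *\<^sub>R (B \<sigma> \<sigma>' - B \<sigma>' \<sigma>)"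

definition mean_anchor :: "('a, 'v) anchor \<Rightarrow> ('a, 'v) anchor \<Rightarrow> ('a, 'v) anchor" where
  "mean_anchor \<rho>l \<rho>r = (\<lambda>q e. (1/2) *\<^sub>R (\<rho>l q e + \<rho>r q e))"

definition dA ::
    "('a, 'v::real_vector) sec_op \<Rightarrow> ('a, 'v) anchor \<Rightarrow> ('a, 'v) anchor \<Rightarrow>
     (('a \<Rightarrow> 'v) \<Rightarrow> ('a \<Rightarrow> 'v) \<Rightarrow> 'a \<Rightarrow> real) \<Rightarrow>
     ('a \<Rightarrow> 'v) \<Rightarrow> ('a \<Rightarrow> 'v) \<Rightarrow> ('a \<Rightarrow> 'v) \<Rightarrow> 'a \<Rightarrow> real" where
  "dA B \<rho>l \<rho>r T \<sigma> \<tau> \<upsilon> =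
     (let \<rho>A = mean_anchor \<rho>l \<rho>r; BA = skew_bracket B in
        act \<rho>A \<sigma> (T \<tau> \<upsilon>) - act \<rho>A \<tau> (T \<sigma> \<upsilon>) + act \<rho>A \<upsilon> (T \<sigma> \<tau>)
        - T (BA \<sigma> \<tau>) \<upsilon> + T (BA \<sigma> \<upsilon>) \<tau> - T (BA \<tau> \<upsilon>) \<sigma>)"


section \<open>Lifts to the dual bundle\<close>

abbreviation dual_total ::
    "('a, 'm::coordinate_space, 'v::real_vector, 'f::coordinate_space) vbundle \<Rightarrow>
     ('a \<times> ('v \<Rightarrow> real), 'm \<times> 'f) manifold" where
  "dual_total E \<equiv> total_space (dual_bundle E)"

definition hat :: "('a \<Rightarrow> 'v) \<Rightarrow> 'a \<times> ('v \<Rightarrow> real) \<Rightarrow> real" where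
  "hat \<gamma> = (\<lambda>(q, k). k (\<gamma> q))"

text \<open>The tangent vector of the dual bundle at \<open>(q, k)\<close> with prescribed values on basic
  functions and on linear functions.\<close>

definition lift_vec ::
    "('a, 'm::coordinate_space, 'v::real_vector, 'f::coordinate_space) vbundle \<Rightarrow>
     'a \<times> ('v \<Rightarrow> real) \<Rightarrow> (('a \<Rightarrow> real) \<Rightarrow> real) \<Rightarrow> (('a \<Rightarrow> 'v) \<Rightarrow> real) \<Rightarrow>
     ('a \<times> ('v \<Rightarrow> real)) tvec" where
  "lift_vec E x a b = (THE X. X \<in> tangent (dual_total E) x \<and>
     (\<forall>f\<in>Cinf (base E). X (f \<circ> fst) = a f) \<and> (\<forall>\<gamma>\<in>sections E. X (hat \<gamma>) = b \<gamma>))"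

definition hlift ::
    "('a, 'm::coordinate_space, 'v::real_vector, 'f::coordinate_space) vbundle \<Rightarrow>
     ('a, 'v) anchor \<Rightarrow> ('a, 'v) sec_op \<Rightarrow> 'a \<times> ('v \<Rightarrow> real) \<Rightarrow> 'v \<Rightarrow> ('a \<times> ('v \<Rightarrow> real)) tvec" where
  "hlift E \<rho> D = (\<lambda>(q, k) e. lift_vec E (q, k) (\<lambda>f. \<rho> q e f) (\<lambda>\<gamma>. k (conn_at E D q e \<gamma>)))"

definition vlift ::
    "('a, 'm::coordinate_space, 'v::real_vector, 'f::coordinate_space) vbundle \<Rightarrow>
     ('a \<Rightarrow> 'v \<Rightarrow> real) \<Rightarrow> 'a \<times> ('v \<Rightarrow> real) \<Rightarrow> ('a \<times> ('v \<Rightarrow> real)) tvec" where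
  "vlift E \<nu> = (\<lambda>x. if x \<in> pts (dual_total E)
     then lift_vec E x (\<lambda>f. 0) (\<lambda>\<gamma>. (pairing \<nu> \<gamma> \<circ> fst) x) else 0)"

definition vlift_tensor ::
    "('a, 'm::coordinate_space, 'v::real_vector, 'f::coordinate_space) vbundle \<Rightarrow>
     (('a \<Rightarrow> 'v) \<Rightarrow> 'a \<Rightarrow> 'v) \<Rightarrow> 'a \<times> ('v \<Rightarrow> real) \<Rightarrow> ('a \<times> ('v \<Rightarrow> real)) tvec" where
  "vlift_tensor E S = (\<lambda>x. if x \<in> pts (dual_total E)
     then lift_vec E x (\<lambda>f. 0) (\<lambda>\<gamma>. hat (S \<gamma>) x) else 0)"


section \<open>The left tangent bundle of an algebroid over its dual\<close>

type_synonym ('a, 'v) lfib = "'v \<times> ('a \<times> ('v \<Rightarrow> real)) tvec"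

text \<open>Coordinates \<open>(x, p)\<close> of the dual bundle induced by a chart of the base and a trivialization
  of \<open>E\<close> give every tangent vector of the dual bundle an \<open>x\<close>-component and a
  \<open>p\<close>-component.  On the fibre the \<open>x\<close>-component of \<open>X\<close> is determined by
  \<open>e\<close>, so that \<open>e\<close> and the \<open>p\<close>-component of \<open>X\<close> are linear fibre coordinates.\<close>

definition left_tangent ::
    "('a, 'm::coordinate_space, 'v::real_vector, 'f::coordinate_space) vbundle \<Rightarrow> ('a, 'v) anchor \<Rightarrow>
     ('a \<times> ('v \<Rightarrow> real), 'm \<times> 'f, ('a, 'v) lfib, 'f \<times> 'f) vbundle" where
  "left_tangent E \<rho>l = \<lparr>base = dual_total E,
     fibre = (\<lambda>(q, k). {(e, X). e \<in> fibre E q \<and> X \<in> tangent (dual_total E) (q, k) \<and>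
                           \<rho>l q e = tangent_map (dual_total E) (base E) fst X}),
     trivs = {(W, \<lambda>(q, k) (e, X).
                 (\<Phi> q e, snd (inv (coord_vec (dual_total E) W (total_chart \<phi> (dual_triv E \<Phi>)) (q, k)) X)))
              | U \<phi> V \<Phi> W. (U, \<phi>) \<in> atlas (base E) \<and> (V, \<Phi>) \<in> trivs E \<and>
                           W = Sigma (U \<inter> V) (fibre (dual_bundle E))}\<rparr>"

definition hsec ::
    "('a, 'm::coordinate_space, 'v::real_vector, 'f::coordinate_space) vbundle \<Rightarrow>
     ('a, 'v) anchor \<Rightarrow> ('a, 'v) sec_op \<Rightarrow> ('a \<Rightarrow> 'v) \<Rightarrow> 'a \<times> ('v \<Rightarrow> real) \<Rightarrow> ('a, 'v) lfib" where
  "hsec E \<rho>l Dl \<sigma> = (\<lambda>x. if x \<in> pts (dual_total E)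
     then (\<sigma> (fst x), hlift E \<rho>l Dl x (\<sigma> (fst x))) else 0)"

definition vsec ::
    "('a, 'm::coordinate_space, 'v::real_vector, 'f::coordinate_space) vbundle \<Rightarrow>
     ('a \<Rightarrow> 'v \<Rightarrow> real) \<Rightarrow> 'a \<times> ('v \<Rightarrow> real) \<Rightarrow> ('a, 'v) lfib" where
  "vsec E \<nu> = (\<lambda>x. (0, vlift E \<nu> x))"

definition vsec_tensor ::
    "('a, 'm::coordinate_space, 'v::real_vector, 'f::coordinate_space) vbundle \<Rightarrow>
     (('a \<Rightarrow> 'v) \<Rightarrow> 'a \<Rightarrow> 'v) \<Rightarrow> 'a \<times> ('v \<Rightarrow> real) \<Rightarrow> ('a, 'v) lfib" where
  "vsec_tensor E S = (\<lambda>x. (0, vlift_tensor E S x))"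

definition left_anchor :: "('a \<times> ('v \<Rightarrow> real), ('a, 'v) lfib) anchor" where
  "left_anchor = (\<lambda>x (e, X). X)"

definition right_anchor ::
    "('a, 'm::coordinate_space, 'v::real_vector, 'f::coordinate_space) vbundle \<Rightarrow>
     ('a, 'v) anchor \<Rightarrow> ('a, 'v) anchor \<Rightarrow> ('a, 'v) sec_op \<Rightarrow> ('a, 'v) sec_op \<Rightarrow>
     ('a \<times> ('v \<Rightarrow> real), ('a, 'v) lfib) anchor" where
  "right_anchor E \<rho>l \<rho>r Dl Dr = (\<lambda>x (e, X). X - hlift E \<rho>l Dl x e + hlift E \<rho>r Dr x e)"

text \<open>The properties that single out the bracket of the associated algebroid structure.\<close>

definition associated_bracket ::
    "('a, 'm::coordinate_space, 'v::real_vector, 'f::coordinate_space) vbundle \<Rightarrow>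
     ('a, 'v) sec_op \<Rightarrow> ('a, 'v) anchor \<Rightarrow> ('a, 'v) anchor \<Rightarrow> ('a, 'v) sec_op \<Rightarrow> ('a, 'v) sec_op \<Rightarrow>
     (('a \<Rightarrow> 'v) \<Rightarrow> ('a, 'v) sec_op) \<Rightarrow> ('a \<times> ('v \<Rightarrow> real), ('a, 'v) lfib) sec_op \<Rightarrow> bool" where
  "associated_bracket E B \<rho>l \<rho>r Dl Dr R BT \<longleftrightarrow>
     algebroid (left_tangent E \<rho>l) BT left_anchor (right_anchor E \<rho>l \<rho>r Dl Dr) \<and>
     (\<forall>\<sigma>\<in>sections E. \<forall>\<tau>\<in>sections E.
        BT (hsec E \<rho>l Dl \<sigma>) (hsec E \<rho>l Dl \<tau>) =
          hsec E \<rho>l Dl (B \<sigma> \<tau>) + vsec_tensor E (\<lambda>\<upsilon>. R \<sigma> \<tau> \<upsilon>)) \<and>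
     (\<forall>\<sigma>\<in>sections E. \<forall>\<nu>\<in>sections (dual_bundle E).
        BT (hsec E \<rho>l Dl \<sigma>) (vsec E \<nu>) = vsec E (dual_conn E \<rho>l Dl \<sigma> \<nu>)) \<and>
     (\<forall>\<kappa>\<in>sections (dual_bundle E). \<forall>\<tau>\<in>sections E.
        BT (vsec E \<kappa>) (hsec E \<rho>l Dl \<tau>) = - vsec E (dual_conn E \<rho>r Dr \<tau> \<kappa>)) \<and>
     (\<forall>\<kappa>\<in>sections (dual_bundle E). \<forall>\<nu>\<in>sections (dual_bundle E).
        BT (vsec E \<kappa>) (vsec E \<nu>) = 0)"

text \<open>The Liouville section, a section of the dual of the left tangent bundle.\<close>

definition liouville ::
    "('a, 'm::coordinate_space, 'v::real_vector, 'f::coordinate_space) vbundle \<Rightarrow> ('a, 'v) anchor \<Rightarrow>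
     'a \<times> ('v \<Rightarrow> real) \<Rightarrow> ('a, 'v) lfib \<Rightarrow> real" where
  "liouville E \<rho>l = (\<lambda>(q, k) (e, X).
     if (q, k) \<in> pts (dual_total E) \<and> (e, X) \<in> fibre (left_tangent E \<rho>l) (q, k) then k e else 0)"

definition Omega ::
    "('a, 'm::coordinate_space, 'v::real_vector, 'f::coordinate_space) vbundle \<Rightarrow>
     ('a, 'v) anchor \<Rightarrow> ('a, 'v) anchor \<Rightarrow> ('a, 'v) sec_op \<Rightarrow> ('a, 'v) sec_op \<Rightarrow>
     ('a \<times> ('v \<Rightarrow> real), ('a, 'v) lfib) sec_op \<Rightarrow>
     ('a \<times> ('v \<Rightarrow> real) \<Rightarrow> ('a, 'v) lfib) \<Rightarrow> ('a \<times> ('v \<Rightarrow> real) \<Rightarrow> ('a, 'v) lfib) \<Rightarrow>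
     'a \<times> ('v \<Rightarrow> real) \<Rightarrow> real" where
  "Omega E \<rho>l \<rho>r Dl Dr BT Y Z =
     - dlr BT left_anchor (right_anchor E \<rho>l \<rho>r Dl Dr) (liouville E \<rho>l) Y Z"

end

theory Submission
  imports Defs
begin

text \<open>
  Horizontal lifts \<open>\<sigma>\<^sup>h = hsec \<sigma>\<close> of sections of \<open>E\<close> and vertical lifts \<open>\<nu>\<^sup>v = vsec \<nu>\<close> of sections of the
  dual bundle generate the sections of the left tangent bundle locally over the smooth functions.  On
  these generators the symplectic section is \<open>\<Omega>(\<sigma>\<^sup>h, \<tau>\<^sup>h) = 0\<close>, \<open>\<Omega>(\<sigma>\<^sup>h, \<nu>\<^sup>v) = \<nu>(\<sigma>)\<close> and
  \<open>\<Omega>(\<nu>\<^sup>v, \<kappa>\<^sup>v) = 0\<close>, where \<open>B(\<sigma>, \<tau>) = D\<^sup>l\<^sub>\<sigma> \<tau> - D\<^sup>r\<^sub>\<tau> \<sigma>\<close> enters through the first identity.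
  Since \<open>\<Omega>\<close> is tensorial and skew, \<open>d\<^sup>A \<Omega>\<close> is tensorial and alternating, so it only has to be evaluated on
  generators.  On three horizontal lifts it is the linear function on the dual bundle given by
  \<open>R(\<sigma>, \<tau>)\<upsilon> + R(\<tau>, \<upsilon>)\<sigma> + R(\<upsilon>, \<sigma>)\<tau>\<close>, once \<open>R\<close> is skew in its first two arguments; on all other
  combinations it vanishes identically.

  Horizontal and vertical lifts are defined by their values on basic and linear functions.  That such
  tangent vectors exist and are unique rests on Hadamard's lemma, which identifies derivations of the
  smooth functions with coordinate vectors, and on bump functions pulled back from the base.
\<close>

section \<open>Finite-dimensional inner product spaces\<close>

text \<open>The generators span only locally, whereas brackets, connections and derivations act on
  global sections and functions. The recurring device is to cut off by a bump function
  \<open>g\<close> both the coefficient and the generator in each summand: then \<open>g\<close>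
  times \<open>g\<close> times the object has a global expansion, and an operation that evaluates
  smooth factors at a point where \<open>g\<close> is 1 sees the object itself. Hadamard's
  expansion, frames of \<open>E\<close> and of its dual, and the lifts all pass through this device.

  A second obstacle is \<open>Omega\<close>. Its definition differentiates both arguments and uses
  an unsymmetric bracket, and the Leibniz rules produce factors such as \<rho>(Y)(f) that are never
  shown to be smooth. Linearity over smooth functions is therefore sharpened to dependence on the
  value at the point, by closed formulas for \<open>Omega\<close> against a lift; only with these
  does the criterion \<open>skew_form\<close> become available, from which the tensoriality of
  \<open>dA\<close> is pure algebra.\<close>

definition onb :: "'a::coordinate_space set" where
  "onb = (SOME B. finite B \<and> (\<forall>u\<in>B. \<forall>v\<in>B. inner u v = (if u = v then 1 else 0)) \<and>
         (\<forall>x. (\<forall>u\<in>B. inner x u = 0) \<longleftrightarrow> x = 0))"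

lemma onb_props:
  "finite (onb::'a::coordinate_space set) \<and>
   (\<forall>u\<in>(onb::'a set). \<forall>v\<in>onb. inner u v = (if u = v then 1 else 0)) \<and>
   (\<forall>x. (\<forall>u\<in>(onb::'a set). inner x u = 0) \<longleftrightarrow> x = 0)"
  unfolding onb_def by (rule someI_ex, rule ex_orthonormal_basis)

lemma finite_onb [simp, intro]: "finite (onb::'a::coordinate_space set)"
  using onb_props by blast

lemma inner_onb: "u \<in> onb \<Longrightarrow> v \<in> onb \<Longrightarrow> inner u v = (if u = v then 1 else 0)"
  using onb_props by blast

lemma onb_eq_zero: "(\<And>u. u \<in> onb \<Longrightarrow> inner x u = 0) \<Longrightarrow> x = 0"
  using onb_props by blast

lemma inner_sum_onb: "v \<in> onb \<Longrightarrow> inner (\<Sum>u\<in>onb. c u *\<^sub>R u) v = c v"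
  by (simp add: inner_sum_left inner_onb if_distrib cong: if_cong)

lemma onb_expansion: "(\<Sum>u\<in>onb. inner x u *\<^sub>R u) = x"
proof -
  have "x - (\<Sum>u\<in>onb. inner x u *\<^sub>R u) = 0"
    by (rule onb_eq_zero) (simp add: inner_diff_left inner_sum_onb)
  then show ?thesis by simp
qed

lemma onb_eqI: "(\<And>u. u \<in> onb \<Longrightarrow> inner x u = inner y u) \<Longrightarrow> x = y"
  using onb_eq_zero[of "x - y"] by (simp add: inner_diff_left)

lemma linear_onb: "linear h \<Longrightarrow> h x = (\<Sum>u\<in>onb. inner x u *\<^sub>R h u)"
  by (subst onb_expansion[of x, symmetric]) (simp add: linear_sum linear_scale)

text \<open>A bounded sequence has a subsequence along which its finitely many coordinates converge.
  Compactness of closed balls is what \<open>bump_exists\<close> relies on; completeness, and with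
  it the Banach property, follows at once.\<close>

instance coordinate_space \<subseteq> heine_borel
proof
  fix f :: "nat \<Rightarrow> 'a" assume bd: "bounded (range f)"
  define un where "un e = (\<Sum>u\<in>onb. e u *\<^sub>R u)" for e :: "'a \<Rightarrow> real"
  have "\<forall>d\<subseteq>onb. \<exists>l::'a. \<exists>r. strict_mono r \<and>
      (\<forall>e>0. eventually (\<lambda>n. \<forall>i\<in>d. dist (inner (f (r n)) i) (inner l i) < e) sequentially)"
  proof (rule compact_lemma_general[where unproj = un])
    show "bounded ((\<lambda>x. inner x k) ` range f)" for k
      by (rule bounded_linear_image[OF bd bounded_linear_inner_left])
  qed (simp_all add: un_def inner_sum_onb onb_expansion)
  then obtain l :: 'a and r where r: "strict_mono r"
    and l: "\<And>e. e > 0 \<Longrightarrow> eventually (\<lambda>n. \<forall>i\<in>onb. dist (inner (f (r n)) i) (inner l i) < e) sequentially"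
    by blast
  have "(\<lambda>n. inner (f (r n)) i) \<longlonglongrightarrow> inner l i" if "i \<in> onb" for i
  proof (rule tendstoI)
    fix e :: real assume "e > 0"
    from l[OF this] show "eventually (\<lambda>n. dist (inner (f (r n)) i) (inner l i) < e) sequentially"
      by (rule eventually_mono) (use that in blast)
  qed
  then have "(\<lambda>n. \<Sum>i\<in>onb. inner (f (r n)) i *\<^sub>R i) \<longlonglongrightarrow> (\<Sum>i\<in>onb. inner l i *\<^sub>R i)"
    by (intro tendsto_sum tendsto_scaleR tendsto_const) auto
  then show "\<exists>l r. strict_mono r \<and> (f \<circ> r) \<longlonglongrightarrow> l"
    using r by (auto simp: onb_expansion o_def)
qed

instance coordinate_space \<subseteq> banach ..

section \<open>Smooth functions\<close>

lemma cont_diff_on_subset: "cont_diff_on k S f \<Longrightarrow> T \<subseteq> S \<Longrightarrow> cont_diff_on k T f"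
proof (induction k arbitrary: f)
  case 0 then show ?case by (auto intro: continuous_on_subset)
next
  case (Suc k)
  then obtain f' where "\<forall>x\<in>S. (f has_derivative f' x) (at x)" "\<forall>v. cont_diff_on k S (\<lambda>x. f' x v)"
    by auto
  with Suc show ?case by (auto intro!: exI[of _ f'])
qed

lemma cont_diff_on_continuous: "cont_diff_on k S f \<Longrightarrow> continuous_on S f"
proof (cases k)
  case (Suc j)
  assume "cont_diff_on k S f"
  then obtain f' where "\<forall>x\<in>S. (f has_derivative f' x) (at x)" unfolding Suc cont_diff_on.simps by blast
  then have "\<forall>x\<in>S. isCont f x" by (blast intro: has_derivative_continuous)
  then show ?thesis by (rule continuous_at_imp_continuous_on)
qed simp

lemma cont_diff_on_SucD: "cont_diff_on (Suc k) S f \<Longrightarrow> cont_diff_on k S f"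
proof (induction k arbitrary: f)
  case 0 then show ?case by (simp only: cont_diff_on.simps(1) cont_diff_on_continuous)
next
  case (Suc k)
  then obtain f' where "\<forall>x\<in>S. (f has_derivative f' x) (at x)"
    "\<And>v. cont_diff_on (Suc k) S (\<lambda>x. f' x v)"
    unfolding cont_diff_on.simps(2)[of "Suc k"] by blast
  then show ?case using Suc.IH unfolding cont_diff_on.simps(2)[of k] by blast
qed

lemma cont_diff_on_cong:
  assumes "open S" "\<And>x. x \<in> S \<Longrightarrow> f x = g x" "cont_diff_on k S f"
  shows "cont_diff_on k S g"
proof (cases k)
  case 0 then show ?thesis using assms by (metis cont_diff_on.simps(1) continuous_on_cong)
next
  case (Suc j)
  then obtain f' where f': "\<forall>x\<in>S. (f has_derivative f' x) (at x)" "\<forall>v. cont_diff_on j S (\<lambda>x. f' x v)"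
    using assms(3) by auto
  have "(g has_derivative f' x) (at x)" if "x \<in> S" for x
    using has_derivative_transform_within_open[OF _ assms(1) that, of f "f' x" UNIV g] f'(1) assms(2) that by auto
  then show ?thesis using f'(2) Suc by auto
qed

text \<open>On an open set the derivative is unique, so the existential witness may be replaced by
  \<open>frechet_derivative\<close>. This canonical choice is what lets derivatives found on
  different neighbourhoods be glued in \<open>cont_diff_on_local\<close>.\<close>

lemma cont_diff_on_Suc_iff:
  assumes "open S"
  shows "cont_diff_on (Suc k) S f \<longleftrightarrow> (\<forall>x\<in>S. f differentiable at x) \<and>
    (\<forall>v. cont_diff_on k S (\<lambda>x. frechet_derivative f (at x) v))" (is "?l \<longleftrightarrow> ?r")
proof
  assume ?l
  then obtain f' where f': "\<And>x. x \<in> S \<Longrightarrow> (f has_derivative f' x) (at x)"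
    and c: "\<And>v. cont_diff_on k S (\<lambda>x. f' x v)" by auto
  have "cont_diff_on k S (\<lambda>x. frechet_derivative f (at x) v)" for v
    by (rule cont_diff_on_cong[OF assms _ c[of v]]) (metis f' frechet_derivative_at)
  then show ?r using f' by (auto intro: differentiableI)
next
  assume ?r then show ?l by (auto simp: frechet_derivative_works)
qed

lemma cont_diff_on_local:
  assumes "open S" "\<And>x. x \<in> S \<Longrightarrow> \<exists>T. open T \<and> x \<in> T \<and> cont_diff_on k T f"
  shows "cont_diff_on k S f"
  using assms(2)
proof (induction k arbitrary: f)
  case 0
  have "isCont f x" if "x \<in> S" for x
    using 0[OF that] continuous_on_eq_continuous_at by auto
  then show ?case
    by (simp add: continuous_at_imp_continuous_on)
next
  case (Suc k)
  have "f differentiable at x" if "x \<in> S" for x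
  proof -
    obtain T where "x \<in> T" "cont_diff_on (Suc k) T f" using Suc.prems \<open>x \<in> S\<close> by blast
    then show ?thesis by (auto intro: differentiableI)
  qed
  moreover have "cont_diff_on k S (\<lambda>x. frechet_derivative f (at x) v)" for v
  proof (rule Suc.IH)
    fix x assume "x \<in> S"
    then obtain T where "open T" "x \<in> T" "cont_diff_on (Suc k) T f" using Suc.prems by blast
    then show "\<exists>T. open T \<and> x \<in> T \<and> cont_diff_on k T (\<lambda>x. frechet_derivative f (at x) v)"
      using cont_diff_on_Suc_iff[of T k f] by auto
  qed
  ultimately show ?case by (simp only: cont_diff_on_Suc_iff[OF assms(1)]) simp
qed

lemma cont_diff_on_const: "cont_diff_on k S (\<lambda>x. c)"
proof (induction k arbitrary: c)
  case (Suc k)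
  have "\<forall>x\<in>S. ((\<lambda>x. c) has_derivative (\<lambda>v. 0)) (at x)" by simp
  then show ?case using Suc by (auto intro!: exI[of _ "\<lambda>x v. 0"])
qed simp

lemma cont_diff_on_linear: "bounded_linear f \<Longrightarrow> cont_diff_on k S f"
proof (cases k)
  case 0
  assume "bounded_linear f" then show ?thesis
    using 0 by (simp add: linear_continuous_on)
next
  case (Suc j)
  assume "bounded_linear f" then show ?thesis
    using Suc by (auto intro!: exI[of _ "\<lambda>x. f"] cont_diff_on_const bounded_linear_imp_has_derivative)
qed

lemma cont_diff_on_add:
  "cont_diff_on k S f \<Longrightarrow> cont_diff_on k S g \<Longrightarrow> cont_diff_on k S (\<lambda>x. f x + g x)"
proof (induction k arbitrary: f g)
  case 0 then show ?case by (simp add: continuous_on_add)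
next
  case (Suc k)
  then obtain f' g' where "\<forall>x\<in>S. (f has_derivative f' x) (at x)" "\<forall>v. cont_diff_on k S (\<lambda>x. f' x v)"
     "\<forall>x\<in>S. (g has_derivative g' x) (at x)" "\<forall>v. cont_diff_on k S (\<lambda>x. g' x v)" by auto
  then show ?case using Suc.IH
    by (auto intro!: exI[of _ "\<lambda>x v. f' x v + g' x v"] has_derivative_add)
qed

lemma cont_diff_on_bilinear:
  assumes "bounded_bilinear p"
  shows "cont_diff_on k S f \<Longrightarrow> cont_diff_on k S g \<Longrightarrow> cont_diff_on k S (\<lambda>x. p (f x) (g x))"
proof (induction k arbitrary: f g)
  case 0 then show ?case using assms by (simp add: bounded_bilinear.continuous_on)
next
  case (Suc k)
  then obtain f' g' where d: "\<forall>x\<in>S. (f has_derivative f' x) (at x)" "\<forall>v. cont_diff_on k S (\<lambda>x. f' x v)"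
     "\<forall>x\<in>S. (g has_derivative g' x) (at x)" "\<forall>v. cont_diff_on k S (\<lambda>x. g' x v)" by auto
  note c = Suc.prems[THEN cont_diff_on_SucD]
  show ?case
    unfolding cont_diff_on.simps
  proof (intro exI[of _ "\<lambda>x v. p (f x) (g' x v) + p (f' x v) (g x)"] conjI ballI allI)
    fix x assume "x \<in> S"
    then show "((\<lambda>x. p (f x) (g x)) has_derivative (\<lambda>v. p (f x) (g' x v) + p (f' x v) (g x))) (at x)"
      using d bounded_bilinear.FDERIV[OF assms] by blast
  next
    fix v
    show "cont_diff_on k S (\<lambda>x. p (f x) (g' x v) + p (f' x v) (g x))"
      using d c by (intro cont_diff_on_add Suc.IH) auto
  qed
qed

lemma cont_diff_on_sum:
  "(\<And>i. i \<in> A \<Longrightarrow> cont_diff_on k S (f i)) \<Longrightarrow> cont_diff_on k S (\<lambda>x. \<Sum>i\<in>A. f i x)"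
  by (induction A rule: infinite_finite_induct) (auto intro: cont_diff_on_const cont_diff_on_add)

text \<open>The recursion only controls derivatives in a fixed direction, but the chain rule
  evaluates the derivative of \<open>g\<close> in the moving direction \<open>f' x v\<close>.
  Expanding that direction in the orthonormal basis of the middle space leaves fixed directions with
  differentiable coefficients.\<close>

lemma cont_diff_on_compose:
  fixes f :: "'a::real_normed_vector \<Rightarrow> 'b::coordinate_space" and g :: "'b \<Rightarrow> 'c::real_normed_vector"
  shows "cont_diff_on k S f \<Longrightarrow> cont_diff_on k T g \<Longrightarrow> f ` S \<subseteq> T \<Longrightarrow> cont_diff_on k S (\<lambda>x. g (f x))"
proof (induction k arbitrary: f g)
  case 0 then show ?case by (auto intro: continuous_on_compose2)
next
  case (Suc k)
  then obtain f' g' where d: "\<forall>x\<in>S. (f has_derivative f' x) (at x)" "\<forall>v. cont_diff_on k S (\<lambda>x. f' x v)"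
     "\<forall>x\<in>T. (g has_derivative g' x) (at x)" "\<forall>v. cont_diff_on k T (\<lambda>x. g' x v)" by auto
  note c = Suc.prems(1,2)[THEN cont_diff_on_SucD] Suc.prems(3)
  show ?case
    unfolding cont_diff_on.simps
  proof (intro exI[of _ "\<lambda>x v. \<Sum>b\<in>onb. inner (f' x v) b *\<^sub>R g' (f x) b"] conjI ballI allI)
    fix x assume x: "x \<in> S"
    then have dg: "(g has_derivative g' (f x)) (at (f x))" and "(f has_derivative f' x) (at x)"
      using d Suc.prems(3) by auto
    then have "((\<lambda>x. g (f x)) has_derivative (\<lambda>v. g' (f x) (f' x v))) (at x)"
      using has_derivative_compose[of f "f' x" x UNIV g "g' (f x)"] by simp
    then show "((\<lambda>x. g (f x)) has_derivative (\<lambda>v. \<Sum>b\<in>onb. inner (f' x v) b *\<^sub>R g' (f x) b)) (at x)"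
      by (subst (asm) linear_onb[OF has_derivative_linear[OF dg]])
  next
    fix v
    have "cont_diff_on k S (\<lambda>x. inner (f' x v) b)" for b
      using d(2) by (intro cont_diff_on_bilinear[OF bounded_bilinear_inner]) (auto intro: cont_diff_on_const)
    then show "cont_diff_on k S (\<lambda>x. \<Sum>b\<in>onb. inner (f' x v) b *\<^sub>R g' (f x) b)"
      using d c by (intro cont_diff_on_sum cont_diff_on_bilinear[OF bounded_bilinear_scaleR] Suc.IH) auto
  qed
qed

lemma cont_diff_on_inverse:
  fixes f :: "'a::real_normed_vector \<Rightarrow> real"
  shows "cont_diff_on k S f \<Longrightarrow> (\<And>x. x \<in> S \<Longrightarrow> f x \<noteq> 0) \<Longrightarrow> cont_diff_on k S (\<lambda>x. inverse (f x))"
proof (induction k arbitrary: f)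
  case 0 then show ?case by (auto intro!: continuous_on_inverse)
next
  case (Suc k)
  then obtain f' where d: "\<forall>x\<in>S. (f has_derivative f' x) (at x)" "\<forall>v. cont_diff_on k S (\<lambda>x. f' x v)"
    by auto
  have i: "cont_diff_on k S (\<lambda>x. inverse (f x))"
    using Suc.IH Suc.prems cont_diff_on_SucD by blast
  show ?case
    unfolding cont_diff_on.simps
  \<comment> \<open>Written as a nested product with a constant factor, so that the closure rule for
    bilinear maps covers it.\<close>
  proof (intro exI[of _ "\<lambda>x v. - 1 * ((inverse (f x) * f' x v) * inverse (f x))"] conjI ballI allI)
    fix x assume "x \<in> S"
    then show "((\<lambda>x. inverse (f x)) has_derivative (\<lambda>v. - 1 * ((inverse (f x) * f' x v) * inverse (f x)))) (at x)"
      using d Suc.prems(2) by (auto intro!: derivative_eq_intros simp: fun_eq_iff)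
  next
    fix v
    show "cont_diff_on k S (\<lambda>x. - 1 * ((inverse (f x) * f' x v) * inverse (f x)))"
      using d i by (intro cont_diff_on_bilinear[OF bounded_bilinear_mult] cont_diff_on_const) auto
  qed
qed

text \<open>Smoothness of a germ: closure properties can be chained at a point without tracking a
  common open domain, which \<open>smooth_on_iff_near\<close> restores at the end.\<close>

definition smooth_near :: "('m::real_normed_vector \<Rightarrow> 'b::real_normed_vector) \<Rightarrow> 'm \<Rightarrow> bool" where
  "smooth_near f z \<longleftrightarrow> (\<exists>S. open S \<and> z \<in> S \<and> smooth_on S f)"

lemma smooth_on_iff_near: "open S \<Longrightarrow> smooth_on S f \<longleftrightarrow> (\<forall>z\<in>S. smooth_near f z)"
  unfolding smooth_near_def smooth_on_def by (intro iffI allI cont_diff_on_local) blast+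

lemma smooth_onD: "smooth_on S f \<Longrightarrow> cont_diff_on k S f"
  by (simp add: smooth_on_def)

lemma smooth_nearI: "open S \<Longrightarrow> z \<in> S \<Longrightarrow> (\<And>k. cont_diff_on k S f) \<Longrightarrow> smooth_near f z"
  unfolding smooth_near_def smooth_on_def by blast

lemma smooth_nearE:
  assumes "smooth_near f z"
  obtains S where "open S" "z \<in> S" "smooth_on S f"
  using assms unfolding smooth_near_def smooth_on_def by blast

lemma smooth_near_nhd:
  assumes "smooth_near f z" "smooth_near g z"
  obtains S where "open S" "z \<in> S" "smooth_on S f" "smooth_on S g"
proof -
  obtain S where S: "open S" "z \<in> S" "smooth_on S f" by (rule smooth_nearE[OF assms(1)])
  obtain T where T: "open T" "z \<in> T" "smooth_on T g" by (rule smooth_nearE[OF assms(2)])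
  show thesis
    by (rule that[of "S \<inter> T"]) (use S T in \<open>auto simp: smooth_on_def intro: cont_diff_on_subset[OF _ Int_lower1]
      cont_diff_on_subset[OF _ Int_lower2]\<close>)
qed

lemma smooth_near_cong:
  assumes "smooth_near f z" "open T" "z \<in> T" "\<And>y. y \<in> T \<Longrightarrow> f y = g y"
  shows "smooth_near g z"
proof -
  obtain S where S: "open S" "z \<in> S" "smooth_on S f" by (rule smooth_nearE[OF assms(1)])
  have "cont_diff_on k (S \<inter> T) g" for k
  proof (rule cont_diff_on_cong)
    show "cont_diff_on k (S \<inter> T) f" by (rule cont_diff_on_subset[OF S(3)[THEN smooth_onD] Int_lower1])
  qed (use S assms in auto)
  then show ?thesis using S assms by (intro smooth_nearI[of "S \<inter> T"]) auto
qed

lemma smooth_near_bilinear: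
  assumes "bounded_bilinear p" "smooth_near f z" "smooth_near g z"
  shows "smooth_near (\<lambda>x. p (f x) (g x)) z"
proof -
  obtain S where "open S" "z \<in> S" "smooth_on S f" "smooth_on S g"
    by (rule smooth_near_nhd[OF assms(2,3)])
  then show ?thesis by (intro smooth_nearI[of S]) (auto simp: smooth_on_def intro!: cont_diff_on_bilinear[OF assms(1)])
qed

lemmas smooth_near_scaleR = smooth_near_bilinear[OF bounded_bilinear_scaleR]
lemmas smooth_near_mult = smooth_near_bilinear[OF bounded_bilinear_mult]
lemmas smooth_near_inner = smooth_near_bilinear[OF bounded_bilinear_inner]

lemma smooth_near_add:
  assumes "smooth_near f z" "smooth_near g z"
  shows "smooth_near (\<lambda>x. f x + g x) z"
proof -
  obtain S where "open S" "z \<in> S" "smooth_on S f" "smooth_on S g"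
    by (rule smooth_near_nhd[OF assms])
  then show ?thesis by (intro smooth_nearI[of S]) (auto simp: smooth_on_def intro!: cont_diff_on_add)
qed

lemma smooth_near_linear: "bounded_linear f \<Longrightarrow> smooth_near f z"
  by (rule smooth_nearI[OF open_UNIV UNIV_I cont_diff_on_linear])

lemma smooth_near_const: "smooth_near (\<lambda>x. c) z"
  by (rule smooth_nearI[OF open_UNIV UNIV_I cont_diff_on_const])

lemma smooth_near_sum:
  "(\<And>i. i \<in> A \<Longrightarrow> smooth_near (f i) z) \<Longrightarrow> smooth_near (\<lambda>x. \<Sum>i\<in>A. f i x) z"
  by (induction A rule: infinite_finite_induct) (auto intro: smooth_near_const smooth_near_add)

lemma open_cont_diff_vimage:
  assumes "open S" "cont_diff_on k S f" "open T"
  shows "open (S \<inter> f -` T)"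
  using continuous_on_open_vimage[OF assms(1), of f] cont_diff_on_continuous[OF assms(2)] assms(3)
  by (simp add: Int_commute)

lemma smooth_near_inverse:
  fixes f :: "'a::real_normed_vector \<Rightarrow> real"
  assumes "smooth_near f z" "f z \<noteq> 0"
  shows "smooth_near (\<lambda>x. inverse (f x)) z"
proof -
  obtain S where S: "open S" "z \<in> S" "smooth_on S f" by (rule smooth_nearE[OF assms(1)])
  show ?thesis
  proof (rule smooth_nearI)
    show "open (S \<inter> f -` (- {0}))" by (rule open_cont_diff_vimage[OF S(1) S(3)[THEN smooth_onD]]) auto
    show "cont_diff_on k (S \<inter> f -` (- {0})) (\<lambda>x. inverse (f x))" for k
      by (rule cont_diff_on_inverse[OF cont_diff_on_subset[OF S(3)[THEN smooth_onD]]]) auto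
  qed (use S assms in auto)
qed

lemma smooth_near_compose:
  fixes f :: "'a::real_normed_vector \<Rightarrow> 'b::coordinate_space"
  assumes "smooth_near f z" "smooth_near g (f z)"
  shows "smooth_near (\<lambda>x. g (f x)) z"
proof -
  obtain S where S: "open S" "z \<in> S" "smooth_on S f" by (rule smooth_nearE[OF assms(1)])
  obtain T where T: "open T" "f z \<in> T" "smooth_on T g" by (rule smooth_nearE[OF assms(2)])
  show ?thesis
  proof (rule smooth_nearI)
    show "open (S \<inter> f -` T)" by (rule open_cont_diff_vimage[OF S(1) S(3)[THEN smooth_onD] T(1)])
    show "cont_diff_on k (S \<inter> f -` T) (\<lambda>x. g (f x))" for k
      by (rule cont_diff_on_compose[OF cont_diff_on_subset[OF S(3)[THEN smooth_onD]] T(3)[THEN smooth_onD]]) auto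
  qed (use S T in auto)
qed

lemma cont_diff_on_Pair:
  "cont_diff_on k S f \<Longrightarrow> cont_diff_on k S g \<Longrightarrow> cont_diff_on k S (\<lambda>x. (f x, g x))"
proof (induction k arbitrary: f g)
  case 0 then show ?case by (simp add: continuous_on_Pair)
next
  case (Suc k)
  then obtain f' g' where "\<forall>x\<in>S. (f has_derivative f' x) (at x)" "\<forall>v. cont_diff_on k S (\<lambda>x. f' x v)"
     "\<forall>x\<in>S. (g has_derivative g' x) (at x)" "\<forall>v. cont_diff_on k S (\<lambda>x. g' x v)" by auto
  then show ?case using Suc.IH
    by (auto intro!: exI[of _ "\<lambda>x v. (f' x v, g' x v)"] has_derivative_Pair)
qed

lemma smooth_near_Pair:
  assumes "smooth_near f z" "smooth_near g z"
  shows "smooth_near (\<lambda>x. (f x, g x)) z"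
proof -
  obtain S where "open S" "z \<in> S" "smooth_on S f" "smooth_on S g"
    by (rule smooth_near_nhd[OF assms])
  then show ?thesis by (intro smooth_nearI[of S]) (auto simp: smooth_on_def intro!: cont_diff_on_Pair)
qed

lemma smooth_near_differentiable: "smooth_near f z \<Longrightarrow> f differentiable at z"
  by (metis (no_types) cont_diff_on.simps(2) differentiableI smooth_nearE smooth_onD)

section \<open>Bump functions\<close>

text \<open>The flat function exp(-1/t) with all its pole factors. By \<open>flat_exp_deriv\<close>
  the derivative of member \<open>n\<close> combines members \<open>n + 1\<close> and
  \<open>n + 2\<close>, so the family is closed under differentiation and one induction over the
  order proves all members smooth.\<close>

definition flat_exp :: "nat \<Rightarrow> real \<Rightarrow> real" where
  "flat_exp n t = (if t > 0 then (1 / t) ^ n * exp (- (1 / t)) else 0)"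

lemma flat_exp_tendsto_0: "(flat_exp n \<longlongrightarrow> 0) (at 0)"
proof -
  have "((\<lambda>t. (1 / t) ^ n / exp (1 / t)) \<longlongrightarrow> 0) (at_right (0::real))"
    by (rule filterlim_compose[OF tendsto_power_div_exp_0 filterlim_inverse_at_top_right, folded divide_inverse,
        unfolded inverse_eq_divide])
  then have "(flat_exp n \<longlongrightarrow> 0) (at_right 0)"
    by (rule filterlim_mono_eventually[OF _ order_refl order_refl])
      (auto simp: flat_exp_def exp_minus field_simps intro: eventually_mono[OF eventually_at_right_less[of 0]])
  moreover have "(flat_exp n \<longlongrightarrow> 0) (at_left 0)"
    by (rule filterlim_mono_eventually[OF tendsto_const order_refl order_refl])
      (auto simp: flat_exp_def eventually_at_left_field intro!: exI[of _ "-1"])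
  ultimately show ?thesis by (simp add: filterlim_split_at)
qed

lemma flat_exp_deriv:
  "(flat_exp n has_real_derivative flat_exp (n + 2) t - real n * flat_exp (n + 1) t) (at t)"
proof -
  consider "t > 0" | "t < 0" | "t = 0" by linarith
  then show ?thesis
  proof cases
    case 1
    have i: "((\<lambda>t. 1 / t) has_real_derivative - ((1 / t) * (1 / t))) (at t)"
      using 1 by (auto intro!: derivative_eq_intros)
    have p: "((\<lambda>t. (1 / t) ^ n) has_real_derivative - real n * (1 / t) ^ Suc n) (at t)"

    proof (cases n)
      case (Suc m)
      have "((\<lambda>t. (1 / t) ^ Suc m) has_real_derivative
          (1 + real m) * (- ((1 / t) * (1 / t)) * (1 / t) ^ m)) (at t)"
        by (rule DERIV_power_Suc[OF i])
      moreover have "(1 + real m) * (- ((1 / t) * (1 / t)) * (1 / t) ^ m) = - real n * (1 / t) ^ Suc n"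
        unfolding Suc by (simp only: power_Suc of_nat_Suc) algebra
      ultimately show ?thesis unfolding Suc by (simp only:)
    qed simp
    have "((\<lambda>t. (1 / t) ^ n * exp (- (1 / t))) has_real_derivative
        flat_exp (n + 2) t - real n * flat_exp (n + 1) t) (at t)"
      using DERIV_mult[OF p DERIV_fun_exp[OF DERIV_minus[OF i]]] 1
      by (simp add: flat_exp_def algebra_simps)
    then show ?thesis
      by (rule has_field_derivative_transform_within_open[of _ _ _ "{0<..}"]) (use 1 in \<open>auto simp: flat_exp_def\<close>)
  next
    case 2
    have "((\<lambda>t. 0) has_real_derivative flat_exp (n + 2) t - real n * flat_exp (n + 1) t) (at t)"
      using 2 by (simp add: flat_exp_def)
    then show ?thesis
      by (rule has_field_derivative_transform_within_open[of _ _ _ "{..<0}"]) (use 2 in \<open>auto simp: flat_exp_def\<close>)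
  next
    case 3
    \<comment> \<open>At the origin the difference quotient of member \<open>n\<close> is member
      \<open>n + 1\<close>, which tends to 0.\<close>
    have "((\<lambda>h. (flat_exp n (0 + h) - flat_exp n 0) / h) \<longlongrightarrow> 0) (at 0)"
      by (rule filterlim_mono_eventually[OF flat_exp_tendsto_0[of "Suc n"] order_refl order_refl])
        (auto simp: flat_exp_def eventually_at_filter)
    then show ?thesis using 3 by (simp add: DERIV_def flat_exp_def)
  qed
qed

lemma cont_diff_on_flat_exp: "cont_diff_on k UNIV (flat_exp n)"
proof (induction k arbitrary: n)
  case 0
  then show ?case
    using DERIV_isCont[OF flat_exp_deriv] by (simp add: continuous_at_imp_continuous_on)
next
  case (Suc k)
  show ?case unfolding cont_diff_on.simps
  proof (intro exI[of _ "\<lambda>t v. (flat_exp (n + 2) t + (- real n) * flat_exp (n + 1) t) * v"] conjI ballI allI)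
    show "(flat_exp n has_derivative (\<lambda>v. (flat_exp (n + 2) t + - real n * flat_exp (n + 1) t) * v)) (at t)" for t
      using flat_exp_deriv[of n t] by (simp add: has_field_derivative_def mult.commute[of _ "_ - _"] cong: if_cong)
    show "cont_diff_on k UNIV (\<lambda>t. (flat_exp (n + 2) t + - real n * flat_exp (n + 1) t) * v)" for v
      by (intro cont_diff_on_bilinear[OF bounded_bilinear_mult] cont_diff_on_add cont_diff_on_const Suc.IH)
  qed
qed

lemma smooth_near_flat_exp: "smooth_near (flat_exp n) t"
  by (rule smooth_nearI[OF open_UNIV UNIV_I cont_diff_on_flat_exp])

lemma bump_function:
  fixes z0 :: "'m::coordinate_space"
  assumes "0 < s"
  obtains b :: "'m \<Rightarrow> real" where "\<And>z. smooth_near b z" "\<And>z. dist z z0 < s \<Longrightarrow> b z = 1"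
    "\<And>z. 2 * s \<le> dist z z0 \<Longrightarrow> b z = 0"
proof -
  \<comment> \<open>\<open>p\<close> is 2 - |z - z0|^2 / s^2, which is at least 1 within distance
    \<open>s\<close> and at most 0 beyond distance \<open>2 * s\<close>; \<open>b\<close> is the
    usual smooth step applied to \<open>p\<close>. The denominator never vanishes, since
    \<open>p\<close> and \<open>q = 1 - p\<close> cannot both be at most 0. Sums with negated terms
    match the available closure rules.\<close>
  define p where "p z = 2 + (- 1 / s\<^sup>2) * inner (z + - z0) (z + - z0)" for z :: 'm
  define q where "q z = 1 + (-1) * p z" for z
  define b where "b z = flat_exp 0 (p z) * inverse (flat_exp 0 (p z) + flat_exp 0 (q z))" for z
  have p: "smooth_near p z" for z
    unfolding p_def by (intro smooth_near_add smooth_near_mult smooth_near_inner smooth_near_const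
        smooth_near_linear bounded_linear_ident)
  have q: "smooth_near q z" for z
    unfolding q_def by (intro smooth_near_add smooth_near_mult smooth_near_const p)
  have pos: "flat_exp 0 t + flat_exp 0 (1 + (-1) * t) \<noteq> 0" for t
    by (rule less_imp_neq[symmetric]) (auto simp: flat_exp_def intro!: add_pos_pos)
  have sm: "smooth_near b z" for z
    unfolding b_def
    by (intro smooth_near_mult smooth_near_inverse smooth_near_add
        smooth_near_compose[OF p smooth_near_flat_exp] smooth_near_compose[OF q smooth_near_flat_exp])
      (simp only: q_def pos simp_thms not_False_eq_True)
  have pd: "p z = 2 - (dist z z0)\<^sup>2 / s\<^sup>2" for z
    by (simp add: p_def dist_norm power2_norm_eq_inner)
  show thesis
  proof (rule that[of b])
    show "smooth_near b z" for z by (rule sm)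
  next
    fix z assume "dist z z0 < s"
    then have "(dist z z0)\<^sup>2 \<le> s\<^sup>2" by (intro power_mono) auto
    then have "p z \<ge> 1" using assms by (simp add: pd field_simps)
    then show "b z = 1" by (simp add: b_def q_def flat_exp_def)
  next
    fix z assume "2 * s \<le> dist z z0"
    then have "(2 * s)\<^sup>2 \<le> (dist z z0)\<^sup>2" using assms by (intro power_mono) auto
    then have "p z \<le> 0" using assms
      by (simp add: pd field_simps power_mult_distrib) (use zero_le_power2[of s] in linarith)
    then show "b z = 0" by (simp add: b_def flat_exp_def)
  qed
qed

section \<open>Hadamard's lemma\<close>

lemma segment_mem:
  assumes "convex S" "z0 \<in> S" "z \<in> S" "t \<in> {0..1::real}"
  shows "z0 + t *\<^sub>R (z - z0) \<in> S"
  using convexD[OF assms(1,2,3), of "1 - t" t] assms(4) by (simp add: algebra_simps)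

text \<open>Differentiation under the integral sign. Each derivative in \<open>z\<close> brings out
  another factor \<open>t\<close>, so the statement carries a power \<open>t ^ n\<close> and the
  induction runs over all \<open>n\<close> at once.\<close>

lemma cont_diff_on_param_integral:
  fixes F :: "'m::coordinate_space \<Rightarrow> real"
  assumes S: "open S" "convex S" "z0 \<in> S"
  shows "cont_diff_on k S F \<Longrightarrow> cont_diff_on k S (\<lambda>z. integral (cbox 0 1) (\<lambda>t. t ^ n * F (z0 + t *\<^sub>R (z - z0))))"
proof (induction k arbitrary: n F)
  case 0
  have "continuous_on (S \<times> cbox 0 1) (\<lambda>p. snd p ^ n * F (z0 + snd p *\<^sub>R (fst p - z0)))"
    using 0 segment_mem[OF S(2,3)]
    by (auto intro!: continuous_intros intro: continuous_on_compose2[where f = "\<lambda>p. z0 + snd p *\<^sub>R (fst p - z0)"])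
  then show ?case
    by (simp only: cont_diff_on.simps(1)) (rule integral_continuous_on_param, simp add: case_prod_beta')
next
  case (Suc k)
  then obtain F' where F': "\<And>z. z \<in> S \<Longrightarrow> (F has_derivative F' z) (at z)"
    and c: "\<And>v. cont_diff_on k S (\<lambda>z. F' z v)" by auto
  have cF: "continuous_on S F" using Suc.prems cont_diff_on_continuous by blast
  have cF': "continuous_on S (\<lambda>z. F' z v)" for v using c cont_diff_on_continuous by blast
  \<comment> \<open>The gradient of the integrand. Representing the derivative as the inner product
    with \<open>G\<close> reduces its continuity in the operator norm to that of finitely many
    directional derivatives.\<close>
  define G where "G z t = t ^ Suc n *\<^sub>R (\<Sum>b\<in>onb. F' (z0 + t *\<^sub>R (z - z0)) b *\<^sub>R b)" for z t
  define fx where "fx z t = blinfun_inner_right (G z t)" for z t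
  have fx: "blinfun_apply (fx z t) v = t ^ Suc n * F' (z0 + t *\<^sub>R (z - z0)) v"
    if "z \<in> S" "t \<in> {0..1}" for z t v
  proof -
    have "F' (z0 + t *\<^sub>R (z - z0)) v = (\<Sum>b\<in>onb. inner v b *\<^sub>R F' (z0 + t *\<^sub>R (z - z0)) b)"
      by (rule linear_onb[OF has_derivative_linear[OF F'[OF segment_mem[OF S(2,3) that]]]])
    then show ?thesis
      by (simp add: fx_def G_def inner_sum_left inner_sum_right inner_commute mult.commute)
  qed
  have cG: "continuous_on (S \<times> cbox 0 1) (\<lambda>(z, t). fx z t)"
    unfolding fx_def G_def case_prod_beta'
    using segment_mem[OF S(2,3)]
    by (auto intro!: continuous_intros bounded_linear.continuous_on[OF bounded_linear_blinfun_inner_right]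
        intro: continuous_on_compose2[OF cF', where f = "\<lambda>p. z0 + snd p *\<^sub>R (fst p - z0)"])
  have d: "((\<lambda>z. integral (cbox 0 1) (\<lambda>t. t ^ n * F (z0 + t *\<^sub>R (z - z0)))) has_derivative
      (\<lambda>v. integral (cbox 0 1) (\<lambda>t. t ^ Suc n * F' (z0 + t *\<^sub>R (z - z0)) v))) (at z)" if z: "z \<in> S" for z
  proof -
    have "((\<lambda>z. integral (cbox 0 1) (\<lambda>t. t ^ n * F (z0 + t *\<^sub>R (z - z0)))) has_derivative
        blinfun_apply (integral (cbox 0 1) (fx z))) (at z within S)"
    proof (rule leibniz_rule[OF _ _ cG z S(2)])
      fix x :: 'm and t :: real assume x: "x \<in> S" and t: "t \<in> cbox 0 1"
      then have m: "z0 + t *\<^sub>R (x - z0) \<in> S" using segment_mem[OF S(2,3) x] by simp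
      have "((\<lambda>x. F (z0 + t *\<^sub>R (x - z0))) has_derivative (\<lambda>v. F' (z0 + t *\<^sub>R (x - z0)) (t *\<^sub>R v))) (at x within S)"
      proof (rule has_derivative_compose[of "\<lambda>x. z0 + t *\<^sub>R (x - z0)" "\<lambda>v. t *\<^sub>R v" x S F, OF _ F'[OF m]])
        show "((\<lambda>x. z0 + t *\<^sub>R (x - z0)) has_derivative (\<lambda>v. t *\<^sub>R v)) (at x within S)"
          by (auto intro!: derivative_eq_intros)
      qed
      then have "((\<lambda>x. t ^ n * F (z0 + t *\<^sub>R (x - z0))) has_derivative
          (\<lambda>v. t ^ n * F' (z0 + t *\<^sub>R (x - z0)) (t *\<^sub>R v))) (at x within S)"
        by (rule has_derivative_mult_right)
      moreover have "(\<lambda>v. t ^ n * F' (z0 + t *\<^sub>R (x - z0)) (t *\<^sub>R v)) = blinfun_apply (fx x t)"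
        using fx[OF x, of t] t linear_scale[OF has_derivative_linear[OF F'[OF m]], of t]
        by (simp add: fun_eq_iff)
      ultimately show "((\<lambda>x. t ^ n * F (z0 + t *\<^sub>R (x - z0))) has_derivative blinfun_apply (fx x t)) (at x within S)"
        by (simp only:)
    next
      fix x assume x: "x \<in> S"
      have "continuous_on {0..1} (\<lambda>t. t ^ n * F (z0 + t *\<^sub>R (x - z0)))"
        using segment_mem[OF S(2,3) x]
        by (auto intro!: continuous_intros intro: continuous_on_compose2[OF cF])
      then show "(\<lambda>t. t ^ n * F (z0 + t *\<^sub>R (x - z0))) integrable_on cbox 0 1"
        by (simp add: integrable_continuous_interval)
    qed
    moreover have "fx z integrable_on cbox 0 1"
    proof (rule integrable_continuous)
      show "continuous_on (cbox 0 1) (fx z)"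
      proof -
        have "continuous_on (cbox 0 1) (\<lambda>t. (z, t))" by (intro continuous_intros)
        from continuous_on_compose2[OF cG this] show ?thesis using z by auto
      qed
    qed
    then have "blinfun_apply (integral (cbox 0 1) (fx z)) =
        (\<lambda>v. integral (cbox 0 1) (\<lambda>t. t ^ Suc n * F' (z0 + t *\<^sub>R (z - z0)) v))"
      by (intro ext, subst blinfun_apply_integral) (auto intro!: integral_cong simp: fx z)
    ultimately show ?thesis
      using at_within_open[OF z S(1)] by (simp only:)
  qed
  show ?case unfolding cont_diff_on.simps
    by (intro exI[of _ "\<lambda>z v. integral (cbox 0 1) (\<lambda>t. t ^ Suc n * F' (z0 + t *\<^sub>R (z - z0)) v)"] conjI ballI allI
        d Suc.IH c)
qed

text \<open>Convexity keeps the segment from \<open>z0\<close> to \<open>z\<close> inside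
  \<open>S\<close>. Integrating the derivative along it gives \<open>F z - F z0\<close>, and
  expanding the direction \<open>z - z0\<close> in the basis makes \<open>H b\<close> the average
  over the segment of the derivative in direction \<open>b\<close>.\<close>

lemma Hadamard_lemma:
  fixes F :: "'m::coordinate_space \<Rightarrow> real"
  assumes S: "open S" "convex S" "z0 \<in> S" and F: "smooth_on S F"
  obtains H where "\<And>b. smooth_on S (H b)"
    "\<And>z. z \<in> S \<Longrightarrow> F z = F z0 + (\<Sum>b\<in>onb. inner (z - z0) b * H b z)"
proof -
  define F' where "F' z = frechet_derivative F (at z)" for z
  have d: "(F has_derivative F' z) (at z)" if "z \<in> S" for z
    using F cont_diff_on_Suc_iff[OF S(1), of 0 F] that
    by (simp add: F'_def smooth_on_def frechet_derivative_works[symmetric] del: cont_diff_on.simps)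
  have c: "cont_diff_on k S (\<lambda>z. F' z v)" for k v
    using F cont_diff_on_Suc_iff[OF S(1), of k F] by (simp add: F'_def smooth_on_def del: cont_diff_on.simps)
  \<comment> \<open>The factor \<open>t ^ 0\<close> makes this the instance \<open>n = 0\<close> of
    the parameter integral.\<close>
  define H where "H b z = integral (cbox 0 1) (\<lambda>t::real. t ^ 0 * F' (z0 + t *\<^sub>R (z - z0)) b)" for b z
  show thesis
  proof (rule that[of H])
    show "smooth_on S (H b)" for b
      unfolding smooth_on_def H_def using cont_diff_on_param_integral[OF S c] by blast
  next
    fix z assume z: "z \<in> S"
    let ?p = "\<lambda>t::real. z0 + t *\<^sub>R (z - z0)"
    have i: "(\<lambda>t. F' (?p t) b) integrable_on {0..1}" for b
      using segment_mem[OF S(2,3) z] cont_diff_on_continuous[OF c[of 0 b]]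
      by (intro integrable_continuous_interval)
        (auto intro!: continuous_intros intro: continuous_on_compose2)
    have "((\<lambda>t. F' (?p t) (z - z0)) has_integral F (?p 1) - F (?p 0)) {0..1}"
    proof (rule fundamental_theorem_of_calculus)
      fix t :: real assume "t \<in> {0..1}"
      then have dF: "(F has_derivative F' (?p t)) (at (?p t))" using d segment_mem[OF S(2,3) z] by blast
      have "(?p has_derivative (\<lambda>v. v *\<^sub>R (z - z0))) (at t within {0..1})"
        by (auto intro!: derivative_eq_intros)
      then have "((\<lambda>t. F (?p t)) has_derivative (\<lambda>v. F' (?p t) (v *\<^sub>R (z - z0)))) (at t within {0..1})"
        using has_derivative_compose[of ?p "\<lambda>v. v *\<^sub>R (z - z0)" t "{0..1}" F "F' (?p t)", OF _ dF] by blast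
      then show "((\<lambda>t. F (?p t)) has_vector_derivative F' (?p t) (z - z0)) (at t within {0..1})"
        using linear_scale[OF has_derivative_linear[OF dF]]
        by (simp add: has_vector_derivative_def)
    qed simp
    then have "F z - F z0 = integral {0..1} (\<lambda>t. F' (?p t) (z - z0))"
      by (simp add: integral_unique)
    also have "\<dots> = integral {0..1} (\<lambda>t. \<Sum>b\<in>onb. inner (z - z0) b *\<^sub>R F' (?p t) b)"
      by (rule integral_cong)
        (rule linear_onb[OF has_derivative_linear[OF d[OF segment_mem[OF S(2,3) z]]]])
    also have "\<dots> = (\<Sum>b\<in>onb. inner (z - z0) b * H b z)"
      by (subst integral_sum) (auto simp: H_def intro!: integrable_on_mult_right i)
    finally show "F z = F z0 + (\<Sum>b\<in>onb. inner (z - z0) b * H b z)" by simp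
  qed
qed

section \<open>Manifolds\<close>

text \<open>A manifold without the separation and countability axioms.  These are only needed for bump
  functions, and those on a total space are pulled back from the base.\<close>

definition premanifold :: "('a, 'm::coordinate_space) manifold \<Rightarrow> bool" where
  "premanifold M \<longleftrightarrow>
     (\<forall>(U, \<phi>)\<in>atlas M. U \<subseteq> pts M \<and> inj_on \<phi> U \<and> open (\<phi> ` U)) \<and>
     (\<Union>(U, \<phi>)\<in>atlas M. U) = pts M \<and>
     (\<forall>(U, \<phi>)\<in>atlas M. \<forall>(V, \<psi>)\<in>atlas M.
        open (\<phi> ` (U \<inter> V)) \<and> smooth_on (\<phi> ` (U \<inter> V)) (\<psi> \<circ> inv_into U \<phi>))"

lemma smooth_manifold_premanifold: "smooth_manifold M \<Longrightarrow> premanifold M"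
  by (simp add: smooth_manifold_def premanifold_def)

lemma premanifoldD:
  assumes "premanifold M" "(U, \<phi>) \<in> atlas M"
  shows "U \<subseteq> pts M" "inj_on \<phi> U" "open (\<phi> ` U)"
  using assms by (auto simp: premanifold_def)

lemma premanifold_transition:
  assumes "premanifold M" "(U, \<phi>) \<in> atlas M" "(V, \<psi>) \<in> atlas M"
  shows "open (\<phi> ` (U \<inter> V))" "smooth_on (\<phi> ` (U \<inter> V)) (\<psi> \<circ> inv_into U \<phi>)"
  using assms by (auto simp: premanifold_def)

lemma premanifold_chart:
  assumes "premanifold M" "p \<in> pts M"
  obtains U \<phi> where "(U, \<phi>) \<in> atlas M" "p \<in> U"
proof -
  have "p \<in> (\<Union>(U, \<phi>)\<in>atlas M. U)" using assms by (simp add: premanifold_def)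
  then show thesis using that by auto
qed

text \<open>The predicate behind \<open>mtopology\<close>. Working with it directly avoids the
  abstract topology type, to which it is linked only once it is known to define a topology, in
  \<open>openin_mtopology\<close>.\<close>

definition mopen :: "('a, 'm::coordinate_space) manifold \<Rightarrow> 'a set \<Rightarrow> bool" where
  "mopen M W \<longleftrightarrow> W \<subseteq> pts M \<and> (\<forall>(U, \<phi>)\<in>atlas M. open (\<phi> ` (W \<inter> U)))"

lemma mopenD: "mopen M W \<Longrightarrow> (U, \<phi>) \<in> atlas M \<Longrightarrow> open (\<phi> ` (W \<inter> U))"
  by (auto simp: mopen_def)

lemma mopen_subset: "mopen M W \<Longrightarrow> W \<subseteq> pts M"
  by (auto simp: mopen_def)

lemma mopen_Int:
  assumes "premanifold M" "mopen M W" "mopen M W'"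
  shows "mopen M (W \<inter> W')"
proof -
  have "open (\<phi> ` (W \<inter> W' \<inter> U))" if c: "(U, \<phi>) \<in> atlas M" for U \<phi>
  proof -
    have "\<phi> ` (W \<inter> W' \<inter> U) = \<phi> ` (W \<inter> U) \<inter> \<phi> ` (W' \<inter> U)"
      using inj_on_image_Int[OF premanifoldD(2)[OF assms(1) c], of "W \<inter> U" "W' \<inter> U"]
      by (simp add: Int_ac)
    then show ?thesis using mopenD[OF assms(2) c] mopenD[OF assms(3) c] by (simp add: open_Int)
  qed
  then show ?thesis using assms by (auto simp: mopen_def)
qed

lemma mopen_Union:
  assumes "\<And>W. W \<in> \<W> \<Longrightarrow> mopen M W"
  shows "mopen M (\<Union>\<W>)"
proof -
  have "open (\<phi> ` (\<Union>\<W> \<inter> U))" if c: "(U, \<phi>) \<in> atlas M" for U \<phi>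
  proof -
    have "\<phi> ` (\<Union>\<W> \<inter> U) = (\<Union>W\<in>\<W>. \<phi> ` (W \<inter> U))" by blast
    then show ?thesis using assms mopenD c by (metis open_UN)
  qed
  then show ?thesis using assms unfolding mopen_def by blast
qed

lemma mopen_pts: "premanifold M \<Longrightarrow> mopen M (pts M)"
  unfolding mopen_def using premanifoldD by (fastforce simp: Int_absorb1)

lemma mopen_chart: "premanifold M \<Longrightarrow> (U, \<phi>) \<in> atlas M \<Longrightarrow> mopen M U"
  unfolding mopen_def using premanifoldD premanifold_transition
  by (metis (no_types, lifting) Int_commute case_prodI2 prod.inject)

lemma openin_mtopology:
  assumes "premanifold M"
  shows "openin (mtopology M) W \<longleftrightarrow> mopen M W"
proof -
  have "istopology (mopen M)"
    unfolding istopology_def using mopen_Int[OF assms] mopen_Union by blast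
  then have "openin (topology (mopen M)) = mopen M" by (rule topology_inverse')
  moreover have "mtopology M = topology (mopen M)"
    unfolding mtopology_def mopen_def ..
  ultimately show ?thesis by simp
qed

lemma topspace_mtopology: "premanifold M \<Longrightarrow> topspace (mtopology M) = pts M"
  using openin_mtopology[of M] mopen_pts[of M] mopen_subset[of M]
  by (metis openin_subset openin_topspace subset_antisym)

text \<open>Continuity of a chart: seen in another chart, the set is the preimage of
  \<open>S\<close> under a transition map, which is continuous on an open set.\<close>

lemma mopen_chart_vimage:
  assumes "premanifold M" "(U, \<phi>) \<in> atlas M" "open S"
  shows "mopen M (U \<inter> \<phi> -` S)"
proof -
  have "open (\<psi> ` (U \<inter> \<phi> -` S \<inter> V))" if c: "(V, \<psi>) \<in> atlas M" for V \<psi>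
  proof -
    note i = premanifoldD(2)[OF assms(1) c]
    have t: "open (\<psi> ` (V \<inter> U))" "smooth_on (\<psi> ` (V \<inter> U)) (\<phi> \<circ> inv_into V \<psi>)"
      using premanifold_transition[OF assms(1) c assms(2)] by auto
    have "\<psi> ` (U \<inter> \<phi> -` S \<inter> V) = \<psi> ` (V \<inter> U) \<inter> (\<phi> \<circ> inv_into V \<psi>) -` S"
      using i by (auto simp: image_iff)
    then show ?thesis using open_cont_diff_vimage[OF t(1) smooth_onD[OF t(2)] assms(3)] by simp
  qed
  then show ?thesis using premanifoldD(1)[OF assms(1,2)] by (auto simp: mopen_def)
qed

definition smooth_at :: "('a, 'm::coordinate_space) manifold \<Rightarrow> ('a \<Rightarrow> 'b::real_normed_vector) \<Rightarrow> 'a \<Rightarrow> bool" where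
  "smooth_at M f p \<longleftrightarrow> (\<exists>(U, \<phi>)\<in>atlas M. p \<in> U \<and> smooth_near (\<lambda>z. f (inv_into U \<phi> z)) (\<phi> p))"

text \<open>Two coordinate expressions of \<open>f\<close> differ by a transition map that is smooth
  near the point, so smoothness in one chart gives smoothness in every chart around it.\<close>

lemma smooth_at_chart:
  assumes M: "premanifold M" and c: "(U, \<phi>) \<in> atlas M" and p: "p \<in> U"
  shows "smooth_at M f p \<longleftrightarrow> smooth_near (\<lambda>z. f (inv_into U \<phi> z)) (\<phi> p)"
proof
  assume "smooth_at M f p"
  then obtain V \<psi> where d: "(V, \<psi>) \<in> atlas M" "p \<in> V" "smooth_near (\<lambda>z. f (inv_into V \<psi> z)) (\<psi> p)"
    unfolding smooth_at_def by blast
  note t = premanifold_transition[OF M c d(1)]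
  have ip: "inv_into U \<phi> (\<phi> p) = p" using premanifoldD(2)[OF M c] p by simp
  have zp: "\<phi> p \<in> \<phi> ` (U \<inter> V)" using p d by blast
  have "smooth_near (\<psi> \<circ> inv_into U \<phi>) (\<phi> p)"
    using t zp smooth_on_iff_near by blast
  then have "smooth_near (\<lambda>z. f (inv_into V \<psi> ((\<psi> \<circ> inv_into U \<phi>) z))) (\<phi> p)"
    by (rule smooth_near_compose) (simp add: ip d)
  then show "smooth_near (\<lambda>z. f (inv_into U \<phi> z)) (\<phi> p)"
    by (rule smooth_near_cong[OF _ t(1) zp])
      (use premanifoldD(2)[OF M c] premanifoldD(2)[OF M d(1)] in auto)
next
  assume "smooth_near (\<lambda>z. f (inv_into U \<phi> z)) (\<phi> p)"
  then show "smooth_at M f p" using c p unfolding smooth_at_def by blast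
qed

lemma smooth_fun_on_iff:
  assumes M: "premanifold M" and W: "mopen M W"
  shows "smooth_fun_on M W f \<longleftrightarrow> (\<forall>p\<in>W. smooth_at M f p)"
proof
  assume f: "smooth_fun_on M W f"
  show "\<forall>p\<in>W. smooth_at M f p"
  proof
    fix p assume p: "p \<in> W"
    then obtain U \<phi> where c: "(U, \<phi>) \<in> atlas M" "p \<in> U"
      using premanifold_chart[OF M] mopen_subset[OF W] by blast
    have "smooth_on (\<phi> ` (U \<inter> W)) (f \<circ> inv_into U \<phi>)" using f c by (auto simp: smooth_fun_on_def)
    moreover have "open (\<phi> ` (U \<inter> W))" using mopenD[OF W c(1)] by (simp add: Int_commute)
    ultimately have "smooth_near (f \<circ> inv_into U \<phi>) (\<phi> p)" using smooth_on_iff_near c p by blast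
    then show "smooth_at M f p" by (simp add: smooth_at_chart[OF M c] o_def)
  qed
next
  assume f: "\<forall>p\<in>W. smooth_at M f p"
  have "smooth_on (\<phi> ` (U \<inter> W)) (f \<circ> inv_into U \<phi>)" if c: "(U, \<phi>) \<in> atlas M" for U \<phi>
  proof -
    have o: "open (\<phi> ` (U \<inter> W))" using mopenD[OF W c(1)] by (simp add: Int_commute)
    show ?thesis unfolding smooth_on_iff_near[OF o]
      using f by (auto simp: o_def smooth_at_chart[OF M c])
  qed
  then show "smooth_fun_on M W f" by (auto simp: smooth_fun_on_def)
qed

lemma Cinf_iff: "premanifold M \<Longrightarrow> f \<in> Cinf M \<longleftrightarrow> (\<forall>p\<in>pts M. smooth_at M f p)"
  by (simp add: Cinf_def smooth_fun_on_iff mopen_pts)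

lemma CinfI: "premanifold M \<Longrightarrow> (\<And>p. p \<in> pts M \<Longrightarrow> smooth_at M f p) \<Longrightarrow> f \<in> Cinf M"
  by (simp add: Cinf_iff)

lemma CinfD: "premanifold M \<Longrightarrow> f \<in> Cinf M \<Longrightarrow> p \<in> pts M \<Longrightarrow> smooth_at M f p"
  by (simp add: Cinf_iff)

lemma smooth_at_cong:
  assumes M: "premanifold M" and f: "smooth_at M f p" and W: "mopen M W" "p \<in> W"
    and eq: "\<And>x. x \<in> W \<Longrightarrow> f x = g x"
  shows "smooth_at M g p"
proof -
  obtain U \<phi> where c: "(U, \<phi>) \<in> atlas M" "p \<in> U"
    using premanifold_chart[OF M] mopen_subset W by blast
  have "smooth_near (\<lambda>z. f (inv_into U \<phi> z)) (\<phi> p)" using f by (simp add: smooth_at_chart[OF M c])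
  then have "smooth_near (\<lambda>z. g (inv_into U \<phi> z)) (\<phi> p)"
    by (rule smooth_near_cong[OF _ mopenD[OF W(1) c(1)]])
      (use c W eq premanifoldD(2)[OF M c(1)] in auto)
  then show ?thesis by (simp add: smooth_at_chart[OF M c])
qed

lemma smooth_at_bilinear:
  assumes "premanifold M" "bounded_bilinear q" "smooth_at M f p" "smooth_at M g p"
  shows "smooth_at M (\<lambda>x. q (f x) (g x)) p"
proof -
  obtain U \<phi> where c: "(U, \<phi>) \<in> atlas M" "p \<in> U" using assms unfolding smooth_at_def by blast
  show ?thesis using assms(3,4) unfolding smooth_at_chart[OF assms(1) c]
    by (rule smooth_near_bilinear[OF assms(2)])
qed

lemmas smooth_at_scaleR = smooth_at_bilinear[OF _ bounded_bilinear_scaleR]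
lemmas smooth_at_mult = smooth_at_bilinear[OF _ bounded_bilinear_mult]
lemmas smooth_at_inner = smooth_at_bilinear[OF _ bounded_bilinear_inner]

lemma smooth_at_add:
  assumes "premanifold M" "smooth_at M f p" "smooth_at M g p"
  shows "smooth_at M (\<lambda>x. f x + g x) p"
proof -
  obtain U \<phi> where c: "(U, \<phi>) \<in> atlas M" "p \<in> U" using assms unfolding smooth_at_def by blast
  show ?thesis using assms(2,3) unfolding smooth_at_chart[OF assms(1) c]
    by (rule smooth_near_add)
qed

lemma smooth_at_const:
  assumes "premanifold M" "p \<in> pts M"
  shows "smooth_at M (\<lambda>x. c) p"
proof -
  obtain U \<phi> where "(U, \<phi>) \<in> atlas M" "p \<in> U" by (rule premanifold_chart[OF assms])
  then show ?thesis unfolding smooth_at_def by (intro bexI[of _ "(U, \<phi>)"]) (auto intro: smooth_near_const)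
qed

lemma smooth_at_sum:
  assumes "premanifold M" "p \<in> pts M"
  shows "(\<And>i. i \<in> A \<Longrightarrow> smooth_at M (f i) p) \<Longrightarrow> smooth_at M (\<lambda>x. \<Sum>i\<in>A. f i x) p"
  by (induction A rule: infinite_finite_induct)
    (auto intro: smooth_at_const[OF assms] smooth_at_add[OF assms(1)])

lemma smooth_at_compose:
  fixes f :: "'a \<Rightarrow> 'b::coordinate_space"
  assumes "smooth_at M f p" "premanifold M" "smooth_near h (f p)"
  shows "smooth_at M (\<lambda>x. h (f x)) p"
proof -
  obtain U \<phi> where c: "(U, \<phi>) \<in> atlas M" "p \<in> U" using assms unfolding smooth_at_def by blast
  have "inv_into U \<phi> (\<phi> p) = p" using premanifoldD(2)[OF assms(2) c(1)] c by simp
  then show ?thesis using assms smooth_near_compose[of "\<lambda>z. f (inv_into U \<phi> z)" "\<phi> p" h]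
    by (simp add: smooth_at_chart[OF assms(2) c])
qed

lemma smooth_at_coordinate:
  assumes M: "premanifold M" and c: "(U, \<phi>) \<in> atlas M" "p \<in> U"
  shows "smooth_at M \<phi> p"
  unfolding smooth_at_chart[OF assms]
  by (rule smooth_near_cong[OF smooth_near_linear[OF bounded_linear_ident] premanifoldD(3)[OF M c(1)]])
    (use c in \<open>auto simp: f_inv_into_f\<close>)

lemma smooth_at_coordinate_compose:
  assumes M: "premanifold M" and c: "(U, \<phi>) \<in> atlas M" "p \<in> U" and h: "smooth_near h (\<phi> p)"
  shows "smooth_at M (\<lambda>x. h (\<phi> x)) p"
  by (rule smooth_at_compose[OF smooth_at_coordinate[OF M c] M h])

section \<open>The algebra of smooth functions\<close>

lemma Cinf_add: "premanifold M \<Longrightarrow> f \<in> Cinf M \<Longrightarrow> g \<in> Cinf M \<Longrightarrow> (\<lambda>x. f x + g x) \<in> Cinf M"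
  by (simp add: Cinf_iff smooth_at_add)

lemma Cinf_mult: "premanifold M \<Longrightarrow> f \<in> Cinf M \<Longrightarrow> g \<in> Cinf M \<Longrightarrow> (\<lambda>x. f x * g x) \<in> Cinf M"
  by (simp add: Cinf_iff smooth_at_mult)

lemma Cinf_const: "premanifold M \<Longrightarrow> (\<lambda>x. c) \<in> Cinf M"
  by (simp add: Cinf_iff smooth_at_const)

lemma Cinf_sum:
  "premanifold M \<Longrightarrow> (\<And>i. i \<in> A \<Longrightarrow> f i \<in> Cinf M) \<Longrightarrow> (\<lambda>x. \<Sum>i\<in>A. f i x) \<in> Cinf M"
  by (simp add: Cinf_iff smooth_at_sum)

lemma Cinf_cong:
  assumes M: "premanifold M" and "f \<in> Cinf M" "\<And>x. x \<in> pts M \<Longrightarrow> f x = g x"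
  shows "g \<in> Cinf M"
  using assms(2,3) by (auto simp: Cinf_iff[OF M] intro: smooth_at_cong[OF M _ mopen_pts[OF M]])

section \<open>Bump functions on manifolds\<close>

text \<open>Vanishing is required on an open set \<open>Z\<close> that covers the manifold together
  with \<open>W\<close>. This form of the support condition makes extension by zero immediate: on
  \<open>W\<close> the product is smooth by assumption, on \<open>Z\<close> it is constantly
  0.\<close>

definition bump :: "('a, 'm::coordinate_space) manifold \<Rightarrow> 'a set \<Rightarrow> 'a \<Rightarrow> ('a \<Rightarrow> real) \<Rightarrow> bool" where
  "bump M W p g \<longleftrightarrow> mopen M W \<and> g \<in> Cinf M \<and>
     (\<exists>N. mopen M N \<and> p \<in> N \<and> N \<subseteq> W \<and> (\<forall>x\<in>N. g x = 1)) \<and>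
     (\<exists>Z. mopen M Z \<and> W \<union> Z = pts M \<and> (\<forall>x\<in>Z. g x = 0))"

lemma bump_zero: "bump M W p g \<Longrightarrow> x \<in> pts M \<Longrightarrow> x \<notin> W \<Longrightarrow> g x = 0"
  unfolding bump_def by blast

lemma bump_one: "bump M W p g \<Longrightarrow> g p = 1"
  unfolding bump_def by blast

lemma bump_mem: "bump M W p g \<Longrightarrow> p \<in> W"
  unfolding bump_def by blast

lemma bump_Cinf: "bump M W p g \<Longrightarrow> g \<in> Cinf M"
  unfolding bump_def by blast

lemma bump_mopen: "bump M W p g \<Longrightarrow> mopen M W"
  unfolding bump_def by blast

lemma bump_extend:
  assumes M: "premanifold M" and g: "bump M W p g"
    and h: "x \<in> W \<Longrightarrow> smooth_at M h x" and x: "x \<in> pts M"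
  shows "smooth_at M (\<lambda>x. g x *\<^sub>R h x) x"
proof (cases "x \<in> W")
  case True
  then show ?thesis
    by (intro smooth_at_scaleR[OF M] CinfD[OF M bump_Cinf[OF g] x] h True)
next
  case False
  obtain Z where "mopen M Z" "W \<union> Z = pts M" "\<forall>x\<in>Z. g x = 0" using g unfolding bump_def by blast
  with False x show ?thesis
    by (intro smooth_at_cong[OF M smooth_at_const[OF M x, of 0], of Z]) auto
qed

lemma bump_extend_Cinf:
  fixes h :: "_ \<Rightarrow> real"
  assumes M: "premanifold M" and g: "bump M W p g"
    and h: "\<And>x. x \<in> W \<Longrightarrow> smooth_at M h x"
  shows "(\<lambda>x. g x * h x) \<in> Cinf M"
  using bump_extend[OF M g h] by (simp add: Cinf_iff[OF M])

text \<open>The Euclidean bump is transported by the chart and extended by 0. The extension is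
  smooth because a closed coordinate ball pulls back to a compact set \<open>K\<close>, which is
  closed by the Hausdorff axiom, so that the function vanishes on the open complement of
  \<open>K\<close>.\<close>

lemma bump_exists:
  assumes M: "smooth_manifold M" and c: "(U, \<phi>) \<in> atlas M" and W: "mopen M W" "W \<subseteq> U" "p \<in> W"
  shows "\<exists>g. bump M W p g"
proof -
  note pM = smooth_manifold_premanifold[OF M]
  note inj = premanifoldD(2)[OF pM c]
  have iU: "inv_into U \<phi> (\<phi> x) = x" if "x \<in> U" for x using inj that by simp
  have "open (\<phi> ` W)" using mopenD[OF W(1) c] W(2) by (simp add: Int_absorb2)
  then obtain e where e: "e > 0" "cball (\<phi> p) e \<subseteq> \<phi> ` W"
    using W(3) open_contains_cball[of "\<phi> ` W"] by blast
  \<comment> \<open>With this radius the bump is 1 within \<open>e / 4\<close> and 0 beyond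
    \<open>e / 2\<close>, the radius of the ball behind \<open>K\<close>; the larger ball of radius
    \<open>e\<close> still lies in the image of \<open>W\<close>.\<close>
  have "0 < e / 4" using e by simp
  then obtain b :: "'b \<Rightarrow> real" where b: "\<And>z. smooth_near b z" "\<And>z. dist z (\<phi> p) < e / 4 \<Longrightarrow> b z = 1"
     "\<And>z. 2 * (e / 4) \<le> dist z (\<phi> p) \<Longrightarrow> b z = 0"
    by (rule bump_function[of "e / 4" "\<phi> p"]) metis
  define K where "K = inv_into U \<phi> ` cball (\<phi> p) (e / 2)"
  have cb: "cball (\<phi> p) (e / 2) \<subseteq> \<phi> ` W" using e subset_cball[of "e / 2" e] by auto
  have KW: "K \<subseteq> W" using cb W(2) iU unfolding K_def by force
  have "continuous_map (top_of_set (\<phi> ` U)) (mtopology M) (inv_into U \<phi>)"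
    unfolding continuous_map_def
  proof (intro conjI ballI allI impI)
    show "inv_into U \<phi> \<in> topspace (top_of_set (\<phi> ` U)) \<rightarrow> topspace (mtopology M)"
      using premanifoldD(1)[OF pM c] by (auto simp: topspace_mtopology[OF pM] iU)
    fix T assume "openin (mtopology M) T"
    then have T: "mopen M T" by (simp add: openin_mtopology[OF pM])
    have "{x \<in> topspace (top_of_set (\<phi> ` U)). inv_into U \<phi> x \<in> T} = \<phi> ` (T \<inter> U)"
      using iU by auto
    moreover have "\<phi> ` (T \<inter> U) \<subseteq> \<phi> ` U" by blast
    ultimately show "openin (top_of_set (\<phi> ` U)) {x \<in> topspace (top_of_set (\<phi> ` U)). inv_into U \<phi> x \<in> T}"
      using mopenD[OF T c] premanifoldD(3)[OF pM c] by (simp add: openin_open_eq)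
  qed
  moreover have "compactin (top_of_set (\<phi> ` U)) (cball (\<phi> p) (e / 2))"
    using cb W(2) by (auto simp: compactin_subtopology)
  ultimately have "compactin (mtopology M) K"
    unfolding K_def by (rule image_compactin[rotated])
  then have "closedin (mtopology M) K"
    using M by (intro compactin_imp_closedin) (simp_all add: smooth_manifold_def)
  then have Z: "mopen M (pts M - K)"
    by (simp add: closedin_def openin_mtopology[OF pM] topspace_mtopology[OF pM])
  define g where "g x = (if x \<in> U then b (\<phi> x) else 0)" for x
  have gZ: "g x = 0" if "x \<in> pts M - K" for x
  proof (cases "x \<in> U")
    case True
    then have "\<phi> x \<notin> cball (\<phi> p) (e / 2)" using that iU[OF True] unfolding K_def by (metis DiffD2 imageI)
    then show ?thesis using True b(3)[of "\<phi> x"] by (simp add: g_def dist_commute)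
  qed (simp add: g_def)
  have "smooth_at M g x" if x: "x \<in> pts M" for x
  proof (cases "x \<in> U")
    case True
    have "smooth_at M (\<lambda>x. b (\<phi> x)) x" by (rule smooth_at_coordinate_compose[OF pM c True b(1)])
    then show ?thesis by (rule smooth_at_cong[OF pM _ mopen_chart[OF pM c] True]) (simp add: g_def)
  next
    case False
    then have "x \<in> pts M - K" using x KW W(2) by auto
    then show ?thesis using gZ by (intro smooth_at_cong[OF pM smooth_at_const[OF pM x, of 0] Z]) auto
  qed
  then have "g \<in> Cinf M" by (rule CinfI[OF pM])
  moreover have "\<exists>N. mopen M N \<and> p \<in> N \<and> N \<subseteq> W \<and> (\<forall>x\<in>N. g x = 1)"
  proof (intro exI[of _ "W \<inter> (U \<inter> \<phi> -` ball (\<phi> p) (e / 4))"] conjI ballI)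
    show "mopen M (W \<inter> (U \<inter> \<phi> -` ball (\<phi> p) (e / 4)))"
      by (intro mopen_Int[OF pM W(1)] mopen_chart_vimage[OF pM c] open_ball)
  qed (use W e b(2) in \<open>auto simp: g_def dist_commute\<close>)
  moreover have "W \<union> (pts M - K) = pts M" using KW mopen_subset[OF W(1)] by blast
  ultimately show ?thesis using W(1) Z gZ unfolding bump_def by blast
qed

section \<open>Tangent vectors\<close>

text \<open>What the description of tangent vectors requires of a manifold: around each point of a
  chart a bump function living on a set with convex coordinate image, as Hadamard's lemma demands.
  Being a predicate of its own, it also applies to total spaces, whose bumps come from the
  base.\<close>

definition convex_bumps :: "('a, 'm::coordinate_space) manifold \<Rightarrow> bool" where
  "convex_bumps M \<longleftrightarrow> premanifold M \<and>
     (\<forall>(U, \<phi>)\<in>atlas M. \<forall>p\<in>U. \<exists>W G. W \<subseteq> U \<and> convex (\<phi> ` W) \<and> bump M W p G)"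

lemma convex_bumpsD: "convex_bumps M \<Longrightarrow> premanifold M"
  by (simp add: convex_bumps_def)

lemma convex_bumpsE:
  assumes "convex_bumps M" "(U, \<phi>) \<in> atlas M" "p \<in> U"
  obtains W G where "W \<subseteq> U" "convex (\<phi> ` W)" "bump M W p G"
  using assms unfolding convex_bumps_def by blast

lemma smooth_manifold_bump_ball:
  assumes M: "smooth_manifold M" and c: "(U, \<phi>) \<in> atlas M" and W: "mopen M W" "p \<in> W" "W \<subseteq> U"
  shows "\<exists>W' G. W' \<subseteq> W \<and> convex (\<phi> ` W') \<and> bump M W' p G"
proof -
  note pM = smooth_manifold_premanifold[OF M]
  have "open (\<phi> ` W)" using mopenD[OF W(1) c] W(3) by (simp add: Int_absorb2)
  then obtain e where e: "e > 0" "ball (\<phi> p) e \<subseteq> \<phi> ` W"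
    using W(2) open_contains_ball[of "\<phi> ` W"] by blast
  let ?W = "W \<inter> (U \<inter> \<phi> -` ball (\<phi> p) e)"
  have "mopen M ?W" by (intro mopen_Int[OF pM W(1)] mopen_chart_vimage[OF pM c] open_ball)
  moreover have "p \<in> ?W" using W e by auto
  ultimately obtain G where "bump M ?W p G" using bump_exists[OF M c, of ?W p] by auto
  moreover have "\<phi> ` ?W = ball (\<phi> p) e"
  proof
    show "ball (\<phi> p) e \<subseteq> \<phi> ` ?W"
    proof
      fix z assume z: "z \<in> ball (\<phi> p) e"
      then obtain x where "x \<in> W" "z = \<phi> x" using e(2) by blast
      then show "z \<in> \<phi> ` ?W" using z W(3) by blast
    qed
  qed auto
  ultimately show ?thesis by (intro exI[of _ ?W]) (auto simp: convex_ball)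
qed

lemma smooth_manifold_convex_bumps:
  assumes M: "smooth_manifold M"
  shows "convex_bumps M"
proof -
  note pM = smooth_manifold_premanifold[OF M]
  show ?thesis unfolding convex_bumps_def
    using pM smooth_manifold_bump_ball[OF M _ mopen_chart[OF pM]] by fastforce
qed

section \<open>Derivations at a point\<close>

lemma tangent_add: "v \<in> tangent M p \<Longrightarrow> f \<in> Cinf M \<Longrightarrow> g \<in> Cinf M \<Longrightarrow> v (\<lambda>x. f x + g x) = v f + v g"
  by (simp add: tangent_def)

lemma tangent_cmult: "v \<in> tangent M p \<Longrightarrow> f \<in> Cinf M \<Longrightarrow> v (\<lambda>x. c * f x) = c * v f"
  by (simp add: tangent_def)

lemma tangent_mult:
  "v \<in> tangent M p \<Longrightarrow> f \<in> Cinf M \<Longrightarrow> g \<in> Cinf M \<Longrightarrow> v (\<lambda>x. f x * g x) = f p * v g + g p * v f"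
  by (simp add: tangent_def)

lemma tangent_not_Cinf: "v \<in> tangent M p \<Longrightarrow> f \<notin> Cinf M \<Longrightarrow> v f = 0"
  by (simp add: tangent_def)

lemma tangent_const:
  assumes "premanifold M" "v \<in> tangent M p"
  shows "v (\<lambda>x. c) = 0"
proof -
  have "v (\<lambda>x. 1 * 1) = 1 * v (\<lambda>x. 1) + 1 * v (\<lambda>x. 1)"
    by (rule tangent_mult[OF assms(2)]) (simp_all add: Cinf_const assms)
  then have "v (\<lambda>x. 1) = 0" by simp
  moreover have "v (\<lambda>x. c * 1) = c * v (\<lambda>x. 1)"
    by (rule tangent_cmult[OF assms(2)]) (simp add: Cinf_const assms)
  ultimately show ?thesis by simp
qed

lemma tangent_sum:
  assumes "premanifold M" "v \<in> tangent M p" "finite A" "\<And>i. i \<in> A \<Longrightarrow> f i \<in> Cinf M"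
  shows "v (\<lambda>x. \<Sum>i\<in>A. f i x) = (\<Sum>i\<in>A. v (f i))"
  using assms(3,4)
  by (induction A rule: finite_induct) (simp_all add: tangent_const[OF assms(1,2)] tangent_add[OF assms(2)] Cinf_sum[OF assms(1)])

lemma tangent_eq:
  assumes M: "premanifold M" and v: "v \<in> tangent M p" and p: "p \<in> pts M" and f: "f \<in> Cinf M"
    and eq: "\<And>x. x \<in> pts M \<Longrightarrow> f x = g x"
  shows "v f = v g"
proof -
  have g: "g \<in> Cinf M" by (rule Cinf_cong[OF M f eq])
  define i where "i x = (if x \<in> pts M then 0 else 1::real)" for x
  have i: "i \<in> Cinf M" by (rule Cinf_cong[OF M Cinf_const[OF M, of 0]]) (simp add: i_def)
  define h where "h = (\<lambda>x. f x + (- 1) * g x)"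
  have h: "h \<in> Cinf M" unfolding h_def by (intro Cinf_add Cinf_mult Cinf_const M f g)
  \<comment> \<open>The difference \<open>h\<close> vanishes on the manifold and \<open>i\<close> is
    1 outside it. Both factors vanish at \<open>p\<close>, so the product rule gives 0.\<close>
  have "h = (\<lambda>x. h x * i x)" by (rule ext) (simp add: h_def i_def eq)
  then have "v h = h p * v i + i p * v h" using tangent_mult[OF v h i] by simp
  then have "v h = 0" using p eq[OF p] by (simp add: h_def i_def)
  moreover have "v h = v f + (-1) * v g"
    unfolding h_def by (subst tangent_add[OF v f]) (simp_all only: Cinf_mult[OF M Cinf_const[OF M] g] tangent_cmult[OF v g, of "-1"])
  ultimately show ?thesis by simp
qed

lemma subspace_tangent: "subspace (tangent M p)"
  unfolding subspace_def tangent_def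
  by (auto simp: scaleR_fun_def algebra_simps)

section \<open>Coordinate vectors of a chart\<close>

lemma coord_vec_eq:
  assumes "f \<in> Cinf M" "((\<lambda>z. f (inv_into U \<phi> z)) has_derivative D) (at (\<phi> p))"
  shows "coord_vec M U \<phi> p a f = D a"
  using assms frechet_derivative_at[OF assms(2)] by (simp add: coord_vec_def o_def)

lemma Cinf_chart_derivative:
  assumes "premanifold M" "(U, \<phi>) \<in> atlas M" "p \<in> U" "f \<in> Cinf M"
  shows "((\<lambda>z. f (inv_into U \<phi> z)) has_derivative (\<lambda>a. coord_vec M U \<phi> p a f)) (at (\<phi> p))"
proof -
  have "smooth_at M f p"
    by (rule CinfD[OF assms(1,4)]) (use premanifoldD(1)[OF assms(1,2)] assms(3) in auto)
  then have "(\<lambda>z. f (inv_into U \<phi> z)) differentiable at (\<phi> p)"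
    using smooth_near_differentiable by (simp add: smooth_at_chart[OF assms(1-3)])
  then show ?thesis using assms(4) by (simp add: coord_vec_def o_def frechet_derivative_works)
qed

lemma coord_vec_tangent:
  assumes M: "premanifold M" and c: "(U, \<phi>) \<in> atlas M" "p \<in> U"
  shows "coord_vec M U \<phi> p a \<in> tangent M p"
proof -
  note d = Cinf_chart_derivative[OF M c]
  have ip: "inv_into U \<phi> (\<phi> p) = p" using premanifoldD(2)[OF M c(1)] c by simp
  have "coord_vec M U \<phi> p a (\<lambda>x. f x + g x) = coord_vec M U \<phi> p a f + coord_vec M U \<phi> p a g"
    if "f \<in> Cinf M" "g \<in> Cinf M" for f g
    by (rule coord_vec_eq[OF Cinf_add[OF M that] has_derivative_add[OF d d]]) fact+
  moreover have "coord_vec M U \<phi> p a (\<lambda>x. b * f x) = b * coord_vec M U \<phi> p a f"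
    if "f \<in> Cinf M" for f b
    by (rule coord_vec_eq[OF Cinf_mult[OF M Cinf_const[OF M] that] has_derivative_mult_right[OF d]]) fact
  moreover have "coord_vec M U \<phi> p a (\<lambda>x. f x * g x) = f p * coord_vec M U \<phi> p a g + g p * coord_vec M U \<phi> p a f"
    if "f \<in> Cinf M" "g \<in> Cinf M" for f g
    using coord_vec_eq[OF Cinf_mult[OF M that] has_derivative_mult[OF d[OF that(1)] d[OF that(2)]]] ip by simp
  moreover have "coord_vec M U \<phi> p a f = 0" if "f \<notin> Cinf M" for f
    using that by (simp add: coord_vec_def)
  ultimately show ?thesis unfolding tangent_def by blast
qed

lemma linear_coord_vec:
  assumes "premanifold M" "(U, \<phi>) \<in> atlas M" "p \<in> U"
  shows "linear (coord_vec M U \<phi> p)"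
proof (rule linearI)
  fix a b c
  have l: "linear (\<lambda>a. coord_vec M U \<phi> p a f)" if "f \<in> Cinf M" for f
    using Cinf_chart_derivative[OF assms that] has_derivative_linear by blast
  have "coord_vec M U \<phi> p (a + b) f = coord_vec M U \<phi> p a f + coord_vec M U \<phi> p b f" for f
    by (cases "f \<in> Cinf M") (use linear_add[OF l] in \<open>simp_all add: coord_vec_def\<close>)
  then show "coord_vec M U \<phi> p (a + b) = coord_vec M U \<phi> p a + coord_vec M U \<phi> p b"
    by (simp add: fun_eq_iff)
  have "coord_vec M U \<phi> p (c *\<^sub>R a) f = c * coord_vec M U \<phi> p a f" for f
    by (cases "f \<in> Cinf M") (use linear_scale[OF l] in \<open>simp_all add: coord_vec_def\<close>)
  then show "coord_vec M U \<phi> p (c *\<^sub>R a) = c *\<^sub>R coord_vec M U \<phi> p a"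
    by (simp add: fun_eq_iff scaleR_fun_def)
qed

text \<open>A globally smooth substitute for the coordinate in direction \<open>b\<close> centred at
  \<open>p\<close>, with which it agrees wherever \<open>G\<close> is 1. Derivations can be applied
  to it, unlike to the coordinate itself.\<close>

definition cut_coord :: "('a \<Rightarrow> real) \<Rightarrow> ('a \<Rightarrow> 'm::coordinate_space) \<Rightarrow> 'a \<Rightarrow> 'm \<Rightarrow> 'a \<Rightarrow> real" where
  "cut_coord G \<phi> p b = (\<lambda>x. G x * inner (\<phi> x - \<phi> p) b)"

context
  fixes M :: "('a, 'm::coordinate_space) manifold" and U :: "'a set" and \<phi> :: "'a \<Rightarrow> 'm" and p :: 'a
    and W :: "'a set" and G :: "'a \<Rightarrow> real"
  assumes M: "premanifold M" and c: "(U, \<phi>) \<in> atlas M" and W: "W \<subseteq> U" and G: "bump M W p G"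
begin

lemma cut_chart_Cinf: "(\<And>x. x \<in> W \<Longrightarrow> smooth_near h (\<phi> x)) \<Longrightarrow> (\<lambda>x. G x * h (\<phi> x)) \<in> Cinf M"
  by (rule bump_extend_Cinf[OF M G]) (use W smooth_at_coordinate_compose[OF M c] in blast)

lemma cut_coord_Cinf: "cut_coord G \<phi> p b \<in> Cinf M"
proof -
  have "smooth_near (\<lambda>z. inner (z + - \<phi> p) b) z" for z
    by (intro smooth_near_inner smooth_near_add smooth_near_const smooth_near_linear bounded_linear_ident)
  then show ?thesis unfolding cut_coord_def
    using cut_chart_Cinf[of "\<lambda>z. inner (z - \<phi> p) b"] by simp
qed

lemma cut_coord_zero: "cut_coord G \<phi> p b p = 0"
  by (simp add: cut_coord_def)

lemma coord_vec_cut_coord: "coord_vec M U \<phi> p a (cut_coord G \<phi> p b) = inner a b"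
proof (rule coord_vec_eq[OF cut_coord_Cinf])
  have p: "p \<in> U" using bump_mem[OF G] W by blast
  have ip: "inv_into U \<phi> (\<phi> p) = p" using premanifoldD(2)[OF M c] p by simp
  have "((\<lambda>z. G (inv_into U \<phi> z) * inner (z - \<phi> p) b) has_derivative
      (\<lambda>a. G (inv_into U \<phi> (\<phi> p)) * inner a b + coord_vec M U \<phi> p a G * inner (\<phi> p - \<phi> p) b)) (at (\<phi> p))"
    by (rule has_derivative_mult[OF Cinf_chart_derivative[OF M c p bump_Cinf[OF G]]])
      (auto intro!: derivative_eq_intros)
  then have "((\<lambda>z. G (inv_into U \<phi> z) * inner (z - \<phi> p) b) has_derivative (\<lambda>a. inner a b)) (at (\<phi> p))"
    by (simp add: ip bump_one[OF G])
  then show "((\<lambda>z. cut_coord G \<phi> p b (inv_into U \<phi> z)) has_derivative (\<lambda>a. inner a b)) (at (\<phi> p))"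
    by (rule has_derivative_transform_within_open[OF _ premanifoldD(3)[OF M c]])
      (use p in \<open>auto simp: cut_coord_def f_inv_into_f\<close>)
qed

text \<open>Hadamard's lemma writes \<open>f - f p\<close> near \<open>p\<close> as a sum of
  coordinates times smooth functions. The coordinates vanish at \<open>p\<close>, so the product
  rule leaves only the values of \<open>v\<close> on the coordinates, and these are the components
  of the coordinate vector sought.\<close>

lemma tangent_eq_coord_vec:
  assumes conv: "convex (\<phi> ` W)" and v: "v \<in> tangent M p"
  shows "v = coord_vec M U \<phi> p (\<Sum>b\<in>onb. v (cut_coord G \<phi> p b) *\<^sub>R b)"
proof
  fix f
  let ?a = "\<Sum>b\<in>onb. v (cut_coord G \<phi> p b) *\<^sub>R b"
  have pW: "p \<in> W" using bump_mem[OF G] .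
  then have p: "p \<in> U" "p \<in> pts M" using W premanifoldD(1)[OF M c] by auto
  have Wi: "inv_into U \<phi> (\<phi> x) = x" if "x \<in> W" for x using premanifoldD(2)[OF M c] W that by auto
  have So: "open (\<phi> ` W)" using mopenD[OF bump_mopen[OF G] c] W by (simp add: Int_absorb2)
  show "v f = coord_vec M U \<phi> p ?a f"
  proof (cases "f \<in> Cinf M")
    case False
    then show ?thesis using tangent_not_Cinf[OF v] by (simp add: coord_vec_def)
  next
    case f: True
    have "smooth_on (\<phi> ` W) (\<lambda>z. f (inv_into U \<phi> z))"
      unfolding smooth_on_iff_near[OF So]
      using CinfD[OF M f] smooth_at_chart[OF M c] W premanifoldD(1)[OF M c] by blast
    then obtain H where H: "\<And>b. smooth_on (\<phi> ` W) (H b)" and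
      Heq: "\<And>z. z \<in> \<phi> ` W \<Longrightarrow> f (inv_into U \<phi> z) =
        f (inv_into U \<phi> (\<phi> p)) + (\<Sum>b\<in>onb. inner (z - \<phi> p) b * H b z)"
      using Hadamard_lemma[OF So conv imageI[OF pW], of "\<lambda>z. f (inv_into U \<phi> z)"] by metis
    have Hn: "smooth_near (H b) (\<phi> x)" if "x \<in> W" for b x
      using H smooth_on_iff_near[OF So] that by blast
    define h where "h b x = G x * H b (\<phi> x)" for b x
    have h: "h b \<in> Cinf M" for b unfolding h_def by (rule cut_chart_Cinf) (rule Hn)
    note G' = bump_Cinf[OF G] and G1 = bump_one[OF G]
    have fp: "(\<lambda>x. f x + - f p) \<in> Cinf M" by (intro Cinf_add Cinf_const M f)
    have GG: "(\<lambda>x. G x * G x) \<in> Cinf M" by (intro Cinf_mult M G')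
    \<comment> \<open>The square provides one cutoff for the coordinate and one for its cofactor in
      Hadamard's expansion. It does not change the value of \<open>v\<close>, since
      \<open>G p = 1\<close> and \<open>f - f p\<close> vanishes at \<open>p\<close>.\<close>
    have "v (\<lambda>x. G x * G x * (f x + - f p)) = v (\<lambda>x. f x + - f p)"
      using tangent_mult[OF v GG fp] by (simp add: G1)
    also have "\<dots> = v f" by (simp only: tangent_add[OF v f Cinf_const[OF M]] tangent_const[OF M v] add_0_right)
    finally have 1: "v f = v (\<lambda>x. G x * G x * (f x + - f p))" ..
    have "v (\<lambda>x. G x * G x * (f x + - f p)) = v (\<lambda>x. \<Sum>b\<in>onb. cut_coord G \<phi> p b x * h b x)"
    proof (rule tangent_eq[OF M v p(2)])
      show "(\<lambda>x. G x * G x * (f x + - f p)) \<in> Cinf M" by (intro Cinf_mult M GG fp)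
      fix x assume x: "x \<in> pts M"
      show "G x * G x * (f x + - f p) = (\<Sum>b\<in>onb. cut_coord G \<phi> p b x * h b x)"
      proof (cases "x \<in> W")
        case True
        then show ?thesis using Heq[of "\<phi> x"] Wi[OF True] Wi[OF pW]
          by (simp add: cut_coord_def h_def sum_distrib_left mult_ac)
      next
        case False
        then show ?thesis using bump_zero[OF G x] by (simp add: h_def)
      qed
    qed
    also have "\<dots> = (\<Sum>b\<in>onb. v (\<lambda>x. cut_coord G \<phi> p b x * h b x))"
      by (rule tangent_sum[OF M v]) (auto intro: Cinf_mult[OF M cut_coord_Cinf h])
    also have "\<dots> = (\<Sum>b\<in>onb. v (cut_coord G \<phi> p b) * H b (\<phi> p))"
      by (simp only: tangent_mult[OF v cut_coord_Cinf h] cut_coord_zero) (simp add: h_def[of _ p] G1 mult.commute)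
    also have "\<dots> = (\<Sum>b\<in>onb. inner ?a b * H b (\<phi> p))"
      by (rule sum.cong) (simp_all add: inner_sum_onb)
    finally have vf: "v f = (\<Sum>b\<in>onb. inner ?a b * H b (\<phi> p))" using 1 by simp
    have "((\<lambda>z. f (inv_into U \<phi> (\<phi> p)) + (\<Sum>b\<in>onb. inner (z - \<phi> p) b * H b z)) has_derivative
        (\<lambda>a. 0 + (\<Sum>b\<in>onb. inner (\<phi> p - \<phi> p) b * frechet_derivative (H b) (at (\<phi> p)) a + inner a b * H b (\<phi> p))))
        (at (\<phi> p))"
    proof (intro has_derivative_add has_derivative_const has_derivative_sum has_derivative_mult)
      show "(H b has_derivative frechet_derivative (H b) (at (\<phi> p))) (at (\<phi> p))" for b
        using smooth_near_differentiable[OF Hn[OF pW]] by (simp add: frechet_derivative_works)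
      show "((\<lambda>z. inner (z - \<phi> p) b) has_derivative (\<lambda>a. inner a b)) (at (\<phi> p))" for b
        by (auto intro!: derivative_eq_intros)
    qed
    then have "((\<lambda>z. f (inv_into U \<phi> z)) has_derivative
        (\<lambda>a. 0 + (\<Sum>b\<in>onb. inner (\<phi> p - \<phi> p) b * frechet_derivative (H b) (at (\<phi> p)) a + inner a b * H b (\<phi> p))))
        (at (\<phi> p))"
      by (rule has_derivative_transform_within_open[OF _ So imageI[OF pW] Heq[symmetric]])
    from coord_vec_eq[OF f this] show ?thesis using vf by simp
  qed
qed

end

lemma coord_vec_bij:
  assumes M: "convex_bumps M" and c: "(U, \<phi>) \<in> atlas M" "p \<in> U"
  shows "bij_betw (coord_vec M U \<phi> p) UNIV (tangent M p)"
proof -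
  obtain W G where W: "W \<subseteq> U" "convex (\<phi> ` W)" "bump M W p G" by (rule convex_bumpsE[OF M c])
  note pM = convex_bumpsD[OF M]
  have "inj (coord_vec M U \<phi> p)"
  proof (rule injI)
    fix a a' assume "coord_vec M U \<phi> p a = coord_vec M U \<phi> p a'"
    then have "inner a b = inner a' b" for b
      using coord_vec_cut_coord[OF pM c(1) W(1,3)] by metis
    then show "a = a'" by (auto intro: onb_eqI)
  qed
  moreover have "range (coord_vec M U \<phi> p) = tangent M p"
    using coord_vec_tangent[OF pM c] tangent_eq_coord_vec[OF pM c(1) W(1,3,2)] by blast
  ultimately show ?thesis by (simp add: bij_betw_def)
qed

lemma inv_coord_vec:
  assumes M: "convex_bumps M" and c: "(U, \<phi>) \<in> atlas M" "p \<in> U"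
  shows "inv (coord_vec M U \<phi> p) (coord_vec M U \<phi> p a) = a"
    and "v \<in> tangent M p \<Longrightarrow> coord_vec M U \<phi> p (inv (coord_vec M U \<phi> p) v) = v"
  using coord_vec_bij[OF assms] by (auto simp: bij_betw_def f_inv_into_f)

lemma linear_on_inv_coord_vec:
  assumes M: "convex_bumps M" and c: "(U, \<phi>) \<in> atlas M" "p \<in> U"
  shows "linear_on (tangent M p) (inv (coord_vec M U \<phi> p))"
proof -
  note l = linear_coord_vec[OF convex_bumpsD[OF M] c] and i = inv_coord_vec[OF assms]
  show ?thesis unfolding linear_on_def
  proof (intro conjI ballI allI)
    fix v w r assume v: "v \<in> tangent M p"
    show "inv (coord_vec M U \<phi> p) (r *\<^sub>R v) = r *\<^sub>R inv (coord_vec M U \<phi> p) v"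
      using i(1)[of "r *\<^sub>R inv (coord_vec M U \<phi> p) v"] i(2)[OF v] linear_scale[OF l] by simp
    assume w: "w \<in> tangent M p"
    show "inv (coord_vec M U \<phi> p) (v + w) = inv (coord_vec M U \<phi> p) v + inv (coord_vec M U \<phi> p) w"
      using i(1)[of "inv (coord_vec M U \<phi> p) v + inv (coord_vec M U \<phi> p) w"] i(2)[OF v] i(2)[OF w]
        linear_add[OF l] by simp
  qed
qed

section \<open>Vector bundles\<close>

lemma linear_onD:
  assumes "linear_on S h"
  shows "x \<in> S \<Longrightarrow> y \<in> S \<Longrightarrow> h (x + y) = h x + h y" "x \<in> S \<Longrightarrow> h (c *\<^sub>R x) = c *\<^sub>R h x"
  using assms by (auto simp: linear_on_def)

lemma linear_on_zero: "linear_on S h \<Longrightarrow> 0 \<in> S \<Longrightarrow> h 0 = 0"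
  using linear_onD(2)[of S h 0 0] by simp

lemma linear_on_sum:
  assumes "linear_on S h" "subspace S" "finite A" "\<And>i. i \<in> A \<Longrightarrow> x i \<in> S"
  shows "h (\<Sum>i\<in>A. c i *\<^sub>R x i) = (\<Sum>i\<in>A. c i *\<^sub>R h (x i))"
  using assms(3,4)
proof (induction A rule: finite_induct)
  case empty then show ?case using linear_on_zero[OF assms(1) subspace_0[OF assms(2)]] by simp
next
  case (insert a A)
  have "c a *\<^sub>R x a \<in> S" "(\<Sum>i\<in>A. c i *\<^sub>R x i) \<in> S"
    using insert.prems by (auto intro!: subspace_scale[OF assms(2)] subspace_sum[OF assms(2)])
  then show ?case using insert linear_onD[OF assms(1)] by simp
qed

lemma fmult_apply: "(f \<star> \<sigma>) q = f q *\<^sub>R \<sigma> q"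
  by (simp add: fmult_def)

lemma sum_fun_apply: "(\<Sum>i\<in>A. f i) x = (\<Sum>i\<in>A. f i x :: 'b::comm_monoid_add)"
  by (induction A rule: infinite_finite_induct) simp_all

text \<open>Weaker than \<open>vector_bundle\<close>, so as to cover \<open>left_tangent\<close> without computing its transition
  functions.\<close>

definition linear_bundle ::
    "('a, 'm::coordinate_space, 'v::real_vector, 'f::coordinate_space) vbundle \<Rightarrow> bool" where
  "linear_bundle E \<longleftrightarrow> premanifold (base E) \<and> (\<forall>q\<in>pts (base E). subspace (fibre E q)) \<and>
     (\<forall>(V, \<Phi>)\<in>trivs E. mopen (base E) V \<and> (\<forall>q\<in>V. linear_on (fibre E q) (\<Phi> q)))"

lemma linear_bundleD:
  assumes "linear_bundle E"
  shows "premanifold (base E)" "q \<in> pts (base E) \<Longrightarrow> subspace (fibre E q)"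
    "(V, \<Phi>) \<in> trivs E \<Longrightarrow> mopen (base E) V" "(V, \<Phi>) \<in> trivs E \<Longrightarrow> q \<in> V \<Longrightarrow> linear_on (fibre E q) (\<Phi> q)"
  using assms by (auto simp: linear_bundle_def)

lemma sections_iff:
  assumes "linear_bundle E"
  shows "\<sigma> \<in> sections E \<longleftrightarrow> (\<forall>q\<in>pts (base E). \<sigma> q \<in> fibre E q) \<and> (\<forall>q. q \<notin> pts (base E) \<longrightarrow> \<sigma> q = 0) \<and>
    (\<forall>V \<Phi>. (V, \<Phi>) \<in> trivs E \<longrightarrow> (\<forall>q\<in>V. smooth_at (base E) (\<lambda>q. \<Phi> q (\<sigma> q)) q))"
  using smooth_fun_on_iff[OF linear_bundleD(1)[OF assms] linear_bundleD(3)[OF assms]]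
  unfolding sections_def by fastforce

lemma sections_fibre: "\<sigma> \<in> sections E \<Longrightarrow> q \<in> pts (base E) \<Longrightarrow> \<sigma> q \<in> fibre E q"
  by (simp add: sections_def)

lemma sections_outside: "\<sigma> \<in> sections E \<Longrightarrow> q \<notin> pts (base E) \<Longrightarrow> \<sigma> q = 0"
  by (simp add: sections_def)

lemma sections_smooth:
  assumes "linear_bundle E" "\<sigma> \<in> sections E" "(V, \<Phi>) \<in> trivs E" "q \<in> V"
  shows "smooth_at (base E) (\<lambda>q. \<Phi> q (\<sigma> q)) q"
  using assms sections_iff by blast

lemma sections_eqI:
  assumes "\<sigma> \<in> sections E" "\<tau> \<in> sections E" "\<And>q. q \<in> pts (base E) \<Longrightarrow> \<sigma> q = \<tau> q"
  shows "\<sigma> = \<tau>"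
  using assms sections_outside by (metis ext)

lemma sections_add:
  assumes E: "linear_bundle E" and s: "\<sigma> \<in> sections E" "\<tau> \<in> sections E"
  shows "\<sigma> + \<tau> \<in> sections E"
proof -
  note l = linear_bundleD[OF E]
  have "smooth_at (base E) (\<lambda>q. \<Phi> q ((\<sigma> + \<tau>) q)) q" if c: "(V, \<Phi>) \<in> trivs E" "q \<in> V" for V \<Phi> q
    by (rule smooth_at_cong[OF l(1) smooth_at_add[OF l(1) sections_smooth[OF E s(1) c] sections_smooth[OF E s(2) c]] l(3)[OF c(1)] c(2)])
      (use s mopen_subset[OF l(3)[OF c(1)]] in \<open>auto simp: linear_onD(1)[OF l(4)[OF c(1)]] sections_fibre\<close>)
  then show ?thesis using s l(2) unfolding sections_iff[OF E] by (auto simp: subspace_add)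
qed

lemma sections_fmult:
  assumes E: "linear_bundle E" and f: "f \<in> Cinf (base E)" and s: "\<sigma> \<in> sections E"
  shows "f \<star> \<sigma> \<in> sections E"
proof -
  note l = linear_bundleD[OF E]
  have "smooth_at (base E) (\<lambda>q. \<Phi> q ((f \<star> \<sigma>) q)) q" if c: "(V, \<Phi>) \<in> trivs E" "q \<in> V" for V \<Phi> q
  proof -
    have "smooth_at (base E) f q" using CinfD[OF l(1) f] mopen_subset[OF l(3)[OF c(1)]] c(2) by auto
    from smooth_at_scaleR[OF l(1) this sections_smooth[OF E s c]]
    show ?thesis
      by (rule smooth_at_cong[OF l(1) _ l(3)[OF c(1)] c(2)])
        (use s mopen_subset[OF l(3)[OF c(1)]] in \<open>auto simp: fmult_def linear_onD(2)[OF l(4)[OF c(1)]] sections_fibre\<close>)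
  qed
  then show ?thesis using s l(2) unfolding sections_iff[OF E] by (auto simp: subspace_scale fmult_def)
qed

lemma sections_zero:
  assumes E: "linear_bundle E"
  shows "0 \<in> sections E"
proof -
  note l = linear_bundleD[OF E]
  have "smooth_at (base E) (\<lambda>q. \<Phi> q ((0::'a \<Rightarrow> 'c) q)) q" if c: "(V, \<Phi>) \<in> trivs E" "q \<in> V" for V \<Phi> q
  proof (rule smooth_at_cong[OF l(1) smooth_at_const[OF l(1), of _ 0] l(3)[OF c(1)] c(2)])
    show "q \<in> pts (base E)" using mopen_subset[OF l(3)[OF c(1)]] c(2) by blast
    fix x assume x: "x \<in> V"
    then have "0 \<in> fibre E x" using mopen_subset[OF l(3)[OF c(1)]] l(2) subspace_0 by blast
    then show "0 = \<Phi> x ((0::'a \<Rightarrow> 'c) x)" using linear_on_zero[OF l(4)[OF c(1) x]] by simp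
  qed
  then show ?thesis using l(2) unfolding sections_iff[OF E] by (auto simp: subspace_0)
qed

lemma fmult_const: "c *\<^sub>R \<sigma> = (\<lambda>_. c) \<star> \<sigma>"
  by (simp add: fmult_def scaleR_fun_def)

lemma sections_scaleR: "linear_bundle E \<Longrightarrow> \<sigma> \<in> sections E \<Longrightarrow> c *\<^sub>R \<sigma> \<in> sections E"
  unfolding fmult_const by (intro sections_fmult Cinf_const linear_bundleD)

lemma uminus_section: "- \<sigma> = (-1) *\<^sub>R (\<sigma> :: 'a \<Rightarrow> 'v::real_vector)"
  by (simp add: scaleR_fun_def fun_eq_iff)

lemma sections_uminus: "linear_bundle E \<Longrightarrow> \<sigma> \<in> sections E \<Longrightarrow> - \<sigma> \<in> sections E"
  unfolding uminus_section by (rule sections_scaleR)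

lemma sections_diff: "linear_bundle E \<Longrightarrow> \<sigma> \<in> sections E \<Longrightarrow> \<tau> \<in> sections E \<Longrightarrow> \<sigma> - \<tau> \<in> sections E"
  using sections_add[of E \<sigma> "- \<tau>"] sections_uminus[of E \<tau>] by simp

lemma sections_sum:
  assumes "linear_bundle E" "\<And>i. i \<in> A \<Longrightarrow> \<sigma> i \<in> sections E"
  shows "(\<Sum>i\<in>A. \<sigma> i) \<in> sections E"
  using assms(2)
  by (induction A rule: infinite_finite_induct) (auto simp: sections_zero[OF assms(1)] intro: sections_add[OF assms(1)])

section \<open>Vector bundles in local trivializations\<close>

lemma vector_bundle_linear: "vector_bundle E \<Longrightarrow> linear_bundle E"
  unfolding vector_bundle_def linear_bundle_def
  using smooth_manifold_premanifold openin_mtopology by fastforce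

lemma vector_bundle_triv:
  assumes E: "vector_bundle E" and c: "(V, \<Phi>) \<in> trivs E" and q: "q \<in> V"
  shows "bij_betw (\<Phi> q) (fibre E q) UNIV"
    "inv_into (fibre E q) (\<Phi> q) y \<in> fibre E q" "\<Phi> q (inv_into (fibre E q) (\<Phi> q) y) = y"
    "e \<in> fibre E q \<Longrightarrow> inv_into (fibre E q) (\<Phi> q) (\<Phi> q e) = e"
proof -
  show b: "bij_betw (\<Phi> q) (fibre E q) UNIV" using assms by (auto simp: vector_bundle_def)
  show "inv_into (fibre E q) (\<Phi> q) y \<in> fibre E q" "\<Phi> q (inv_into (fibre E q) (\<Phi> q) y) = y"
    "e \<in> fibre E q \<Longrightarrow> inv_into (fibre E q) (\<Phi> q) (\<Phi> q e) = e"
    using b unfolding bij_betw_def by (auto intro: inv_into_into f_inv_into_f)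
qed

lemma vector_bundle_cover:
  assumes "vector_bundle E" "q \<in> pts (base E)"
  obtains U \<phi> V \<Phi> where "(U, \<phi>) \<in> atlas (base E)" "(V, \<Phi>) \<in> trivs E" "q \<in> U" "q \<in> V"
proof -
  have "q \<in> (\<Union>(V, \<Phi>)\<in>trivs E. V)" using assms by (auto simp: vector_bundle_def)
  then obtain V \<Phi> where "(V, \<Phi>) \<in> trivs E" "q \<in> V" by auto
  moreover obtain U \<phi> where "(U, \<phi>) \<in> atlas (base E)" "q \<in> U"
    using premanifold_chart[OF linear_bundleD(1)[OF vector_bundle_linear[OF assms(1)]] assms(2)] by blast
  ultimately show thesis using that by blast
qed

lemma vector_bundle_manifold: "vector_bundle E \<Longrightarrow> smooth_manifold (base E)"
  by (simp add: vector_bundle_def)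

lemma vector_bundle_transition:
  assumes E: "vector_bundle E" and c: "(V, \<Phi>) \<in> trivs E" "(W, \<Psi>) \<in> trivs E" and q: "q \<in> V" "q \<in> W"
  shows "smooth_at (base E) (\<lambda>q. \<Psi> q (inv_into (fibre E q) (\<Phi> q) y)) q"
proof -
  note l = linear_bundleD[OF vector_bundle_linear[OF E]]
  have "smooth_fun_on (base E) (V \<inter> W) (\<lambda>q. \<Psi> q (inv_into (fibre E q) (\<Phi> q) y))"
    using E c by (fastforce simp: vector_bundle_def)
  then show ?thesis
    using smooth_fun_on_iff[OF l(1) mopen_Int[OF l(1) l(3)[OF c(1)] l(3)[OF c(2)]]] q by blast
qed

lemma vector_bundle_inv_expansion:
  assumes E: "vector_bundle E" and c: "(V, \<Phi>) \<in> trivs E" and q: "q \<in> V"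
  shows "inv_into (fibre E q) (\<Phi> q) y = (\<Sum>b\<in>onb. inner y b *\<^sub>R inv_into (fibre E q) (\<Phi> q) b)" (is "?l = ?r")
proof -
  note l = linear_bundleD[OF vector_bundle_linear[OF E]] and t = vector_bundle_triv[OF E c q]
  have qp: "q \<in> pts (base E)" using mopen_subset[OF l(3)[OF c]] q by blast
  have "\<Phi> q ?r = (\<Sum>b\<in>onb. inner y b *\<^sub>R \<Phi> q (inv_into (fibre E q) (\<Phi> q) b))"
    by (rule linear_on_sum[OF l(4)[OF c q] l(2)[OF qp]]) (simp_all add: t)
  also have "\<dots> = y" by (simp add: t onb_expansion)
  finally have "\<Phi> q ?r = y" .
  moreover have "?r \<in> fibre E q"
    by (intro subspace_sum[OF l(2)[OF qp]] subspace_scale[OF l(2)[OF qp]] t)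
  ultimately show ?thesis using t(4) by metis
qed

lemma vector_bundle_transition_expansion:
  assumes E: "vector_bundle E" and c: "(V, \<Phi>) \<in> trivs E" "(W, \<Psi>) \<in> trivs E" and q: "q \<in> V" "q \<in> W"
  shows "\<Psi> q (inv_into (fibre E q) (\<Phi> q) y) = (\<Sum>b\<in>onb. inner y b *\<^sub>R \<Psi> q (inv_into (fibre E q) (\<Phi> q) b))"
proof -
  note l = linear_bundleD[OF vector_bundle_linear[OF E]] and t = vector_bundle_triv[OF E c(1) q(1)]
  have qp: "q \<in> pts (base E)" using mopen_subset[OF l(3)[OF c(1)]] q by blast
  show ?thesis
    by (subst vector_bundle_inv_expansion[OF E c(1) q(1)])
      (rule linear_on_sum[OF l(4)[OF c(2) q(2)] l(2)[OF qp]], simp_all add: t)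
qed

text \<open>The section that is constantly \<open>y\<close> in the trivialization, cut off to become
  global. For \<open>y\<close> in \<open>onb\<close> these sections form a frame wherever
  \<open>g\<close> does not vanish.\<close>

definition frame ::
    "('a, 'm, 'v::real_vector, 'f) vbundle \<Rightarrow> 'a set \<Rightarrow> ('a \<Rightarrow> 'v \<Rightarrow> 'f) \<Rightarrow> ('a \<Rightarrow> real) \<Rightarrow> 'f \<Rightarrow> 'a \<Rightarrow> 'v" where
  "frame E V \<Phi> g y = (\<lambda>q. if q \<in> V then g q *\<^sub>R inv_into (fibre E q) (\<Phi> q) y else 0)"

lemma frame_triv:
  assumes E: "vector_bundle E" and c: "(V, \<Phi>) \<in> trivs E" and q: "q \<in> V"
  shows "\<Phi> q (frame E V \<Phi> g y q) = g q *\<^sub>R y"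
  using linear_onD(2)[OF linear_bundleD(4)[OF vector_bundle_linear[OF E] c q]] q vector_bundle_triv[OF E c q]
  by (simp add: frame_def)

lemma frame_section:
  assumes E: "vector_bundle E" and c: "(V, \<Phi>) \<in> trivs E" and g: "bump (base E) W q0 g" and WV: "W \<subseteq> V"
  shows "frame E V \<Phi> g y \<in> sections E"
  unfolding sections_iff[OF vector_bundle_linear[OF E]]
proof (intro conjI ballI allI impI)
  note l = linear_bundleD[OF vector_bundle_linear[OF E]] and t = vector_bundle_triv[OF E c]
  fix q
  show "frame E V \<Phi> g y q \<in> fibre E q" if "q \<in> pts (base E)"
    using that t(2) l(2) by (auto simp: frame_def subspace_0 subspace_scale)
  show "frame E V \<Phi> g y q = 0" if "q \<notin> pts (base E)"
    using that mopen_subset[OF l(3)[OF c]] by (auto simp: frame_def)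
  fix V' \<Psi> assume d: "(V', \<Psi>) \<in> trivs E" and q: "q \<in> V'"
  have V': "V' \<subseteq> pts (base E)" using mopen_subset[OF l(3)[OF d]] .
  have "smooth_at (base E) (\<lambda>q. g q *\<^sub>R \<Psi> q (inv_into (fibre E q) (\<Phi> q) y)) q"
    by (rule bump_extend[OF l(1) g]) (use vector_bundle_transition[OF E c d] q V' WV in auto)
  then show "smooth_at (base E) (\<lambda>q. \<Psi> q (frame E V \<Phi> g y q)) q"
  proof (rule smooth_at_cong[OF l(1) _ l(3)[OF d] q])
    fix x assume x: "x \<in> V'"
    then have xp: "x \<in> pts (base E)" using V' by blast
    have "g x = 0" if "x \<notin> V" using bump_zero[OF g xp] that WV by blast
    then show "g x *\<^sub>R \<Psi> x (inv_into (fibre E x) (\<Phi> x) y) = \<Psi> x (frame E V \<Phi> g y x)"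
      using t(2)[of x y] linear_onD(2)[OF l(4)[OF d x]] linear_on_zero[OF l(4)[OF d x] subspace_0[OF l(2)[OF xp]]]
      by (auto simp: frame_def)
  qed
qed

definition frame_coeff :: "('a \<Rightarrow> 'v \<Rightarrow> 'f::real_inner) \<Rightarrow> ('a \<Rightarrow> real) \<Rightarrow> ('a \<Rightarrow> 'v) \<Rightarrow> 'f \<Rightarrow> 'a \<Rightarrow> real" where
  "frame_coeff \<Phi> g \<gamma> b = (\<lambda>q. g q * inner (\<Phi> q (\<gamma> q)) b)"

lemma frame_coeff_Cinf:
  assumes E: "linear_bundle E" and c: "(V, \<Phi>) \<in> trivs E" and g: "bump (base E) W q0 g" and WV: "W \<subseteq> V"
    and s: "\<gamma> \<in> sections E"
  shows "frame_coeff \<Phi> g \<gamma> b \<in> Cinf (base E)"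
  unfolding frame_coeff_def
proof (rule bump_extend_Cinf[OF linear_bundleD(1)[OF E] g])
  fix q assume "q \<in> W"
  then have q: "q \<in> V" "q \<in> pts (base E)" using WV mopen_subset[OF bump_mopen[OF g]] by auto
  show "smooth_at (base E) (\<lambda>q. inner (\<Phi> q (\<gamma> q)) b) q"
    by (intro smooth_at_inner sections_smooth[OF E s c q(1)] smooth_at_const linear_bundleD(1)[OF E] q(2))
qed

text \<open>Every summand carries \<open>g\<close> twice, once in its coefficient and once in its
  frame section, so that both are defined globally. This accounts for the square on the
  left.\<close>

lemma frame_expansion:
  assumes E: "vector_bundle E" and c: "(V, \<Phi>) \<in> trivs E" and g: "bump (base E) W q0 g" and WV: "W \<subseteq> V"
    and s: "\<gamma> \<in> sections E"
  shows "(\<lambda>q. g q * g q) \<star> \<gamma> = (\<Sum>b\<in>onb. frame_coeff \<Phi> g \<gamma> b \<star> frame E V \<Phi> g b)"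
proof (rule sections_eqI[where E = E])
  note lb = vector_bundle_linear[OF E] note l = linear_bundleD[OF lb]
  show "(\<lambda>q. g q * g q) \<star> \<gamma> \<in> sections E"
    by (intro sections_fmult[OF lb] Cinf_mult l(1) bump_Cinf[OF g] s)
  show "(\<Sum>b\<in>onb. frame_coeff \<Phi> g \<gamma> b \<star> frame E V \<Phi> g b) \<in> sections E"
    by (intro sections_sum[OF lb] sections_fmult[OF lb] frame_coeff_Cinf[OF lb c g WV s] frame_section[OF E c g WV])
  fix q assume q: "q \<in> pts (base E)"
  show "((\<lambda>q. g q * g q) \<star> \<gamma>) q = (\<Sum>b\<in>onb. frame_coeff \<Phi> g \<gamma> b \<star> frame E V \<Phi> g b) q"
  proof (cases "q \<in> V")
    case False
    then have "g q = 0" using bump_zero[OF g q] WV by blast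
    then show ?thesis by (simp add: fmult_def frame_coeff_def sum_fun_apply)
  next
    case True
    have "(\<Sum>b\<in>onb. frame_coeff \<Phi> g \<gamma> b \<star> frame E V \<Phi> g b) q =
        (g q * g q) *\<^sub>R (\<Sum>b\<in>onb. inner (\<Phi> q (\<gamma> q)) b *\<^sub>R inv_into (fibre E q) (\<Phi> q) b)"
      using True by (simp add: fmult_def frame_coeff_def frame_def scaleR_sum_right sum_fun_apply mult_ac)
    then show ?thesis
      using vector_bundle_inv_expansion[OF E c True, of "\<Phi> q (\<gamma> q)"] vector_bundle_triv(4)[OF E c True] sections_fibre[OF s q]
      by (simp add: fmult_def)
  qed
qed

lemma vector_bundle_bump:
  assumes E: "vector_bundle E" and c: "(U, \<phi>) \<in> atlas (base E)" "(V, \<Phi>) \<in> trivs E" and q: "q \<in> U" "q \<in> V"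
  obtains W g where "W \<subseteq> U \<inter> V" "convex (\<phi> ` W)" "bump (base E) W q g"
proof -
  note l = linear_bundleD[OF vector_bundle_linear[OF E]]
  show thesis
    using smooth_manifold_bump_ball[OF vector_bundle_manifold[OF E] c(1)
        mopen_Int[OF l(1) mopen_chart[OF l(1) c(1)] l(3)[OF c(2)]], of q] q that by blast
qed

lemma vector_bundle_frame_at:
  assumes E: "vector_bundle E" and q: "q \<in> pts (base E)"
  obtains V \<Phi> W g where "(V, \<Phi>) \<in> trivs E" "bump (base E) W q g" "W \<subseteq> V"
  using vector_bundle_cover[OF assms] vector_bundle_bump[OF E] by (metis le_inf_iff)

lemma section_through:
  assumes E: "vector_bundle E" and q: "q \<in> pts (base E)" and e: "e \<in> fibre E q"
  obtains \<sigma> where "\<sigma> \<in> sections E" "\<sigma> q = e"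
proof -
  obtain V \<Phi> W g where c: "(V, \<Phi>) \<in> trivs E" "bump (base E) W q g" "W \<subseteq> V"
    by (rule vector_bundle_frame_at[OF E q])
  have qV: "q \<in> V" using bump_mem[OF c(2)] c(3) by blast
  show thesis
    by (rule that[OF frame_section[OF E c, of "\<Phi> q e"]])
      (simp add: frame_def qV bump_one[OF c(2)] vector_bundle_triv(4)[OF E c(1) qV e])
qed

section \<open>Localizing functionals on sections\<close>

lemma additive_zero:
  assumes E: "linear_bundle E" and add: "\<And>\<gamma> \<gamma>'. \<gamma> \<in> sections E \<Longrightarrow> \<gamma>' \<in> sections E \<Longrightarrow> L (\<gamma> + \<gamma>') = L \<gamma> + L \<gamma>'"
  shows "L 0 = (0 :: 'w::real_vector)"
  using add[OF sections_zero[OF E] sections_zero[OF E]] by simp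

lemma additive_sum:
  assumes E: "linear_bundle E" and add: "\<And>\<gamma> \<gamma>'. \<gamma> \<in> sections E \<Longrightarrow> \<gamma>' \<in> sections E \<Longrightarrow> L (\<gamma> + \<gamma>') = L \<gamma> + L \<gamma>'"
    and "finite A" "\<And>i. i \<in> A \<Longrightarrow> \<sigma> i \<in> sections E"
  shows "L (\<Sum>i\<in>A. \<sigma> i) = (\<Sum>i\<in>A. (L (\<sigma> i) :: 'w::real_vector))"
  using assms(3,4)
proof (induction A rule: finite_induct)
  case empty
  have "L 0 = 0" by (rule additive_zero[OF E add])
  then show ?case by (simp only: sum.empty)
next
  case (insert a A)
  have "L (\<Sum>i\<in>insert a A. \<sigma> i) = L (\<sigma> a + (\<Sum>i\<in>A. \<sigma> i))"
    by (subst sum.insert[OF insert.hyps]) (rule refl)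
  also have "\<dots> = L (\<sigma> a) + L (\<Sum>i\<in>A. \<sigma> i)"
    using insert.prems by (intro add sections_sum[OF E]) auto
  also have "L (\<Sum>i\<in>A. \<sigma> i) = (\<Sum>i\<in>A. L (\<sigma> i))"
    by (rule insert.IH) (use insert.prems in auto)
  finally show ?case by (subst (2) sum.insert[OF insert.hyps])
qed

text \<open>Apply both functionals to the frame expansion of \<open>g\<close> times \<open>g\<close>
  times the section. The derivation terms \<open>D\<close> are common to both, and a frame section
  whose coefficient vanishes at \<open>q\<close> contributes nothing else; \<open>g q = 1\<close>
  removes the cutoff. With \<open>D = 0\<close> this is tensoriality; with the Leibniz term of a
  tangent vector it extends an identity from the frame to all sections in
  \<open>lift_exists\<close>.\<close>

lemma leibniz_functional_unique:
  assumes E: "vector_bundle E" and q: "q \<in> pts (base E)"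
    and c: "(V, \<Phi>) \<in> trivs E" "bump (base E) W q g" "W \<subseteq> V"
    and L: "\<And>\<gamma> \<gamma>'. \<gamma> \<in> sections E \<Longrightarrow> \<gamma>' \<in> sections E \<Longrightarrow> L (\<gamma> + \<gamma>') = (L \<gamma> :: 'w::real_vector) + L \<gamma>'"
      "\<And>f \<gamma>. f \<in> Cinf (base E) \<Longrightarrow> \<gamma> \<in> sections E \<Longrightarrow> L (f \<star> \<gamma>) = f q *\<^sub>R L \<gamma> + D f \<gamma>"
    and K: "\<And>\<gamma> \<gamma>'. \<gamma> \<in> sections E \<Longrightarrow> \<gamma>' \<in> sections E \<Longrightarrow> K (\<gamma> + \<gamma>') = K \<gamma> + K \<gamma>'"
      "\<And>f \<gamma>. f \<in> Cinf (base E) \<Longrightarrow> \<gamma> \<in> sections E \<Longrightarrow> K (f \<star> \<gamma>) = f q *\<^sub>R K \<gamma> + D f \<gamma>"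
    and eq: "\<And>b. b \<in> onb \<Longrightarrow> frame_coeff \<Phi> g \<gamma> b q \<noteq> 0 \<Longrightarrow> L (frame E V \<Phi> g b) = K (frame E V \<Phi> g b)"
    and s: "\<gamma> \<in> sections E"
  shows "L \<gamma> = K \<gamma>"
proof -
  note lb = vector_bundle_linear[OF E] note l = linear_bundleD[OF lb]
  let ?f = "\<lambda>b. frame_coeff \<Phi> g \<gamma> b" and ?s = "frame E V \<Phi> g"
  have f: "?f b \<in> Cinf (base E)" for b by (rule frame_coeff_Cinf[OF lb c s])
  have fs: "?s b \<in> sections E" for b by (rule frame_section[OF E c])
  have ffs: "?f b \<star> ?s b \<in> sections E" for b by (rule sections_fmult[OF lb f fs])
  have gg: "(\<lambda>q. g q * g q) \<in> Cinf (base E)" by (intro Cinf_mult l(1) bump_Cinf[OF c(2)])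
  have "L ((\<lambda>q. g q * g q) \<star> \<gamma>) = (\<Sum>b\<in>onb. L (?f b \<star> ?s b))"
    unfolding frame_expansion[OF E c s] by (rule additive_sum[OF lb L(1)]) (auto intro: ffs)
  also have "\<dots> = (\<Sum>b\<in>onb. K (?f b \<star> ?s b))"
  proof (rule sum.cong[OF refl])
    fix b :: 'd assume "b \<in> onb"
    then show "L (?f b \<star> ?s b) = K (?f b \<star> ?s b)"
      using eq[of b] by (cases "?f b q = 0") (simp_all add: L(2)[OF f fs] K(2)[OF f fs])
  qed
  also have "\<dots> = K ((\<lambda>q. g q * g q) \<star> \<gamma>)"
    unfolding frame_expansion[OF E c s] by (rule additive_sum[OF lb K(1), symmetric]) (auto intro: ffs)
  finally show ?thesis using L(2)[OF gg s] K(2)[OF gg s] by (simp add: bump_one[OF c(2)])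
qed

text \<open>The difference of the two sections vanishes at \<open>q\<close>, hence so do its frame
  coefficients there, and comparison with the zero functional finishes the argument.\<close>

lemma tensorial_at:
  assumes E: "vector_bundle E" and q: "q \<in> pts (base E)"
    and L: "\<And>\<gamma> \<gamma>'. \<gamma> \<in> sections E \<Longrightarrow> \<gamma>' \<in> sections E \<Longrightarrow> L (\<gamma> + \<gamma>') = (L \<gamma> :: 'w::real_vector) + L \<gamma>'"
      "\<And>f \<gamma>. f \<in> Cinf (base E) \<Longrightarrow> \<gamma> \<in> sections E \<Longrightarrow> L (f \<star> \<gamma>) = f q *\<^sub>R L \<gamma>"
    and s: "\<gamma> \<in> sections E" "\<gamma>' \<in> sections E" "\<gamma> q = \<gamma>' q"
  shows "L \<gamma> = L \<gamma>'"
proof -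
  note lb = vector_bundle_linear[OF E] note l = linear_bundleD[OF lb]
  obtain V \<Phi> W g where c: "(V, \<Phi>) \<in> trivs E" "bump (base E) W q g" "W \<subseteq> V"
    by (rule vector_bundle_frame_at[OF E q])
  have qV: "q \<in> V" using bump_mem[OF c(2)] c(3) by blast
  have d: "\<gamma> - \<gamma>' \<in> sections E" by (rule sections_diff[OF lb s(1,2)])
  have "\<Phi> q 0 = 0" by (rule linear_on_zero[OF l(4)[OF c(1) qV] subspace_0[OF l(2)[OF q]]])
  then have "frame_coeff \<Phi> g (\<gamma> - \<gamma>') b q = 0" for b by (simp add: frame_coeff_def s(3))
  note z = this
  have "L (\<gamma> - \<gamma>') = (\<lambda>_. 0) (\<gamma> - \<gamma>')"
  proof (rule leibniz_functional_unique[OF E q c, where D = "\<lambda>_ _. 0" and L = L and K = "\<lambda>_. 0"])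
    show "L (f \<star> \<gamma>) = f q *\<^sub>R L \<gamma> + 0" if "f \<in> Cinf (base E)" "\<gamma> \<in> sections E" for f \<gamma>
      using L(2)[OF that] by simp
  qed (simp_all add: L(1) d z)
  then show ?thesis using L(1)[OF d s(2)] by simp
qed

lemma premanifoldI:
  assumes "\<And>U \<phi>. (U, \<phi>) \<in> atlas M \<Longrightarrow> U \<subseteq> pts M" "\<And>U \<phi>. (U, \<phi>) \<in> atlas M \<Longrightarrow> inj_on \<phi> U"
    "\<And>U \<phi>. (U, \<phi>) \<in> atlas M \<Longrightarrow> open (\<phi> ` U)"
    "\<And>p. p \<in> pts M \<Longrightarrow> \<exists>U \<phi>. (U, \<phi>) \<in> atlas M \<and> p \<in> U"
    "\<And>U \<phi> V \<psi>. (U, \<phi>) \<in> atlas M \<Longrightarrow> (V, \<psi>) \<in> atlas M \<Longrightarrow> open (\<phi> ` (U \<inter> V))"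
    "\<And>U \<phi> V \<psi>. (U, \<phi>) \<in> atlas M \<Longrightarrow> (V, \<psi>) \<in> atlas M \<Longrightarrow>
      smooth_on (\<phi> ` (U \<inter> V)) (\<psi> \<circ> inv_into U \<phi>)"
  shows "premanifold M"
proof -
  have "(\<Union>(U, \<phi>)\<in>atlas M. U) = pts M" using assms(1,4) by fast
  then show ?thesis unfolding premanifold_def using assms(1,2,3,5,6) by auto
qed

lemma vector_bundleI:
  assumes M: "smooth_manifold (base E)"
    and "\<And>q. q \<in> pts (base E) \<Longrightarrow> subspace (fibre E q)"
    "\<And>q. q \<in> pts (base E) \<Longrightarrow> \<exists>V \<Phi>. (V, \<Phi>) \<in> trivs E \<and> q \<in> V"
    and V: "\<And>V \<Phi>. (V, \<Phi>) \<in> trivs E \<Longrightarrow> mopen (base E) V"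
    and "\<And>V \<Phi> q. (V, \<Phi>) \<in> trivs E \<Longrightarrow> q \<in> V \<Longrightarrow> linear_on (fibre E q) (\<Phi> q)"
    "\<And>V \<Phi> q. (V, \<Phi>) \<in> trivs E \<Longrightarrow> q \<in> V \<Longrightarrow> bij_betw (\<Phi> q) (fibre E q) UNIV"
    and t: "\<And>V \<Phi> W \<Psi> y q. (V, \<Phi>) \<in> trivs E \<Longrightarrow> (W, \<Psi>) \<in> trivs E \<Longrightarrow> q \<in> V \<Longrightarrow> q \<in> W \<Longrightarrow>
      smooth_at (base E) (\<lambda>q. \<Psi> q (inv_into (fibre E q) (\<Phi> q) y)) q"
  shows "vector_bundle E"
proof -
  note pM = smooth_manifold_premanifold[OF M]
  have "smooth_fun_on (base E) (V \<inter> W) (\<lambda>q. \<Psi> q (inv_into (fibre E q) (\<Phi> q) y))"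
    if "(V, \<Phi>) \<in> trivs E" "(W, \<Psi>) \<in> trivs E" for V \<Phi> W \<Psi> y
    unfolding smooth_fun_on_iff[OF pM mopen_Int[OF pM V[OF that(1)] V[OF that(2)]]] using t[OF that] by blast
  moreover have "(\<Union>(V, \<Phi>)\<in>trivs E. V) = pts (base E)" using assms(3) V mopen_subset by fast
  ultimately show ?thesis unfolding vector_bundle_def using M assms(2) V assms(5,6)
    by (auto simp: openin_mtopology[OF pM])
qed

section \<open>Total spaces\<close>

lemma total_space_pts [simp]: "pts (total_space E) = Sigma (pts (base E)) (fibre E)"
  by (simp add: total_space_def)

lemma total_space_atlasE:
  assumes "(C, \<xi>) \<in> atlas (total_space E)"
  obtains U \<phi> V \<Phi> where "(U, \<phi>) \<in> atlas (base E)" "(V, \<Phi>) \<in> trivs E"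
    "C = Sigma (U \<inter> V) (fibre E)" "\<xi> = total_chart \<phi> \<Phi>"
  using assms by (auto simp: total_space_def)

lemma total_space_atlasI:
  "(U, \<phi>) \<in> atlas (base E) \<Longrightarrow> (V, \<Phi>) \<in> trivs E \<Longrightarrow>
   (Sigma (U \<inter> V) (fibre E), total_chart \<phi> \<Phi>) \<in> atlas (total_space E)"
  by (auto simp: total_space_def)

context
  fixes E :: "('a, 'm::coordinate_space, 'v::real_vector, 'f::coordinate_space) vbundle"
  assumes E: "vector_bundle E"
begin

private lemmas l = linear_bundleD[OF vector_bundle_linear[OF E]]

lemma total_chart_image:
  assumes c: "(V, \<Phi>) \<in> trivs E" and W: "W \<subseteq> V"
  shows "total_chart \<phi> \<Phi> ` Sigma W (fibre E) = \<phi> ` W \<times> UNIV"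
proof
  show "\<phi> ` W \<times> UNIV \<subseteq> total_chart \<phi> \<Phi> ` Sigma W (fibre E)"
  proof clarify
    fix q and y :: 'f assume q: "q \<in> W"
    then have "(\<phi> q, y) = total_chart \<phi> \<Phi> (q, inv_into (fibre E q) (\<Phi> q) y)"
      using vector_bundle_triv[OF E c, of q] W by (auto simp: total_chart_def)
    then show "(\<phi> q, y) \<in> total_chart \<phi> \<Phi> ` Sigma W (fibre E)"
      using q W vector_bundle_triv(2)[OF E c, of q] by blast
  qed
qed (auto simp: total_chart_def)

lemma inj_on_total_chart:
  assumes c: "(U, \<phi>) \<in> atlas (base E)" "(V, \<Phi>) \<in> trivs E"
  shows "inj_on (total_chart \<phi> \<Phi>) (Sigma (U \<inter> V) (fibre E))"
proof (rule inj_onI, clarify)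
  fix q e q' e'
  assume a: "q \<in> U" "q \<in> V" "e \<in> fibre E q" "q' \<in> U" "q' \<in> V" "e' \<in> fibre E q'"
    and eq: "total_chart \<phi> \<Phi> (q, e) = total_chart \<phi> \<Phi> (q', e')"
  then have qq: "q = q'" using premanifoldD(2)[OF l(1) c(1)] by (auto simp: total_chart_def dest: inj_onD)
  then have "\<Phi> q e = \<Phi> q e'" using eq by (simp add: total_chart_def)
  moreover have "inv_into (fibre E q) (\<Phi> q) (\<Phi> q e) = e" "inv_into (fibre E q) (\<Phi> q) (\<Phi> q e') = e'"
    using a qq by (auto intro!: vector_bundle_triv(4)[OF E c(2)])
  ultimately show "q = q' \<and> e = e'" using qq by metis
qed

lemma inv_total_chart:
  assumes c: "(U, \<phi>) \<in> atlas (base E)" "(V, \<Phi>) \<in> trivs E" and z: "z \<in> \<phi> ` (U \<inter> V)"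
  shows "inv_into (Sigma (U \<inter> V) (fibre E)) (total_chart \<phi> \<Phi>) (z, y) =
    (inv_into U \<phi> z, inv_into (fibre E (inv_into U \<phi> z)) (\<Phi> (inv_into U \<phi> z)) y)"
proof -
  obtain q where q: "q \<in> U" "q \<in> V" "z = \<phi> q" using z by blast
  have iq: "inv_into U \<phi> z = q" using premanifoldD(2)[OF l(1) c(1)] q by simp
  have "total_chart \<phi> \<Phi> (q, inv_into (fibre E q) (\<Phi> q) y) = (z, y)"
    using vector_bundle_triv(3)[OF E c(2) q(2)] q(3) by (simp add: total_chart_def)
  moreover have "(q, inv_into (fibre E q) (\<Phi> q) y) \<in> Sigma (U \<inter> V) (fibre E)"
    using q vector_bundle_triv(2)[OF E c(2) q(2)] by blast
  ultimately show ?thesis unfolding iq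
    using inv_into_f_f[OF inj_on_total_chart[OF c]] by metis
qed

lemma total_chart_Int_image:
  assumes c: "(U, \<phi>) \<in> atlas (base E)" "(V, \<Phi>) \<in> trivs E" and W: "mopen (base E) W"
  shows "total_chart \<phi> \<Phi> ` (Sigma W (fibre E) \<inter> Sigma (U \<inter> V) (fibre E)) = \<phi> ` (W \<inter> U \<inter> V) \<times> UNIV"
    and "open (total_chart \<phi> \<Phi> ` (Sigma W (fibre E) \<inter> Sigma (U \<inter> V) (fibre E)))"
proof -
  have "Sigma W (fibre E) \<inter> Sigma (U \<inter> V) (fibre E) = Sigma (W \<inter> U \<inter> V) (fibre E)" by blast
  then show eq: "total_chart \<phi> \<Phi> ` (Sigma W (fibre E) \<inter> Sigma (U \<inter> V) (fibre E)) = \<phi> ` (W \<inter> U \<inter> V) \<times> UNIV"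
    using total_chart_image[OF c(2), of "W \<inter> U \<inter> V" \<phi>] by auto
  have "open (\<phi> ` (W \<inter> V \<inter> U))"
    by (rule mopenD[OF mopen_Int[OF l(1) W l(3)[OF c(2)]] c(1)])
  then show "open (total_chart \<phi> \<Phi> ` (Sigma W (fibre E) \<inter> Sigma (U \<inter> V) (fibre E)))"
    unfolding eq by (simp add: open_Times Int_ac)
qed

text \<open>The bundle axioms give smoothness of a transition function in the base point for each
  fixed fibre vector. Joint smoothness follows by linearity: expand the fibre vector in the basis,
  so that only finitely many fixed vectors occur.\<close>

lemma total_space_transition:
  assumes c: "(U, \<phi>) \<in> atlas (base E)" "(V, \<Phi>) \<in> trivs E"
    and d: "(U', \<psi>) \<in> atlas (base E)" "(V', \<Psi>) \<in> trivs E"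
    and q: "q \<in> U" "q \<in> V" "q \<in> U'" "q \<in> V'"
  shows "smooth_near (total_chart \<psi> \<Psi> \<circ> inv_into (Sigma (U \<inter> V) (fibre E)) (total_chart \<phi> \<Phi>)) (\<phi> q, y)"
proof -
  have ops: "mopen (base E) (V \<inter> (U' \<inter> V'))"
    by (intro mopen_Int l(1) l(3)[OF c(2)] l(3)[OF d(2)] mopen_chart[OF l(1) d(1)])
  define S where "S = \<phi> ` (V \<inter> (U' \<inter> V') \<inter> U) \<times> (UNIV :: 'f set)"
  have S: "open S" unfolding S_def by (intro open_Times open_UNIV mopenD[OF ops c(1)])
  define I where "I = inv_into U \<phi>"
  define T where "T b z = \<Psi> (I z) (inv_into (fibre E (I z)) (\<Phi> (I z)) b)" for b z
  have smT: "smooth_near (T b) (\<phi> q)" for b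
    using vector_bundle_transition[OF E c(2) d(2) q(2,4), of b]
    unfolding smooth_at_chart[OF l(1) c(1) q(1)] T_def I_def .
  have sm\<psi>: "smooth_near (\<lambda>z. \<psi> (I z)) (\<phi> q)"
    using smooth_at_coordinate[OF l(1) d(1) q(3)]
    unfolding smooth_at_chart[OF l(1) c(1) q(1)] I_def .
  have 1: "smooth_near (\<lambda>p. h (fst p)) (\<phi> q, y)" if "smooth_near h (\<phi> q)" for h :: "'m \<Rightarrow> 'z::real_normed_vector"
    by (rule smooth_near_compose[OF smooth_near_linear[OF bounded_linear_fst]]) (use that in simp)
  have "smooth_near (\<lambda>p. (\<psi> (I (fst p)), \<Sum>b\<in>onb. inner (snd p) b *\<^sub>R T b (fst p))) (\<phi> q, y)"
    by (intro smooth_near_Pair smooth_near_sum smooth_near_scaleR smooth_near_inner 1 sm\<psi> smT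
        smooth_near_const smooth_near_linear[OF bounded_linear_snd])
  then show ?thesis
  proof (rule smooth_near_cong[OF _ S])
    show "(\<phi> q, y) \<in> S" using q by (auto simp: S_def)
    fix p assume "p \<in> S"
    then obtain x y' where x: "x \<in> V" "x \<in> U'" "x \<in> V'" "x \<in> U" "p = (\<phi> x, y')" by (auto simp: S_def)
    then have ix: "I (\<phi> x) = x" using premanifoldD(2)[OF l(1) c(1)] by (simp add: I_def)
    show "(\<psi> (I (fst p)), \<Sum>b\<in>onb. inner (snd p) b *\<^sub>R T b (fst p)) =
        (total_chart \<psi> \<Psi> \<circ> inv_into (Sigma (U \<inter> V) (fibre E)) (total_chart \<phi> \<Phi>)) p"
      using x inv_total_chart[OF c, of "\<phi> x" y'] ix
        vector_bundle_transition_expansion[OF E c(2) d(2) x(1,3), of y']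
      by (simp add: I_def[symmetric] T_def total_chart_def)
  qed
qed

lemma total_space_premanifold: "premanifold (total_space E)"
proof (rule premanifoldI)
  fix C \<xi> assume "(C, \<xi>) \<in> atlas (total_space E)"
  then obtain U \<phi> V \<Phi> where c: "(U, \<phi>) \<in> atlas (base E)" "(V, \<Phi>) \<in> trivs E"
    "C = Sigma (U \<inter> V) (fibre E)" "\<xi> = total_chart \<phi> \<Phi>" by (rule total_space_atlasE)
  show "C \<subseteq> pts (total_space E)" using premanifoldD(1)[OF l(1) c(1)] c(3) by auto
  show "inj_on \<xi> C" using inj_on_total_chart[OF c(1,2)] c(3,4) by simp
  have "C = Sigma (pts (base E)) (fibre E) \<inter> Sigma (U \<inter> V) (fibre E)"
    using premanifoldD(1)[OF l(1) c(1)] c(3) by auto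
  then show "open (\<xi> ` C)"
    using total_chart_Int_image(2)[OF c(1,2) mopen_pts[OF l(1)]] c(4) by simp
  fix C' \<xi>' assume "(C', \<xi>') \<in> atlas (total_space E)"
  then obtain U' \<psi> V' \<Psi> where d: "(U', \<psi>) \<in> atlas (base E)" "(V', \<Psi>) \<in> trivs E"
    "C' = Sigma (U' \<inter> V') (fibre E)" "\<xi>' = total_chart \<psi> \<Psi>" by (rule total_space_atlasE)
  have o: "mopen (base E) (U' \<inter> V')" by (intro mopen_Int l(1) l(3)[OF d(2)] mopen_chart[OF l(1) d(1)])
  note i = total_chart_Int_image[OF c(1,2) o]
  have CC: "C \<inter> C' = Sigma (U' \<inter> V') (fibre E) \<inter> Sigma (U \<inter> V) (fibre E)"
    using c(3) d(3) by blast
  show op: "open (\<xi> ` (C \<inter> C'))" using i(2) CC c(4) by simp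
  show "smooth_on (\<xi> ` (C \<inter> C')) (\<xi>' \<circ> inv_into C \<xi>)"
    unfolding smooth_on_iff_near[OF op]
  proof
    fix z assume "z \<in> \<xi> ` (C \<inter> C')"
    then obtain q y where "q \<in> U" "q \<in> V" "q \<in> U'" "q \<in> V'" "z = (\<phi> q, y)"
      using i(1) CC c(4) by auto
    then show "smooth_near (\<xi>' \<circ> inv_into C \<xi>) z"
      using total_space_transition[OF c(1,2) d(1,2)] c(3,4) d(3,4) by simp
  qed
next
  fix x assume "x \<in> pts (total_space E)"
  then obtain q e where qe: "x = (q, e)" "q \<in> pts (base E)" "e \<in> fibre E q" by auto
  obtain U \<phi> V \<Phi> where "(U, \<phi>) \<in> atlas (base E)" "(V, \<Phi>) \<in> trivs E" "q \<in> U" "q \<in> V"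
    by (rule vector_bundle_cover[OF E qe(2)])
  then show "\<exists>C \<xi>. (C, \<xi>) \<in> atlas (total_space E) \<and> x \<in> C"
    using total_space_atlasI[of U \<phi> E V \<Phi>] qe by (intro exI conjI) auto
qed

lemma mopen_Sigma:
  assumes W: "mopen (base E) W"
  shows "mopen (total_space E) (Sigma W (fibre E))"
  unfolding mopen_def
proof (intro conjI ballI, safe del: subsetI)
  show "Sigma W (fibre E) \<subseteq> pts (total_space E)" using mopen_subset[OF W] by auto
  fix C \<xi> assume "(C, \<xi>) \<in> atlas (total_space E)"
  then show "open (\<xi> ` (Sigma W (fibre E) \<inter> C))"
    by (rule total_space_atlasE) (use total_chart_Int_image(2)[OF _ _ W] in simp)
qed

lemma smooth_at_total_coordinate:
  assumes c: "(V, \<Phi>) \<in> trivs E" and q: "q \<in> V" "e \<in> fibre E q"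
  shows "smooth_at (total_space E) (\<lambda>(q, e). \<Phi> q e) (q, e)"
proof -
  obtain U \<phi> where d: "(U, \<phi>) \<in> atlas (base E)" "q \<in> U"
    using premanifold_chart[OF l(1)] mopen_subset[OF l(3)[OF c]] q by blast
  have "smooth_at (total_space E) (\<lambda>x. snd (total_chart \<phi> \<Phi> x)) (q, e)"
    by (rule smooth_at_coordinate_compose[OF total_space_premanifold total_space_atlasI[OF d(1) c]])
      (use d q in \<open>auto intro: smooth_near_linear bounded_linear_snd\<close>)
  then show ?thesis by (simp add: total_chart_def case_prod_beta')
qed

lemma smooth_at_basic:
  assumes q: "q \<in> pts (base E)" "e \<in> fibre E q" and f: "smooth_at (base E) f q"
  shows "smooth_at (total_space E) (f \<circ> fst) (q, e)"
proof -
  obtain U \<phi> V \<Phi> where c: "(U, \<phi>) \<in> atlas (base E)" "(V, \<Phi>) \<in> trivs E" "q \<in> U" "q \<in> V"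
    by (rule vector_bundle_cover[OF E q(1)])
  let ?C = "Sigma (U \<inter> V) (fibre E)"
  have qC: "(q, e) \<in> ?C" using c q by blast
  have "smooth_near (\<lambda>z. f (inv_into U \<phi> z)) (\<phi> q)" using f by (simp add: smooth_at_chart[OF l(1) c(1,3)])
  then have n: "smooth_near (\<lambda>p. f (inv_into U \<phi> (fst p))) (\<phi> q, \<Phi> q e)"
    by (intro smooth_near_compose[OF smooth_near_linear[OF bounded_linear_fst]]) simp
  have "smooth_at (total_space E) (\<lambda>x. f (inv_into U \<phi> (fst (total_chart \<phi> \<Phi> x)))) (q, e)"
    by (rule smooth_at_coordinate_compose[OF total_space_premanifold total_space_atlasI[OF c(1,2)] qC,
        of "\<lambda>p. f (inv_into U \<phi> (fst p))"]) (use n in \<open>simp add: total_chart_def\<close>)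
  then show ?thesis
    by (rule smooth_at_cong[OF total_space_premanifold _ mopen_chart[OF total_space_premanifold total_space_atlasI[OF c(1,2)]] qC])
      (use premanifoldD(2)[OF l(1) c(1)] in \<open>auto simp: total_chart_def\<close>)
qed

lemma Cinf_basic: "f \<in> Cinf (base E) \<Longrightarrow> f \<circ> fst \<in> Cinf (total_space E)"
  by (rule CinfI[OF total_space_premanifold]) (auto intro!: smooth_at_basic CinfD[OF l(1)])

lemma bump_total_space:
  assumes g: "bump (base E) W q g" and e: "e \<in> fibre E q"
  shows "bump (total_space E) (Sigma W (fibre E)) (q, e) (g \<circ> fst)"
proof -
  obtain N where N: "mopen (base E) N" "q \<in> N" "N \<subseteq> W" "\<forall>x\<in>N. g x = 1" using g unfolding bump_def by blast
  obtain Z where Z: "mopen (base E) Z" "W \<union> Z = pts (base E)" "\<forall>x\<in>Z. g x = 0" using g unfolding bump_def by blast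
  show ?thesis unfolding bump_def
  proof (intro conjI)
    show "mopen (total_space E) (Sigma W (fibre E))" by (rule mopen_Sigma[OF bump_mopen[OF g]])
    show "g \<circ> fst \<in> Cinf (total_space E)" by (rule Cinf_basic[OF bump_Cinf[OF g]])
    show "\<exists>N. mopen (total_space E) N \<and> (q, e) \<in> N \<and> N \<subseteq> Sigma W (fibre E) \<and> (\<forall>x\<in>N. (g \<circ> fst) x = 1)"
      by (rule exI[of _ "Sigma N (fibre E)"]) (use N e mopen_Sigma in auto)
    have "Sigma W (fibre E) \<union> Sigma Z (fibre E) = pts (total_space E)" using Z(2) by auto
    then show "\<exists>Z. mopen (total_space E) Z \<and> Sigma W (fibre E) \<union> Z = pts (total_space E) \<and> (\<forall>x\<in>Z. (g \<circ> fst) x = 0)"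
      by (intro exI[of _ "Sigma Z (fibre E)"]) (use Z mopen_Sigma in auto)
  qed
qed

text \<open>Over a set \<open>W\<close> of the base with convex coordinate image, the coordinate
  image of the total space is the product of that image with the whole model fibre, which is again
  convex. The bump function is constant along the fibres.\<close>

lemma total_space_convex_bumps: "convex_bumps (total_space E)"
  unfolding convex_bumps_def
proof (intro conjI ballI total_space_premanifold, safe)
  fix C \<xi> q e assume "(C, \<xi>) \<in> atlas (total_space E)" and qe: "(q, e) \<in> C"
  then obtain U \<phi> V \<Phi> where c: "(U, \<phi>) \<in> atlas (base E)" "(V, \<Phi>) \<in> trivs E"
    "C = Sigma (U \<inter> V) (fibre E)" "\<xi> = total_chart \<phi> \<Phi>" by (metis total_space_atlasE)
  then have q: "q \<in> U" "q \<in> V" "e \<in> fibre E q" using qe by auto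
  obtain W g where W: "W \<subseteq> U \<inter> V" "convex (\<phi> ` W)" "bump (base E) W q g"
    by (rule vector_bundle_bump[OF E c(1,2) q(1,2)])
  have "convex (\<xi> ` Sigma W (fibre E))"
    using total_chart_image[OF c(2), of W \<phi>] W c(4) by (auto intro: convex_Times)
  then show "\<exists>W G. W \<subseteq> C \<and> convex (\<xi> ` W) \<and> bump (total_space E) W (q, e) G"
    using bump_total_space[OF W(3) q(3)] W(1) c(3) by (intro exI[of _ "Sigma W (fibre E)"]) auto
qed

end

section \<open>The dual bundle\<close>

lemma dual_bundle_simps [simp]:
  "base (dual_bundle E) = base E"
  "fibre (dual_bundle E) q = {k. linear_on (fibre E q) k \<and> (\<forall>e. e \<notin> fibre E q \<longrightarrow> k e = 0)}"
  by (simp_all add: dual_bundle_def)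

lemma dual_bundle_trivsE:
  assumes "(V, \<Xi>) \<in> trivs (dual_bundle E)"
  obtains \<Phi> where "(V, \<Phi>) \<in> trivs E" "\<Xi> = dual_triv E \<Phi>"
  using assms by (auto simp: dual_bundle_def)

lemma dual_bundle_trivsI: "(V, \<Phi>) \<in> trivs E \<Longrightarrow> (V, dual_triv E \<Phi>) \<in> trivs (dual_bundle E)"
  by (auto simp: dual_bundle_def)

context
  fixes E :: "('a, 'm::coordinate_space, 'v::real_vector, 'f::coordinate_space) vbundle"
  assumes E: "vector_bundle E"
begin

private lemmas l' = linear_bundleD[OF vector_bundle_linear[OF E]]

lemma dual_triv_unique:
  assumes c: "(V, \<Phi>) \<in> trivs E" and q: "q \<in> V" and k: "\<And>e. e \<in> fibre E q \<Longrightarrow> k e = inner y (\<Phi> q e)"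
  shows "dual_triv E \<Phi> q k = y"
  unfolding dual_triv_def
proof (rule the_equality)
  fix y' assume y': "\<forall>e\<in>fibre E q. k e = inner y' (\<Phi> q e)"
  have "inner y' b = inner y b" for b
    using y' k[of "inv_into (fibre E q) (\<Phi> q) b"] vector_bundle_triv[OF E c q] by metis
  then show "y' = y" by (auto intro: onb_eqI)
qed (use k in blast)

text \<open>The vector representing a covector in the model fibre has as coordinates the values of
  the covector on the frame of the trivialization.\<close>

lemma dual_triv_eq:
  assumes c: "(V, \<Phi>) \<in> trivs E" and q: "q \<in> V" and k: "linear_on (fibre E q) k"
  shows "dual_triv E \<Phi> q k = (\<Sum>b\<in>onb. k (inv_into (fibre E q) (\<Phi> q) b) *\<^sub>R b)"
    and "e \<in> fibre E q \<Longrightarrow> k e = inner (dual_triv E \<Phi> q k) (\<Phi> q e)"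
proof -
  note t = vector_bundle_triv[OF E c q]
  have qp: "q \<in> pts (base E)" using mopen_subset[OF l'(3)[OF c]] q by blast
  have k: "k e = inner (\<Sum>b\<in>onb. k (inv_into (fibre E q) (\<Phi> q) b) *\<^sub>R b) (\<Phi> q e)" if e: "e \<in> fibre E q" for e
  proof -
    have "k e = k (\<Sum>b\<in>onb. inner (\<Phi> q e) b *\<^sub>R inv_into (fibre E q) (\<Phi> q) b)"
      using vector_bundle_inv_expansion[OF E c q, of "\<Phi> q e"] t(4)[OF e] by simp
    also have "\<dots> = (\<Sum>b\<in>onb. inner (\<Phi> q e) b *\<^sub>R k (inv_into (fibre E q) (\<Phi> q) b))"
      by (rule linear_on_sum[OF k l'(2)[OF qp]]) (auto intro: t)
    finally show ?thesis by (simp add: inner_sum_left inner_sum_right inner_commute mult.commute)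
  qed
  show d: "dual_triv E \<Phi> q k = (\<Sum>b\<in>onb. k (inv_into (fibre E q) (\<Phi> q) b) *\<^sub>R b)"
    by (rule dual_triv_unique[OF c q k])
  show "e \<in> fibre E q \<Longrightarrow> k e = inner (dual_triv E \<Phi> q k) (\<Phi> q e)"
    unfolding d by (rule k)
qed

lemma linear_on_inner_triv:
  assumes c: "(V, \<Phi>) \<in> trivs E" and q: "q \<in> V"
  shows "linear_on (fibre E q) (\<lambda>e. inner y (\<Phi> q e))"
  using linear_onD[OF l'(4)[OF c q]] by (simp add: linear_on_def inner_add_right)

lemma dual_covector_mem:
  assumes c: "(V, \<Phi>) \<in> trivs E" and q: "q \<in> V"
  shows "(\<lambda>e. if e \<in> fibre E q then inner y (\<Phi> q e) else 0) \<in> fibre (dual_bundle E) q"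
proof -
  have qp: "q \<in> pts (base E)" using mopen_subset[OF l'(3)[OF c]] q by blast
  show ?thesis using linear_onD[OF linear_on_inner_triv[OF c q]] l'(2)[OF qp]
    by (auto simp: linear_on_def subspace_add subspace_scale)
qed

lemma dual_triv_covector:
  assumes c: "(V, \<Phi>) \<in> trivs E" and q: "q \<in> V"
  shows "dual_triv E \<Phi> q (\<lambda>e. if e \<in> fibre E q then inner y (\<Phi> q e) else 0) = y"
  by (rule dual_triv_unique[OF c q]) simp

lemma dual_triv_bij:
  assumes c: "(V, \<Phi>) \<in> trivs E" and q: "q \<in> V"
  shows "bij_betw (dual_triv E \<Phi> q) (fibre (dual_bundle E) q) UNIV"
    and "inv_into (fibre (dual_bundle E) q) (dual_triv E \<Phi> q) y = (\<lambda>e. if e \<in> fibre E q then inner y (\<Phi> q e) else 0)"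
proof -
  have inj: "inj_on (dual_triv E \<Phi> q) (fibre (dual_bundle E) q)"
  proof (rule inj_onI)
    fix k k' assume k: "k \<in> fibre (dual_bundle E) q" "k' \<in> fibre (dual_bundle E) q"
      and eq: "dual_triv E \<Phi> q k = dual_triv E \<Phi> q k'"
    show "k = k'"
    proof
      fix e show "k e = k' e"
        using k eq dual_triv_eq(2)[OF c q, of k e] dual_triv_eq(2)[OF c q, of k' e] by (cases "e \<in> fibre E q") auto
    qed
  qed
  moreover have "range (\<lambda>y. dual_triv E \<Phi> q (\<lambda>e. if e \<in> fibre E q then inner y (\<Phi> q e) else 0)) = UNIV"
    using dual_triv_covector[OF c q] by auto
  then have "dual_triv E \<Phi> q ` fibre (dual_bundle E) q = UNIV"
    using dual_covector_mem[OF c q] by blast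
  ultimately show "bij_betw (dual_triv E \<Phi> q) (fibre (dual_bundle E) q) UNIV"
    by (simp add: bij_betw_def del: dual_bundle_simps)
  show "inv_into (fibre (dual_bundle E) q) (dual_triv E \<Phi> q) y = (\<lambda>e. if e \<in> fibre E q then inner y (\<Phi> q e) else 0)"
    using inv_into_f_f[OF inj dual_covector_mem[OF c q, of y]] dual_triv_covector[OF c q, of y] by simp
qed

lemma subspace_dual_fibre:
  assumes "subspace (fibre E q)"
  shows "subspace (fibre (dual_bundle E) q)"
  unfolding subspace_def dual_bundle_simps linear_on_def
  by (auto simp: scaleR_fun_def algebra_simps)

lemma linear_on_dual_triv:
  assumes c: "(V, \<Phi>) \<in> trivs E" and q: "q \<in> V"
  shows "linear_on (fibre (dual_bundle E) q) (dual_triv E \<Phi> q)"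
  unfolding linear_on_def
proof (intro conjI ballI allI)
  fix k k' r assume k: "k \<in> fibre (dual_bundle E) q"
  then have lk: "linear_on (fibre E q) k" by simp
  show "dual_triv E \<Phi> q (r *\<^sub>R k) = r *\<^sub>R dual_triv E \<Phi> q k"
    by (rule dual_triv_unique[OF c q]) (simp add: scaleR_fun_def dual_triv_eq(2)[OF c q lk])
  assume "k' \<in> fibre (dual_bundle E) q"
  then have lk': "linear_on (fibre E q) k'" by simp
  show "dual_triv E \<Phi> q (k + k') = dual_triv E \<Phi> q k + dual_triv E \<Phi> q k'"
    by (rule dual_triv_unique[OF c q]) (simp add: inner_add_left dual_triv_eq(2)[OF c q lk] dual_triv_eq(2)[OF c q lk'])
qed

text \<open>In orthonormal coordinates the transition of the dual bundle from \<Phi> to \<Psi> is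
  the transpose of the transition of \<open>E\<close> from \<Psi> to \<Phi>, so its entries are
  smooth.\<close>

lemma dual_transition_smooth:
  assumes c: "(V, \<Phi>) \<in> trivs E" "(W, \<Psi>) \<in> trivs E" and q: "q \<in> V" "q \<in> W"
  shows "smooth_at (base E) (\<lambda>q. dual_triv E \<Psi> q (inv_into (fibre (dual_bundle E) q) (dual_triv E \<Phi> q) y)) q"
proof -
  have VW: "mopen (base E) (V \<inter> W)" by (intro mopen_Int l'(1) l'(3)[OF c(1)] l'(3)[OF c(2)])
  have qp: "q \<in> pts (base E)" using mopen_subset[OF VW] q by blast
  have "smooth_at (base E) (\<lambda>q. \<Sum>b\<in>onb. inner y (\<Phi> q (inv_into (fibre E q) (\<Psi> q) b)) *\<^sub>R b) q"
    by (intro smooth_at_sum smooth_at_scaleR smooth_at_inner smooth_at_const l'(1) qp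
        vector_bundle_transition[OF E c(2,1) q(2,1)])
  then show ?thesis
  proof (rule smooth_at_cong[OF l'(1) _ VW])
    show "q \<in> V \<inter> W" using q by blast
    fix x assume x: "x \<in> V \<inter> W"
    then have x: "x \<in> V" "x \<in> W" by auto
    have "linear_on (fibre E x) (\<lambda>e. if e \<in> fibre E x then inner y (\<Phi> x e) else 0)"
      using dual_covector_mem[OF c(1) x(1), of y] by simp
    then show "(\<Sum>b\<in>onb. inner y (\<Phi> x (inv_into (fibre E x) (\<Psi> x) b)) *\<^sub>R b) =
        dual_triv E \<Psi> x (inv_into (fibre (dual_bundle E) x) (dual_triv E \<Phi> x) y)"
      unfolding dual_triv_bij(2)[OF c(1) x(1)]
      by (subst dual_triv_eq(1)[OF c(2) x(2)]) (simp_all add: vector_bundle_triv[OF E c(2) x(2)])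
  qed
qed

lemma dual_vector_bundle: "vector_bundle (dual_bundle E)"
proof -
  show ?thesis
  proof (rule vector_bundleI)
    show "smooth_manifold (base (dual_bundle E))" using vector_bundle_manifold[OF E] by simp
    show "subspace (fibre (dual_bundle E) q)" if "q \<in> pts (base (dual_bundle E))" for q
      by (rule subspace_dual_fibre[OF l'(2)]) (use that in simp)
    show "\<exists>V \<Xi>. (V, \<Xi>) \<in> trivs (dual_bundle E) \<and> q \<in> V" if q: "q \<in> pts (base (dual_bundle E))" for q
    proof -
      obtain V \<Phi> where "(V, \<Phi>) \<in> trivs E" "q \<in> V"
        using vector_bundle_cover[OF E, of q thesis] q by auto
      then show ?thesis using dual_bundle_trivsI by blast
    qed
    fix V \<Xi> assume "(V, \<Xi>) \<in> trivs (dual_bundle E)"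
    then obtain \<Phi> where c: "(V, \<Phi>) \<in> trivs E" and \<Xi>: "\<Xi> = dual_triv E \<Phi>" by (rule dual_bundle_trivsE)
    show "mopen (base (dual_bundle E)) V" using l'(3)[OF c] by simp
    show "linear_on (fibre (dual_bundle E) q) (\<Xi> q)" "bij_betw (\<Xi> q) (fibre (dual_bundle E) q) UNIV" if "q \<in> V" for q
      unfolding \<Xi> by (rule linear_on_dual_triv[OF c that], rule dual_triv_bij(1)[OF c that])
    fix W \<Xi>' y q assume "(W, \<Xi>') \<in> trivs (dual_bundle E)" and q: "q \<in> V" "q \<in> W"
    then obtain \<Psi> where d: "(W, \<Psi>) \<in> trivs E" and \<Xi>': "\<Xi>' = dual_triv E \<Psi>" by (blast elim: dual_bundle_trivsE)
    show "smooth_at (base (dual_bundle E)) (\<lambda>q. \<Xi>' q (inv_into (fibre (dual_bundle E) q) (\<Xi> q) y)) q"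
      unfolding dual_bundle_simps(1) \<Xi> \<Xi>' by (rule dual_transition_smooth[OF c d q])
  qed
qed

end

section \<open>Lifts to the dual bundle\<close>

definition anchor_map ::
    "('a, 'm::coordinate_space, 'v::real_vector, 'f::coordinate_space) vbundle \<Rightarrow> ('a, 'v) anchor \<Rightarrow> bool" where
  "anchor_map E \<rho> \<longleftrightarrow> (\<forall>q\<in>pts (base E). linear_on (fibre E q) (\<rho> q) \<and> \<rho> q ` fibre E q \<subseteq> tangent (base E) q)"

lemma bundle_morphism_anchor_map: "bundle_morphism E (tangent_bundle (base E)) \<rho> \<Longrightarrow> anchor_map E \<rho>"
  by (simp add: bundle_morphism_def anchor_map_def tangent_bundle_def)

lemma anchor_mapD:
  assumes "anchor_map E \<rho>" "q \<in> pts (base E)"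
  shows "linear_on (fibre E q) (\<rho> q)" "e \<in> fibre E q \<Longrightarrow> \<rho> q e \<in> tangent (base E) q"
  using assms by (auto simp: anchor_map_def)

lemma bilinear_sectionsD:
  assumes "bilinear_sections E B" "\<sigma> \<in> sections E" "\<tau> \<in> sections E"
  shows "B \<sigma> \<tau> \<in> sections E"
    "\<sigma>' \<in> sections E \<Longrightarrow> B (\<sigma> + \<sigma>') \<tau> = B \<sigma> \<tau> + B \<sigma>' \<tau>"
    "\<sigma>' \<in> sections E \<Longrightarrow> B \<tau> (\<sigma> + \<sigma>') = B \<tau> \<sigma> + B \<tau> \<sigma>'"
  using assms by (auto simp: bilinear_sections_def linear_on_def)

lemma connectionD:
  assumes "connection E \<rho> D" "\<sigma> \<in> sections E" "\<gamma> \<in> sections E"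
  shows "D \<sigma> \<gamma> \<in> sections E" "\<sigma>' \<in> sections E \<Longrightarrow> D (\<sigma> + \<sigma>') \<gamma> = D \<sigma> \<gamma> + D \<sigma>' \<gamma>"
    "\<sigma>' \<in> sections E \<Longrightarrow> D \<gamma> (\<sigma> + \<sigma>') = D \<gamma> \<sigma> + D \<gamma> \<sigma>'"
    "f \<in> Cinf (base E) \<Longrightarrow> D (f \<star> \<sigma>) \<gamma> = f \<star> D \<sigma> \<gamma>"
    "f \<in> Cinf (base E) \<Longrightarrow> D \<sigma> (f \<star> \<gamma>) = act \<rho> \<sigma> f \<star> \<gamma> + f \<star> D \<sigma> \<gamma>"
  using assms bilinear_sectionsD[of E D] unfolding connection_def by auto

context
  fixes E :: "('a, 'm::coordinate_space, 'v::real_vector, 'f::coordinate_space) vbundle"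
  assumes E: "vector_bundle E"
begin

private lemmas lb = vector_bundle_linear[OF E]
private lemmas pM = linear_bundleD(1)[OF lb]
private lemmas dE = dual_vector_bundle[OF E]
private lemmas pN = total_space_premanifold[OF dE]
private lemmas cbN = total_space_convex_bumps[OF dE]
private lemmas cbM = smooth_manifold_convex_bumps[OF vector_bundle_manifold[OF E]]

lemma dual_fibre_linear: "k \<in> fibre (dual_bundle E) q \<Longrightarrow> linear_on (fibre E q) k"
  by simp

lemma dual_fibre_zero: "k \<in> fibre (dual_bundle E) q \<Longrightarrow> q \<in> pts (base E) \<Longrightarrow> k 0 = 0"
  using linear_on_zero[OF dual_fibre_linear] subspace_0[OF linear_bundleD(2)[OF lb]] by blast

text \<open>In a trivialization this function is the inner product of the fibre coordinate of the
  dual bundle with the local expression of the section, and both are smooth on the total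
  space.\<close>

lemma hat_Cinf:
  assumes s: "\<gamma> \<in> sections E"
  shows "hat \<gamma> \<in> Cinf (dual_total E)"
proof (rule CinfI[OF pN])
  fix x assume "x \<in> pts (dual_total E)"
  then obtain q k where x: "x = (q, k)" "q \<in> pts (base E)" "k \<in> fibre (dual_bundle E) q" by auto
  obtain U \<phi> V \<Phi> where c: "(V, \<Phi>) \<in> trivs E" "q \<in> V" by (rule vector_bundle_cover[OF E x(2)])
  let ?V = "Sigma V (fibre (dual_bundle E))"
  have "smooth_at (dual_total E) (\<lambda>x. inner ((\<lambda>(q, k). dual_triv E \<Phi> q k) x) (((\<lambda>q. \<Phi> q (\<gamma> q)) \<circ> fst) x)) (q, k)"
    by (intro smooth_at_inner[OF pN] smooth_at_total_coordinate[OF dE dual_bundle_trivsI[OF c(1)] c(2) x(3)]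
        smooth_at_basic[OF dE]) (use x sections_smooth[OF lb s c] in simp_all)
  then show "smooth_at (dual_total E) (hat \<gamma>) x"
    unfolding x(1)
  proof (rule smooth_at_cong[OF pN _ mopen_Sigma[OF dE]])
    show "mopen (base (dual_bundle E)) V" using linear_bundleD(3)[OF lb c(1)] by simp
    show "(q, k) \<in> ?V" using c x by simp
    fix y assume "y \<in> ?V"
    then obtain p j where y: "y = (p, j)" "p \<in> V" "j \<in> fibre (dual_bundle E) p" by auto
    then have "p \<in> pts (base E)" using mopen_subset[OF linear_bundleD(3)[OF lb c(1)]] by blast
    from dual_triv_eq(2)[OF E c(1) y(2) dual_fibre_linear[OF y(3)] sections_fibre[OF s this]]
    show "inner ((\<lambda>(q, k). dual_triv E \<Phi> q k) y) (((\<lambda>q. \<Phi> q (\<gamma> q)) \<circ> fst) y) = hat \<gamma> y"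
      by (simp add: y hat_def)
  qed
qed

lemma hat_add:
  assumes "\<gamma> \<in> sections E" "\<gamma>' \<in> sections E" "x \<in> pts (dual_total E)"
  shows "hat (\<gamma> + \<gamma>') x = hat \<gamma> x + hat \<gamma>' x"
  using assms by (auto simp: hat_def sections_fibre linear_onD(1)[of "fibre E (fst x)"])

lemma hat_fmult:
  assumes "\<gamma> \<in> sections E" "x \<in> pts (dual_total E)"
  shows "hat (f \<star> \<gamma>) x = (f \<circ> fst) x * hat \<gamma> x"
  using assms by (auto simp: hat_def fmult_apply sections_fibre linear_onD(2)[of "fibre E (fst x)"])

lemma pairing_Cinf:
  assumes k: "\<kappa> \<in> sections (dual_bundle E)" and s: "\<gamma> \<in> sections E"
  shows "pairing \<kappa> \<gamma> \<in> Cinf (base E)"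
proof (rule CinfI[OF pM])
  fix q assume q: "q \<in> pts (base E)"
  obtain U \<phi> V \<Phi> where c: "(V, \<Phi>) \<in> trivs E" "q \<in> V" by (rule vector_bundle_cover[OF E q])
  note V = linear_bundleD(3)[OF lb c(1)]
  have "smooth_at (base E) (\<lambda>q. inner (dual_triv E \<Phi> q (\<kappa> q)) (\<Phi> q (\<gamma> q))) q"
    using smooth_at_inner[OF pM sections_smooth[OF vector_bundle_linear[OF dE] k dual_bundle_trivsI[OF c(1)] c(2), simplified]
      sections_smooth[OF lb s c]] .
  then show "smooth_at (base E) (pairing \<kappa> \<gamma>) q"
  proof (rule smooth_at_cong[OF pM _ V c(2)])
    fix p assume p: "p \<in> V"
    then have pp: "p \<in> pts (base E)" using mopen_subset[OF V] by blast
    have "\<kappa> p \<in> fibre (dual_bundle E) p" using sections_fibre[OF k] pp by simp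
    from dual_triv_eq(2)[OF E c(1) p dual_fibre_linear[OF this] sections_fibre[OF s pp]]
    show "inner (dual_triv E \<Phi> p (\<kappa> p)) (\<Phi> p (\<gamma> p)) = pairing \<kappa> \<gamma> p" by (simp add: pairing_def)
  qed
qed

lemma tangent_hat_add:
  assumes v: "v \<in> tangent (dual_total E) x" and x: "x \<in> pts (dual_total E)"
    and s: "\<gamma> \<in> sections E" "\<gamma>' \<in> sections E"
  shows "v (hat (\<gamma> + \<gamma>')) = v (hat \<gamma>) + v (hat \<gamma>')"
proof -
  have "v (hat (\<gamma> + \<gamma>')) = v (\<lambda>x. hat \<gamma> x + hat \<gamma>' x)"
    by (rule tangent_eq[OF pN v x hat_Cinf[OF sections_add[OF lb s]] hat_add[OF s]])
  then show ?thesis by (simp add: tangent_add[OF v hat_Cinf[OF s(1)] hat_Cinf[OF s(2)]])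
qed

lemma tangent_hat_fmult:
  assumes v: "v \<in> tangent (dual_total E) (q, k)" and x: "(q, k) \<in> pts (dual_total E)"
    and f: "f \<in> Cinf (base E)" and s: "\<gamma> \<in> sections E"
  shows "v (hat (f \<star> \<gamma>)) = f q * v (hat \<gamma>) + v (f \<circ> fst) * k (\<gamma> q)"
proof -
  have b: "f \<circ> fst \<in> Cinf (dual_total E)" using Cinf_basic[OF dE] f by simp
  have "v (hat (f \<star> \<gamma>)) = v (\<lambda>x. (f \<circ> fst) x * hat \<gamma> x)"
    by (rule tangent_eq[OF pN v x hat_Cinf[OF sections_fmult[OF lb f s]] hat_fmult[OF s]])
  then show ?thesis using tangent_mult[OF v b hat_Cinf[OF s]] by (simp add: hat_def)
qed

section \<open>Tangent vectors of the dual bundle in bundle coordinates\<close>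

context
  fixes U \<phi> V \<Phi> q k
  assumes c: "(U, \<phi>) \<in> atlas (base E)" "(V, \<Phi>) \<in> trivs E" and q: "q \<in> U" "q \<in> V"
    and k: "k \<in> fibre (dual_bundle E) q"
begin

abbreviation "dual_domain \<equiv> Sigma (U \<inter> V) (fibre (dual_bundle E))"
abbreviation "dual_chart \<equiv> total_chart \<phi> (dual_triv E \<Phi>)"

lemma dual_chart_atlas: "(dual_domain, dual_chart) \<in> atlas (dual_total E)"
  by (rule total_space_atlasI[OF _ dual_bundle_trivsI[OF c(2)]]) (use c in simp)

lemma dual_domain_mem: "(q, k) \<in> dual_domain"
  using q k by blast

lemma dual_point_mem: "q \<in> pts (base E)" "(q, k) \<in> pts (dual_total E)"
  using q k mopen_subset[OF linear_bundleD(3)[OF lb c(2)]] by auto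

lemma coord_vec_basic:
  assumes f: "f \<in> Cinf (base E)"
  shows "coord_vec (dual_total E) dual_domain dual_chart (q, k) a (f \<circ> fst) = coord_vec (base E) U \<phi> q (fst a) f"
proof (rule coord_vec_eq)
  show "f \<circ> fst \<in> Cinf (dual_total E)" using Cinf_basic[OF dE] f by simp
  have "((\<lambda>z. f (inv_into U \<phi> (fst z))) has_derivative (\<lambda>a. coord_vec (base E) U \<phi> q (fst a) f))
      (at (dual_chart (q, k)))"
    by (rule has_derivative_compose[of fst fst _ _ "\<lambda>z. f (inv_into U \<phi> z)"])
      (auto simp: total_chart_def intro!: Cinf_chart_derivative[OF pM c(1) q(1) f] derivative_intros)
  then show "((\<lambda>z. (f \<circ> fst) (inv_into dual_domain dual_chart z)) has_derivative
      (\<lambda>a. coord_vec (base E) U \<phi> q (fst a) f)) (at (dual_chart (q, k)))"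
  proof (rule has_derivative_transform_within_open[OF _ premanifoldD(3)[OF pN dual_chart_atlas]])
    fix z assume "z \<in> dual_chart ` dual_domain"
    then have "fst z \<in> \<phi> ` (U \<inter> V)" by (auto simp: total_chart_def)
    then show "f (inv_into U \<phi> (fst z)) = (f \<circ> fst) (inv_into dual_domain dual_chart z)"
      using inv_total_chart[OF dE _ dual_bundle_trivsI[OF c(2)], of U \<phi> "fst z" "snd z"] c(1) by simp
  qed (use dual_domain_mem in blast)
qed

text \<open>In coordinates \<open>(z, y)\<close> a linear function is the inner product of
  \<open>y\<close> with the local expression of the section at \<open>z\<close>; the two summands
  are its product rule.\<close>

lemma coord_vec_hat:
  assumes s: "\<gamma> \<in> sections E"
    and F: "((\<lambda>z. \<Phi> (inv_into U \<phi> z) (\<gamma> (inv_into U \<phi> z))) has_derivative F') (at (\<phi> q))"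
  shows "coord_vec (dual_total E) dual_domain dual_chart (q, k) a (hat \<gamma>) =
    inner (dual_triv E \<Phi> q k) (F' (fst a)) + inner (snd a) (\<Phi> q (\<gamma> q))"
proof (rule coord_vec_eq[OF hat_Cinf[OF s]])
  have iq: "inv_into U \<phi> (\<phi> q) = q" using premanifoldD(2)[OF pM c(1)] q by simp
  let ?F = "\<lambda>z. \<Phi> (inv_into U \<phi> z) (\<gamma> (inv_into U \<phi> z))"
  have "((\<lambda>z. inner (snd z) (?F (fst z))) has_derivative
      (\<lambda>a. inner (snd (dual_chart (q, k))) (F' (fst a)) + inner (snd a) (?F (fst (dual_chart (q, k))))))
      (at (dual_chart (q, k)))"
  proof (rule has_derivative_inner)
    show "((\<lambda>z. ?F (fst z)) has_derivative (\<lambda>a. F' (fst a))) (at (dual_chart (q, k)))"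
      by (rule has_derivative_compose[of fst fst _ _ ?F])
        (auto simp: total_chart_def intro!: F derivative_intros)
  qed (auto intro!: derivative_intros)
  then have "((\<lambda>z. inner (snd z) (?F (fst z))) has_derivative
      (\<lambda>a. inner (dual_triv E \<Phi> q k) (F' (fst a)) + inner (snd a) (\<Phi> q (\<gamma> q)))) (at (dual_chart (q, k)))"
    by (simp add: total_chart_def iq)
  then show "((\<lambda>z. hat \<gamma> (inv_into dual_domain dual_chart z)) has_derivative
      (\<lambda>a. inner (dual_triv E \<Phi> q k) (F' (fst a)) + inner (snd a) (\<Phi> q (\<gamma> q)))) (at (dual_chart (q, k)))"
  proof (rule has_derivative_transform_within_open[OF _ premanifoldD(3)[OF pN dual_chart_atlas]])
    fix z assume "z \<in> dual_chart ` dual_domain"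
    then obtain p j where p: "p \<in> U" "p \<in> V" "j \<in> fibre (dual_bundle E) p" "z = dual_chart (p, j)" by blast
    then have iz: "inv_into dual_domain dual_chart z = (p, j)"
      using premanifoldD(2)[OF pN dual_chart_atlas] by (metis IntI SigmaI inv_into_f_f)
    have pp: "p \<in> pts (base E)" using mopen_subset[OF linear_bundleD(3)[OF lb c(2)]] p by blast
    have "inv_into U \<phi> (\<phi> p) = p" using premanifoldD(2)[OF pM c(1)] p by simp
    then show "inner (snd z) (?F (fst z)) = hat \<gamma> (inv_into dual_domain dual_chart z)"
      using dual_triv_eq(2)[OF E c(2) p(2) dual_fibre_linear[OF p(3)] sections_fibre[OF s pp]]
      by (simp add: iz hat_def) (simp add: p(4) total_chart_def)
  qed (use dual_domain_mem in blast)
qed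

lemma coord_vec_hat_vertical:
  assumes s: "\<gamma> \<in> sections E"
  shows "coord_vec (dual_total E) dual_domain dual_chart (q, k) (0, y) (hat \<gamma>) = inner y (\<Phi> q (\<gamma> q))"
proof -
  let ?F = "\<lambda>z. \<Phi> (inv_into U \<phi> z) (\<gamma> (inv_into U \<phi> z))"
  have "smooth_near ?F (\<phi> q)"
    using sections_smooth[OF lb s c(2) q(2)] by (simp add: smooth_at_chart[OF pM c(1) q(1)])
  then have F: "(?F has_derivative frechet_derivative ?F (at (\<phi> q))) (at (\<phi> q))"
    using smooth_near_differentiable by (simp add: frechet_derivative_works)
  have "frechet_derivative ?F (at (\<phi> q)) 0 = 0"
    using linear_0[OF has_derivative_linear[OF F]] .
  then show ?thesis using coord_vec_hat[OF s F, of "(0, y)"] by simp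
qed

text \<open>Where \<open>g\<close> is 1 the frame section has the constant local expression
  \<open>b\<close>, so its linear function is a fibre coordinate. Thus global linear functions read
  off fibre components. The point \<open>q\<close> ranges over all of \<open>N\<close>, not only the
  centre \<open>q0\<close>, because smoothness of lifts calls for the formula on a whole
  neighbourhood.\<close>

lemma coord_vec_hat_frame:
  assumes g: "bump (base E) W q0 g" "W \<subseteq> V" and N: "mopen (base E) N" "q \<in> N" "\<And>p. p \<in> N \<Longrightarrow> g p = 1"
  shows "coord_vec (dual_total E) dual_domain dual_chart (q, k) a (hat (frame E V \<Phi> g b)) = inner (snd a) b"
proof -
  have op: "mopen (base E) (N \<inter> V)" by (intro mopen_Int pM N(1) linear_bundleD(3)[OF lb c(2)])
  let ?F = "\<lambda>z. \<Phi> (inv_into U \<phi> z) (frame E V \<Phi> g b (inv_into U \<phi> z))"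
  have "((\<lambda>z. b) has_derivative (\<lambda>a. 0)) (at (\<phi> q))" by simp
  then have "(?F has_derivative (\<lambda>a. 0)) (at (\<phi> q))"
    by (rule has_derivative_transform_within_open[OF _ mopenD[OF op c(1)]])
      (use premanifoldD(2)[OF pM c(1)] q N in \<open>auto simp: frame_triv[OF E c(2)]\<close>)
  from coord_vec_hat[OF frame_section[OF E c(2) g] this]
  show ?thesis by (simp add: frame_triv[OF E c(2) q(2)] N(2,3))
qed

lemma tangent_component_hat:
  assumes g: "bump (base E) W q0 g" "W \<subseteq> V" and N: "mopen (base E) N" "q \<in> N" "\<And>p. p \<in> N \<Longrightarrow> g p = 1"
    and X: "X \<in> tangent (dual_total E) (q, k)"
  shows "inner (snd (inv (coord_vec (dual_total E) dual_domain dual_chart (q, k)) X)) b = X (hat (frame E V \<Phi> g b))"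
  using coord_vec_hat_frame[OF g N, of "inv (coord_vec (dual_total E) dual_domain dual_chart (q, k)) X" b]
    inv_coord_vec(2)[OF cbN dual_chart_atlas dual_domain_mem X] by simp

text \<open>On basic functions a tangent vector acts through its base component alone. If it
  annihilates them, that component represents the zero vector of the base and is 0 by injectivity of
  \<open>coord_vec\<close>.\<close>

lemma vertical_coord_vec:
  assumes X: "X \<in> tangent (dual_total E) (q, k)" and v: "\<And>f. f \<in> Cinf (base E) \<Longrightarrow> X (f \<circ> fst) = 0"
  shows "X = coord_vec (dual_total E) dual_domain dual_chart (q, k)
    (0, snd (inv (coord_vec (dual_total E) dual_domain dual_chart (q, k)) X))"
proof -
  let ?c = "coord_vec (dual_total E) dual_domain dual_chart (q, k)"
  define a where "a = inv ?c X"
  have Xa: "?c a = X" unfolding a_def by (rule inv_coord_vec(2)[OF cbN dual_chart_atlas dual_domain_mem X])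
  have "coord_vec (base E) U \<phi> q (fst a) f = coord_vec (base E) U \<phi> q 0 f" for f
  proof (cases "f \<in> Cinf (base E)")
    case True
    have "coord_vec (base E) U \<phi> q (fst a) f = 0"
      using coord_vec_basic[OF True, of a] v[OF True] by (simp add: Xa)
    moreover have "coord_vec (base E) U \<phi> q 0 = 0" by (rule linear_0[OF linear_coord_vec[OF pM c(1) q(1)]])
    ultimately show ?thesis by simp
  qed (simp add: coord_vec_def)
  then have "coord_vec (base E) U \<phi> q (fst a) = coord_vec (base E) U \<phi> q 0" by (rule ext)
  then have "inv (coord_vec (base E) U \<phi> q) (coord_vec (base E) U \<phi> q (fst a)) =
      inv (coord_vec (base E) U \<phi> q) (coord_vec (base E) U \<phi> q 0)" by (rule arg_cong)
  then have "fst a = 0" by (simp only: inv_coord_vec(1)[OF cbM c(1) q(1)])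
  then have "a = (0, snd a)" by (simp add: prod_eq_iff)
  then show ?thesis using Xa unfolding a_def[symmetric] by simp
qed

end

text \<open>The difference is vertical because it annihilates basic functions, and its fibre
  components are its values on the linear functions of a frame, which are 0. This gives uniqueness
  of all lifts.\<close>

lemma dual_tangent_eqI:
  assumes x: "x \<in> pts (dual_total E)" and XY: "X \<in> tangent (dual_total E) x" "Y \<in> tangent (dual_total E) x"
    and b: "\<And>f. f \<in> Cinf (base E) \<Longrightarrow> X (f \<circ> fst) = Y (f \<circ> fst)"
    and h: "\<And>\<gamma>. \<gamma> \<in> sections E \<Longrightarrow> X (hat \<gamma>) = Y (hat \<gamma>)"
  shows "X = Y"
proof -
  obtain q k where x: "x = (q, k)" "q \<in> pts (base E)" "k \<in> fibre (dual_bundle E) q" using x by auto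
  obtain U \<phi> V \<Phi> where c: "(U, \<phi>) \<in> atlas (base E)" "(V, \<Phi>) \<in> trivs E" and q: "q \<in> U" "q \<in> V"
    by (rule vector_bundle_cover[OF E x(2)])
  obtain W g where W: "W \<subseteq> U \<inter> V" "bump (base E) W q g" by (rule vector_bundle_bump[OF E c q])
  obtain N where N: "mopen (base E) N" "q \<in> N" "\<And>p. p \<in> N \<Longrightarrow> g p = 1" using W(2) unfolding bump_def by blast
  let ?Z = "X - Y"
  have Z: "?Z \<in> tangent (dual_total E) (q, k)" using subspace_diff[OF subspace_tangent XY] x(1) by simp
  have "inner (snd (inv (coord_vec (dual_total E) (dual_domain U V) (dual_chart \<phi> \<Phi>) (q, k)) ?Z)) b = 0" for b
  proof -
    have WV: "W \<subseteq> V" using W(1) by blast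
    have "inner (snd (inv (coord_vec (dual_total E) (dual_domain U V) (dual_chart \<phi> \<Phi>) (q, k)) ?Z)) b =
        ?Z (hat (frame E V \<Phi> g b))"
      by (rule tangent_component_hat[OF c q x(3) W(2) WV N Z])
    also have "\<dots> = 0" using h[OF frame_section[OF E c(2) W(2) WV, of b]] by simp
    finally show ?thesis .
  qed
  note z = this
  have "snd (inv (coord_vec (dual_total E) (dual_domain U V) (dual_chart \<phi> \<Phi>) (q, k)) ?Z) = 0"
    by (rule onb_eq_zero, rule z)
  moreover have "?Z = coord_vec (dual_total E) (dual_domain U V) (dual_chart \<phi> \<Phi>) (q, k)
      (0, snd (inv (coord_vec (dual_total E) (dual_domain U V) (dual_chart \<phi> \<Phi>) (q, k)) ?Z))"
    by (rule vertical_coord_vec[OF c q x(3) Z]) (simp add: b)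
  ultimately have "?Z = coord_vec (dual_total E) (dual_domain U V) (dual_chart \<phi> \<Phi>) (q, k) 0"
    by (simp add: zero_prod_def)
  also have "\<dots> = 0"
    by (rule linear_0[OF linear_coord_vec[OF pN dual_chart_atlas[OF c q x(3)] dual_domain_mem[OF c q x(3)]]])
  finally show ?thesis by simp
qed

text \<open>The base component is that of \<open>a\<close>, and the fibre component is prescribed by
  the values of \<open>b\<close> on a frame. The two hypotheses on \<open>b\<close> are exactly the
  rules that any tangent vector obeys on linear functions, so agreement on the frame propagates to
  all sections by \<open>leibniz_functional_unique\<close>.\<close>

lemma lift_exists:
  assumes q: "q \<in> pts (base E)" and k: "k \<in> fibre (dual_bundle E) q" and a: "a \<in> tangent (base E) q"
    and b: "\<And>\<gamma> \<gamma>'. \<gamma> \<in> sections E \<Longrightarrow> \<gamma>' \<in> sections E \<Longrightarrow> b (\<gamma> + \<gamma>') = b \<gamma> + b \<gamma>'"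
      "\<And>f \<gamma>. f \<in> Cinf (base E) \<Longrightarrow> \<gamma> \<in> sections E \<Longrightarrow> b (f \<star> \<gamma>) = f q * b \<gamma> + a f * k (\<gamma> q)"
  shows "\<exists>X\<in>tangent (dual_total E) (q, k). (\<forall>f\<in>Cinf (base E). X (f \<circ> fst) = a f) \<and>
    (\<forall>\<gamma>\<in>sections E. X (hat \<gamma>) = b \<gamma>)"
proof -
  obtain U \<phi> V \<Phi> where c: "(U, \<phi>) \<in> atlas (base E)" "(V, \<Phi>) \<in> trivs E" and qU: "q \<in> U" "q \<in> V"
    by (rule vector_bundle_cover[OF E q])
  obtain W g where W: "W \<subseteq> U \<inter> V" "bump (base E) W q g" by (rule vector_bundle_bump[OF E c qU])
  have WV: "W \<subseteq> V" using W by blast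
  obtain N where N: "mopen (base E) N" "q \<in> N" "\<And>p. p \<in> N \<Longrightarrow> g p = 1" using W(2) unfolding bump_def by blast
  define u where "u = inv (coord_vec (base E) U \<phi> q) a"
  have u: "coord_vec (base E) U \<phi> q u = a" unfolding u_def by (rule inv_coord_vec(2)[OF cbM c(1) qU(1) a])
  define y where "y = (\<Sum>e\<in>onb. b (frame E V \<Phi> g e) *\<^sub>R e)"
  define X where "X = coord_vec (dual_total E) (dual_domain U V) (dual_chart \<phi> \<Phi>) (q, k) (u, y)"
  note pt = dual_point_mem[OF c qU k]
  have X: "X \<in> tangent (dual_total E) (q, k)" unfolding X_def
    by (rule coord_vec_tangent[OF pN dual_chart_atlas[OF c qU k] dual_domain_mem[OF c qU k]])
  have Xf: "X (f \<circ> fst) = a f" if "f \<in> Cinf (base E)" for f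
    using coord_vec_basic[OF c qU k that, of "(u, y)"] by (simp add: X_def u)
  have "X (hat \<gamma>) = b \<gamma>" if s: "\<gamma> \<in> sections E" for \<gamma>
  proof (rule leibniz_functional_unique[OF E q c(2) W(2) WV, where L = "\<lambda>\<gamma>. X (hat \<gamma>)" and K = b
        and D = "\<lambda>f \<gamma>. a f * k (\<gamma> q)"])
    show "X (hat (f \<star> \<gamma>)) = f q *\<^sub>R X (hat \<gamma>) + a f * k (\<gamma> q)" if "f \<in> Cinf (base E)" "\<gamma> \<in> sections E" for f \<gamma>
      using tangent_hat_fmult[OF X pt(2) that] Xf[OF that(1)] by simp
    show "X (hat (frame E V \<Phi> g e)) = b (frame E V \<Phi> g e)" if "e \<in> onb" for e
      using coord_vec_hat_frame[OF c qU k W(2) WV N, of "(u, y)" e] that by (simp add: X_def y_def inner_sum_onb)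
    show "X (hat (\<gamma> + \<gamma>')) = X (hat \<gamma>) + X (hat \<gamma>')" if "\<gamma> \<in> sections E" "\<gamma>' \<in> sections E" for \<gamma> \<gamma>'
      by (rule tangent_hat_add[OF X pt(2) that])
  qed (use b s in simp_all)
  then show ?thesis using X Xf by blast
qed

lemma lift_vec_props:
  assumes q: "q \<in> pts (base E)" and k: "k \<in> fibre (dual_bundle E) q" and a: "a \<in> tangent (base E) q"
    and b: "\<And>\<gamma> \<gamma>'. \<gamma> \<in> sections E \<Longrightarrow> \<gamma>' \<in> sections E \<Longrightarrow> b (\<gamma> + \<gamma>') = b \<gamma> + b \<gamma>'"
      "\<And>f \<gamma>. f \<in> Cinf (base E) \<Longrightarrow> \<gamma> \<in> sections E \<Longrightarrow> b (f \<star> \<gamma>) = f q * b \<gamma> + a f * k (\<gamma> q)"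
  shows "lift_vec E (q, k) a b \<in> tangent (dual_total E) (q, k)"
    "f \<in> Cinf (base E) \<Longrightarrow> lift_vec E (q, k) a b (f \<circ> fst) = a f"
    "\<gamma> \<in> sections E \<Longrightarrow> lift_vec E (q, k) a b (hat \<gamma>) = b \<gamma>"
proof -
  have x: "(q, k) \<in> pts (dual_total E)" using q k by simp
  let ?P = "\<lambda>X. X \<in> tangent (dual_total E) (q, k) \<and>
     (\<forall>f\<in>Cinf (base E). X (f \<circ> fst) = a f) \<and> (\<forall>\<gamma>\<in>sections E. X (hat \<gamma>) = b \<gamma>)"
  have "\<exists>!X. ?P X"
  proof (rule ex_ex1I)
    show "\<exists>X. ?P X" using lift_exists[OF assms] by blast
    show "X = Y" if "?P X" "?P Y" for X Y
      by (rule dual_tangent_eqI[OF x]) (use that in auto)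
  qed
  then have "?P (lift_vec E (q, k) a b)" unfolding lift_vec_def by (rule theI')
  then show "lift_vec E (q, k) a b \<in> tangent (dual_total E) (q, k)"
    "f \<in> Cinf (base E) \<Longrightarrow> lift_vec E (q, k) a b (f \<circ> fst) = a f"
    "\<gamma> \<in> sections E \<Longrightarrow> lift_vec E (q, k) a b (hat \<gamma>) = b \<gamma>" by auto
qed

section \<open>Horizontal lifts, vertical lifts and the dual connection\<close>

lemma conn_at_eq:
  assumes D: "connection E \<rho> D" and q: "q \<in> pts (base E)" and s: "\<sigma> \<in> sections E" "\<gamma> \<in> sections E"
  shows "conn_at E D q (\<sigma> q) \<gamma> = D \<sigma> \<gamma> q"
  unfolding conn_at_def
proof (rule the_equality)
  have "D \<sigma>' \<gamma> q = D \<sigma> \<gamma> q" if "\<sigma>' \<in> sections E" "\<sigma>' q = \<sigma> q" for \<sigma>'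
    by (rule tensorial_at[OF E q, of "\<lambda>\<sigma>. D \<sigma> \<gamma> q"])
      (use that s connectionD[OF D] in \<open>simp_all add: fmult_apply\<close>)
  then show "\<forall>\<sigma>'\<in>sections E. \<sigma>' q = \<sigma> q \<longrightarrow> D \<sigma>' \<gamma> q = D \<sigma> \<gamma> q" by blast
  fix w assume "\<forall>\<sigma>'\<in>sections E. \<sigma>' q = \<sigma> q \<longrightarrow> D \<sigma>' \<gamma> q = w"
  then show "w = D \<sigma> \<gamma> q" using s by blast
qed

lemma conn_at_linear:
  assumes D: "connection E \<rho> D" and q: "q \<in> pts (base E)" and s: "\<gamma> \<in> sections E"
    and e: "e \<in> fibre E q" "e' \<in> fibre E q"
  shows "conn_at E D q (e + e') \<gamma> = conn_at E D q e \<gamma> + conn_at E D q e' \<gamma>"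
    "conn_at E D q (c *\<^sub>R e) \<gamma> = c *\<^sub>R conn_at E D q e \<gamma>" "conn_at E D q e \<gamma> \<in> fibre E q"
proof -
  obtain \<sigma> where \<sigma>: "\<sigma> \<in> sections E" "\<sigma> q = e" by (rule section_through[OF E q e(1)])
  obtain \<sigma>' where \<sigma>': "\<sigma>' \<in> sections E" "\<sigma>' q = e'" by (rule section_through[OF E q e(2)])
  note C = conn_at_eq[OF D q]
  show "conn_at E D q (e + e') \<gamma> = conn_at E D q e \<gamma> + conn_at E D q e' \<gamma>"
    using C[OF sections_add[OF lb \<sigma>(1) \<sigma>'(1)] s] C[OF \<sigma>(1) s] C[OF \<sigma>'(1) s] connectionD(2)[OF D \<sigma>(1) s \<sigma>'(1)]
    by (simp add: \<sigma>(2) \<sigma>'(2))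
  have "conn_at E D q (((\<lambda>_. c) \<star> \<sigma>) q) \<gamma> = D ((\<lambda>_. c) \<star> \<sigma>) \<gamma> q"
    by (rule C[OF sections_fmult[OF lb Cinf_const[OF pM] \<sigma>(1)] s])
  also have "\<dots> = c *\<^sub>R D \<sigma> \<gamma> q"
    by (simp add: connectionD(4)[OF D \<sigma>(1) s Cinf_const[OF pM]] fmult_apply)
  finally show "conn_at E D q (c *\<^sub>R e) \<gamma> = c *\<^sub>R conn_at E D q e \<gamma>"
    using C[OF \<sigma>(1) s] by (simp add: fmult_apply \<sigma>(2))
  show "conn_at E D q e \<gamma> \<in> fibre E q"
    using C[OF \<sigma>(1) s] sections_fibre[OF connectionD(1)[OF D \<sigma>(1) s] q] by (simp add: \<sigma>(2))
qed

text \<open>The Leibniz rule of \<open>D\<close> in its second argument, paired with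
  \<open>k\<close>, is the compatibility condition of \<open>lift_vec_props\<close>; the anchor
  supplies the action on basic functions.\<close>

lemma hlift_props:
  assumes r: "anchor_map E \<rho>" and D: "connection E \<rho> D"
    and q: "q \<in> pts (base E)" and k: "k \<in> fibre (dual_bundle E) q" and e: "e \<in> fibre E q"
  shows "hlift E \<rho> D (q, k) e \<in> tangent (dual_total E) (q, k)"
    "f \<in> Cinf (base E) \<Longrightarrow> hlift E \<rho> D (q, k) e (f \<circ> fst) = \<rho> q e f"
    "\<gamma> \<in> sections E \<Longrightarrow> hlift E \<rho> D (q, k) e (hat \<gamma>) = k (conn_at E D q e \<gamma>)"
proof -
  obtain \<sigma> where s: "\<sigma> \<in> sections E" "\<sigma> q = e" by (rule section_through[OF E q e])
  note lk = linear_onD[OF dual_fibre_linear[OF k]]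
  have c: "conn_at E D q e \<gamma> = D \<sigma> \<gamma> q" if "\<gamma> \<in> sections E" for \<gamma>
    using conn_at_eq[OF D q s(1) that] s(2) by simp
  have f: "D \<sigma> \<gamma> q \<in> fibre E q" if "\<gamma> \<in> sections E" for \<gamma>
    by (rule sections_fibre[OF connectionD(1)[OF D s(1) that] q])
  have a: "k (conn_at E D q e (\<gamma> + \<gamma>')) = k (conn_at E D q e \<gamma>) + k (conn_at E D q e \<gamma>')"
    if "\<gamma> \<in> sections E" "\<gamma>' \<in> sections E" for \<gamma> \<gamma>'
    using that by (simp add: c sections_add[OF lb] connectionD(3)[OF D _ s(1)] lk f)
  have m: "k (conn_at E D q e (f \<star> \<gamma>)) = f q * k (conn_at E D q e \<gamma>) + \<rho> q e f * k (\<gamma> q)"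
    if "f \<in> Cinf (base E)" "\<gamma> \<in> sections E" for f \<gamma>
  proof -
    have fq: "\<gamma> q \<in> fibre E q" "D \<sigma> \<gamma> q \<in> fibre E q" using f sections_fibre q that by auto
    note sc = subspace_scale[OF linear_bundleD(2)[OF lb q]]
    have "conn_at E D q e (f \<star> \<gamma>) = \<rho> q e f *\<^sub>R \<gamma> q + f q *\<^sub>R D \<sigma> \<gamma> q"
      using that by (simp add: c sections_fmult[OF lb] connectionD(5)[OF D s(1)] fmult_apply act_def s(2))
    then show ?thesis using that fq by (simp add: lk sc c)
  qed
  note p = lift_vec_props[OF q k anchor_mapD(2)[OF r q e], of "\<lambda>\<gamma>. k (conn_at E D q e \<gamma>)", OF a m]
  show "hlift E \<rho> D (q, k) e \<in> tangent (dual_total E) (q, k)"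
    "f \<in> Cinf (base E) \<Longrightarrow> hlift E \<rho> D (q, k) e (f \<circ> fst) = \<rho> q e f"
    "\<gamma> \<in> sections E \<Longrightarrow> hlift E \<rho> D (q, k) e (hat \<gamma>) = k (conn_at E D q e \<gamma>)"
    unfolding hlift_def using p by simp_all
qed

lemma hlift_zero:
  assumes r: "anchor_map E \<rho>" and D: "connection E \<rho> D"
    and q: "q \<in> pts (base E)" and k: "k \<in> fibre (dual_bundle E) q"
  shows "hlift E \<rho> D (q, k) 0 = 0"
proof -
  have e: "0 \<in> fibre E q" by (rule subspace_0[OF linear_bundleD(2)[OF lb q]])
  note h = hlift_props[OF r D q k e]
  have rho: "\<rho> q 0 = 0" by (rule linear_on_zero[OF anchor_mapD(1)[OF r q] e])
  have "conn_at E D q 0 \<gamma> = 0" if "\<gamma> \<in> sections E" for \<gamma>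
    using conn_at_linear(2)[OF D q that e e, of 0] by simp
  then show ?thesis
    by (intro dual_tangent_eqI[of "(q, k)"])
      (use q k h in \<open>simp_all add: rho subspace_0[OF subspace_tangent] dual_fibre_zero[OF k q] del: dual_bundle_simps(2)\<close>)
qed

lemma zero_tangent: "(0::'c tvec) \<in> tangent M p"
  by (rule subspace_0[OF subspace_tangent])

lemma vlift_props:
  assumes q: "q \<in> pts (base E)" and k: "k \<in> fibre (dual_bundle E) q" and \<nu>: "\<nu> q \<in> fibre (dual_bundle E) q"
  shows "vlift E \<nu> (q, k) \<in> tangent (dual_total E) (q, k)"
    "f \<in> Cinf (base E) \<Longrightarrow> vlift E \<nu> (q, k) (f \<circ> fst) = 0"
    "\<gamma> \<in> sections E \<Longrightarrow> vlift E \<nu> (q, k) (hat \<gamma>) = \<nu> q (\<gamma> q)"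
proof -
  note lk = linear_onD[OF dual_fibre_linear[OF \<nu>]]
  have x: "(q, k) \<in> pts (dual_total E)" using q k by simp
  note p = lift_vec_props[OF q k zero_tangent, of "\<lambda>\<gamma>. (pairing \<nu> \<gamma> \<circ> fst) (q, k)"]
  have a: "(pairing \<nu> (\<gamma> + \<gamma>') \<circ> fst) (q, k) = (pairing \<nu> \<gamma> \<circ> fst) (q, k) + (pairing \<nu> \<gamma>' \<circ> fst) (q, k)"
    if "\<gamma> \<in> sections E" "\<gamma>' \<in> sections E" for \<gamma> \<gamma>'
    using that by (simp add: pairing_def sections_fibre[OF _ q] lk)
  have m: "(pairing \<nu> (f \<star> \<gamma>) \<circ> fst) (q, k) = f q * (pairing \<nu> \<gamma> \<circ> fst) (q, k) + 0 f * k (\<gamma> q)"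
    if "f \<in> Cinf (base E)" "\<gamma> \<in> sections E" for f :: "'a \<Rightarrow> real" and \<gamma>
    using that by (simp add: pairing_def sections_fibre[OF _ q] lk fmult_apply)
  have v: "vlift E \<nu> (q, k) = lift_vec E (q, k) 0 (\<lambda>\<gamma>. (pairing \<nu> \<gamma> \<circ> fst) (q, k))"
    using x by (simp add: vlift_def zero_fun_def)
  show "vlift E \<nu> (q, k) \<in> tangent (dual_total E) (q, k)"
    "f \<in> Cinf (base E) \<Longrightarrow> vlift E \<nu> (q, k) (f \<circ> fst) = 0"
    "\<gamma> \<in> sections E \<Longrightarrow> vlift E \<nu> (q, k) (hat \<gamma>) = \<nu> q (\<gamma> q)"
    unfolding v using p[OF a m] by (simp_all add: pairing_def)
qed

lemma vlift_tensor_hat: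
  assumes q: "q \<in> pts (base E)" and k: "k \<in> fibre (dual_bundle E) q"
    and S: "\<And>\<gamma>. \<gamma> \<in> sections E \<Longrightarrow> S \<gamma> \<in> sections E"
      "\<And>\<gamma> \<gamma>'. \<gamma> \<in> sections E \<Longrightarrow> \<gamma>' \<in> sections E \<Longrightarrow> S (\<gamma> + \<gamma>') = S \<gamma> + S \<gamma>'"
      "\<And>f \<gamma>. f \<in> Cinf (base E) \<Longrightarrow> \<gamma> \<in> sections E \<Longrightarrow> S (f \<star> \<gamma>) = f \<star> S \<gamma>"
    and g: "\<gamma> \<in> sections E"
  shows "vlift_tensor E S (q, k) (hat \<gamma>) = k (S \<gamma> q)"
proof -
  note lk = linear_onD[OF dual_fibre_linear[OF k]]
  have x: "(q, k) \<in> pts (dual_total E)" using q k by simp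
  note p = lift_vec_props(3)[OF q k zero_tangent, of "\<lambda>\<gamma>. hat (S \<gamma>) (q, k)"]
  have a: "hat (S (\<gamma> + \<gamma>')) (q, k) = hat (S \<gamma>) (q, k) + hat (S \<gamma>') (q, k)"
    if "\<gamma> \<in> sections E" "\<gamma>' \<in> sections E" for \<gamma> \<gamma>'
    using that by (simp add: hat_def sections_fibre[OF S(1) q] lk S)
  have m: "hat (S (f \<star> \<gamma>)) (q, k) = f q * hat (S \<gamma>) (q, k) + 0 f * k (\<gamma> q)"
    if "f \<in> Cinf (base E)" "\<gamma> \<in> sections E" for f :: "'a \<Rightarrow> real" and \<gamma>
    using that by (simp add: hat_def sections_fibre[OF S(1) q] lk fmult_apply S)
  have v: "vlift_tensor E S (q, k) = lift_vec E (q, k) 0 (\<lambda>\<gamma>. hat (S \<gamma>) (q, k))"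
    using x by (simp add: vlift_tensor_def zero_fun_def)
  show ?thesis unfolding v using p[OF a m g] by (simp add: hat_def)
qed

text \<open>The derivative of a factor \<open>f\<close> appears in both terms of the defining
  formula and cancels, so the formula is tensorial in \<gamma> and comes from a covector at
  \<open>q\<close>. That covector is unique because every fibre vector lies on a section.\<close>

lemma dual_conn_props:
  assumes r: "anchor_map E \<rho>" and D: "connection E \<rho> D" and q: "q \<in> pts (base E)"
    and s: "\<sigma> \<in> sections E" and \<kappa>: "\<kappa> \<in> sections (dual_bundle E)"
  shows "dual_conn E \<rho> D \<sigma> \<kappa> q \<in> fibre (dual_bundle E) q"
    "\<gamma> \<in> sections E \<Longrightarrow> dual_conn E \<rho> D \<sigma> \<kappa> q (\<gamma> q) = act \<rho> \<sigma> (pairing \<kappa> \<gamma>) q - pairing \<kappa> (D \<sigma> \<gamma>) q"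
proof -
  define L where "L \<gamma> = act \<rho> \<sigma> (pairing \<kappa> \<gamma>) q - pairing \<kappa> (D \<sigma> \<gamma>) q" for \<gamma>
  have v: "\<rho> q (\<sigma> q) \<in> tangent (base E) q" by (rule anchor_mapD(2)[OF r q sections_fibre[OF s q]])
  have \<kappa>f: "\<kappa> p \<in> fibre (dual_bundle E) p" if "p \<in> pts (base E)" for p
    using sections_fibre[OF \<kappa>] that by simp
  have lk1: "\<kappa> p (x + y) = \<kappa> p x + \<kappa> p y"
    if "p \<in> pts (base E)" "x \<in> fibre E p" "y \<in> fibre E p" for p x y
    using linear_onD(1)[OF dual_fibre_linear[OF \<kappa>f[OF that(1)]]] that by simp
  have lk2: "\<kappa> p (c *\<^sub>R x) = c * \<kappa> p x"
    if "p \<in> pts (base E)" "x \<in> fibre E p" for p x c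
    using linear_onD(2)[OF dual_fibre_linear[OF \<kappa>f[OF that(1)]]] that by simp
  note lk = lk1 lk2
  note sf = sections_fibre note pC = pairing_Cinf[OF \<kappa>]
  have La: "L (\<gamma> + \<gamma>') = L \<gamma> + L \<gamma>'" if t: "\<gamma> \<in> sections E" "\<gamma>' \<in> sections E" for \<gamma> \<gamma>'
  proof -
    have "act \<rho> \<sigma> (pairing \<kappa> (\<gamma> + \<gamma>')) q = \<rho> q (\<sigma> q) (\<lambda>p. pairing \<kappa> \<gamma> p + pairing \<kappa> \<gamma>' p)"
      unfolding act_def by (rule tangent_eq[OF pM v q pC[OF sections_add[OF lb t]]])
        (use t in \<open>simp add: pairing_def sections_fibre lk\<close>)
    also have "\<dots> = act \<rho> \<sigma> (pairing \<kappa> \<gamma>) q + act \<rho> \<sigma> (pairing \<kappa> \<gamma>') q"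
      unfolding act_def by (rule tangent_add[OF v pC[OF t(1)] pC[OF t(2)]])
    finally show ?thesis
      using sf[OF connectionD(1)[OF D s t(1)] q] sf[OF connectionD(1)[OF D s t(2)] q]
      by (simp add: L_def connectionD(3)[OF D t(1) s t(2)] pairing_def lk q)
  qed
  have Lm: "L (f \<star> \<gamma>) = f q *\<^sub>R L \<gamma>" if f: "f \<in> Cinf (base E)" and t: "\<gamma> \<in> sections E" for f \<gamma>
  proof -
    have "act \<rho> \<sigma> (pairing \<kappa> (f \<star> \<gamma>)) q = \<rho> q (\<sigma> q) (\<lambda>p. f p * pairing \<kappa> \<gamma> p)"
      unfolding act_def by (rule tangent_eq[OF pM v q pC[OF sections_fmult[OF lb f t]]])
        (use t in \<open>simp add: pairing_def sections_fibre lk fmult_apply\<close>)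
    also have "\<dots> = f q * act \<rho> \<sigma> (pairing \<kappa> \<gamma>) q + pairing \<kappa> \<gamma> q * act \<rho> \<sigma> f q"
      unfolding act_def by (rule tangent_mult[OF v f pC[OF t]])
    finally have 1: "act \<rho> \<sigma> (pairing \<kappa> (f \<star> \<gamma>)) q = f q * act \<rho> \<sigma> (pairing \<kappa> \<gamma>) q + pairing \<kappa> \<gamma> q * act \<rho> \<sigma> f q" .
    note fq = sf[OF t q] sf[OF connectionD(1)[OF D s t] q]
    note sc = subspace_scale[OF linear_bundleD(2)[OF lb q]]
    have "pairing \<kappa> (D \<sigma> (f \<star> \<gamma>)) q = act \<rho> \<sigma> f q * pairing \<kappa> \<gamma> q + f q * pairing \<kappa> (D \<sigma> \<gamma>) q"
      using fq by (simp add: connectionD(5)[OF D s t f] pairing_def fmult_apply lk q sc)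
    then show ?thesis using 1 by (simp add: L_def algebra_simps)
  qed
  have Leq: "L \<gamma> = L \<gamma>'" if "\<gamma> \<in> sections E" "\<gamma>' \<in> sections E" "\<gamma> q = \<gamma>' q" for \<gamma> \<gamma>'
    by (rule tensorial_at[OF E q La Lm that])
  \<comment> \<open>Some section through \<open>e\<close> is chosen; by \<open>Leq\<close> the value
    of \<open>L\<close> does not depend on the choice.\<close>
  define k where "k e = (if e \<in> fibre E q then L (SOME \<gamma>. \<gamma> \<in> sections E \<and> \<gamma> q = e) else 0)" for e
  have k: "k (\<gamma> q) = L \<gamma>" if "\<gamma> \<in> sections E" for \<gamma>
  proof -
    have "\<exists>\<gamma>'. \<gamma>' \<in> sections E \<and> \<gamma>' q = \<gamma> q" using that by blast
    from someI_ex[OF this]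
    have "(SOME \<gamma>'. \<gamma>' \<in> sections E \<and> \<gamma>' q = \<gamma> q) \<in> sections E \<and> (SOME \<gamma>'. \<gamma>' \<in> sections E \<and> \<gamma>' q = \<gamma> q) q = \<gamma> q" .
    then have "L (SOME \<gamma>'. \<gamma>' \<in> sections E \<and> \<gamma>' q = \<gamma> q) = L \<gamma>" using that by (intro Leq) auto
    then show ?thesis using sf[OF that q] by (simp only: k_def if_True)
  qed
  have "linear_on (fibre E q) k"
    unfolding linear_on_def
  proof (intro conjI ballI allI)
    fix e e' c assume e: "e \<in> fibre E q"
    obtain \<gamma> where g: "\<gamma> \<in> sections E" "\<gamma> q = e" by (rule section_through[OF E q e])
    have "k (((\<lambda>_. c) \<star> \<gamma>) q) = c * k (\<gamma> q)"
      using k[OF sections_fmult[OF lb Cinf_const[OF pM] g(1)]] Lm[OF Cinf_const[OF pM] g(1)] k[OF g(1)] by simp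
    then show "k (c *\<^sub>R e) = c *\<^sub>R k e" by (simp add: fmult_apply g(2))
    assume e': "e' \<in> fibre E q"
    obtain \<gamma>' where g': "\<gamma>' \<in> sections E" "\<gamma>' q = e'" by (rule section_through[OF E q e'])
    show "k (e + e') = k e + k e'"
      using k[OF sections_add[OF lb g(1) g'(1)]] La[OF g(1) g'(1)] k[OF g(1)] k[OF g'(1)] by (simp add: g(2) g'(2))
  qed
  then have kf: "k \<in> fibre (dual_bundle E) q" by (simp add: k_def)
  let ?P = "\<lambda>k. k \<in> fibre (dual_bundle E) q \<and>
    (\<forall>\<gamma>\<in>sections E. k (\<gamma> q) = act \<rho> \<sigma> (pairing \<kappa> \<gamma>) q - pairing \<kappa> (D \<sigma> \<gamma>) q)"
  have "\<exists>!k. ?P k"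
  proof (rule ex1I[of _ k])
    show "?P k" using kf k by (simp add: L_def)
    fix k' assume k': "?P k'"
    show "k' = k"
    proof
      fix e show "k' e = k e"
      proof (cases "e \<in> fibre E q")
        case True
        then obtain \<gamma> where "\<gamma> \<in> sections E" "\<gamma> q = e" by (rule section_through[OF E q])
        then show ?thesis using k' k by (auto simp: L_def)
      next
        case False
        then show ?thesis using k' by (simp add: k_def)
      qed
    qed
  qed
  from theI'[OF this] have "?P (dual_conn E \<rho> D \<sigma> \<kappa> q)"
    unfolding dual_conn_def if_P[OF q] .
  then show "dual_conn E \<rho> D \<sigma> \<kappa> q \<in> fibre (dual_bundle E) q"
    "\<gamma> \<in> sections E \<Longrightarrow> dual_conn E \<rho> D \<sigma> \<kappa> q (\<gamma> q) = act \<rho> \<sigma> (pairing \<kappa> \<gamma>) q - pairing \<kappa> (D \<sigma> \<gamma>) q"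
    by blast+
qed

end

section \<open>The left tangent bundle\<close>

lemma left_tangent_base [simp]: "base (left_tangent E \<rho>l) = dual_total E"
  by (simp add: left_tangent_def)

lemma left_tangent_fibre:
  "fibre (left_tangent E \<rho>l) (q, k) = {(e, X). e \<in> fibre E q \<and> X \<in> tangent (dual_total E) (q, k) \<and>
     \<rho>l q e = tangent_map (dual_total E) (base E) fst X}"
  by (simp add: left_tangent_def)

definition left_triv ::
    "('a, 'm::coordinate_space, 'v::real_vector, 'f::coordinate_space) vbundle \<Rightarrow> 'a set \<Rightarrow> ('a \<Rightarrow> 'm) \<Rightarrow>
     'a set \<Rightarrow> ('a \<Rightarrow> 'v \<Rightarrow> 'f) \<Rightarrow> 'a \<times> ('v \<Rightarrow> real) \<Rightarrow> ('a, 'v) lfib \<Rightarrow> 'f \<times> 'f" where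
  "left_triv E U \<phi> V \<Phi> = (\<lambda>(q, k) (e, X). (\<Phi> q e,
     snd (inv (coord_vec (dual_total E) (Sigma (U \<inter> V) (fibre (dual_bundle E))) (total_chart \<phi> (dual_triv E \<Phi>)) (q, k)) X)))"

lemma left_tangent_trivsI:
  "(U, \<phi>) \<in> atlas (base E) \<Longrightarrow> (V, \<Phi>) \<in> trivs E \<Longrightarrow>
   (Sigma (U \<inter> V) (fibre (dual_bundle E)), left_triv E U \<phi> V \<Phi>) \<in> trivs (left_tangent E \<rho>l)"
  unfolding left_tangent_def left_triv_def by fastforce

lemma left_tangent_trivsE:
  assumes "(C, T) \<in> trivs (left_tangent E \<rho>l)"
  obtains U \<phi> V \<Phi> where "(U, \<phi>) \<in> atlas (base E)" "(V, \<Phi>) \<in> trivs E"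
    "C = Sigma (U \<inter> V) (fibre (dual_bundle E))" "T = left_triv E U \<phi> V \<Phi>"
  using assms unfolding left_tangent_def left_triv_def by auto

lemma tangent_map_simps:
  "tangent_map M N F (v + w) = tangent_map M N F v + tangent_map M N F w"
  "tangent_map M N F (c *\<^sub>R v) = c *\<^sub>R tangent_map M N F v"
  by (simp_all add: tangent_map_def fun_eq_iff scaleR_fun_def)

lemma dual_pointE:
  assumes "x \<in> pts (dual_total E)"
  obtains q k where "x = (q, k)" "q \<in> pts (base E)" "k \<in> fibre (dual_bundle E) q"
  using assms by (cases x) simp

locale lifted_bundle =
  fixes E :: "('a, 'm::coordinate_space, 'v::real_vector, 'f::coordinate_space) vbundle"
    and \<rho>l :: "('a, 'v) anchor"
  assumes E: "vector_bundle E" and rl: "anchor_map E \<rho>l"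
begin

abbreviation "TE \<equiv> left_tangent E \<rho>l"
abbreviation "DE \<equiv> dual_total E"
abbreviation "BE \<equiv> dual_bundle E"

lemmas lb = vector_bundle_linear[OF E]
lemmas pM = linear_bundleD(1)[OF lb]
lemmas dE = dual_vector_bundle[OF E]
lemmas dlb = vector_bundle_linear[OF dE]
lemmas pN = total_space_premanifold[OF dE]
lemmas cbN = total_space_convex_bumps[OF dE]

lemma base_zero: "q \<in> pts (base E) \<Longrightarrow> 0 \<in> fibre E q"
  by (rule subspace_0[OF linear_bundleD(2)[OF lb]])

lemma anchor_zero: "q \<in> pts (base E) \<Longrightarrow> \<rho>l q 0 = 0"
  by (rule linear_on_zero[OF anchor_mapD(1)[OF rl] base_zero])

lemma left_fibreI:
  assumes "q \<in> pts (base E)" "e \<in> fibre E q" "X \<in> tangent DE (q, k)"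
    "\<And>f. f \<in> Cinf (base E) \<Longrightarrow> X (f \<circ> fst) = \<rho>l q e f"
  shows "(e, X) \<in> fibre TE (q, k)"
proof -
  have "\<rho>l q e = tangent_map DE (base E) fst X"
    using assms(4) tangent_not_Cinf[OF anchor_mapD(2)[OF rl assms(1,2)]] by (auto simp: tangent_map_def fun_eq_iff)
  then show ?thesis using assms by (simp add: left_tangent_fibre)
qed

lemma left_fibreD:
  assumes "p \<in> fibre TE (q, k)"
  shows "fst p \<in> fibre E q" "snd p \<in> tangent DE (q, k)"
    "f \<in> Cinf (base E) \<Longrightarrow> snd p (f \<circ> fst) = \<rho>l q (fst p) f"
proof -
  have "fst p \<in> fibre E q \<and> snd p \<in> tangent DE (q, k) \<and> \<rho>l q (fst p) = tangent_map DE (base E) fst (snd p)"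
    using assms by (auto simp: left_tangent_fibre)
  then show "fst p \<in> fibre E q" "snd p \<in> tangent DE (q, k)"
    "f \<in> Cinf (base E) \<Longrightarrow> snd p (f \<circ> fst) = \<rho>l q (fst p) f" by (auto simp: tangent_map_def)
qed

lemma left_linear: "linear_bundle TE"
  unfolding linear_bundle_def
proof (intro conjI ballI)
  show "premanifold (base TE)" using pN by simp
  fix x assume "x \<in> pts (base TE)"
  then obtain q k where x: "x = (q, k)" "q \<in> pts (base E)" by auto
  note s = linear_bundleD(2)[OF lb x(2)] and t = subspace_tangent[of DE "(q, k)"]
  note lr = linear_onD[OF anchor_mapD(1)[OF rl x(2)]]
  show "subspace (fibre TE x)"
    unfolding x(1) left_tangent_fibre subspace_def
    using s t lr anchor_zero[OF x(2)]
    by (auto simp: subspace_0 subspace_add subspace_scale tangent_map_simps zero_prod_def)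
      (simp add: tangent_map_def fun_eq_iff)
next
  fix T assume "T \<in> trivs TE"
  then obtain U \<phi> V \<Phi> where c: "(U, \<phi>) \<in> atlas (base E)" "(V, \<Phi>) \<in> trivs E"
    and T: "T = (Sigma (U \<inter> V) (fibre BE), left_triv E U \<phi> V \<Phi>)" by (metis left_tangent_trivsE surj_pair)
  have UV: "mopen (base BE) (U \<inter> V)"
    using mopen_Int[OF pM mopen_chart[OF pM c(1)] linear_bundleD(3)[OF lb c(2)]] by simp
  have lin: "linear_on (fibre TE x) (left_triv E U \<phi> V \<Phi> x)" if xC: "x \<in> Sigma (U \<inter> V) (fibre BE)" for x
  proof -
    obtain q k where x: "x = (q, k)" "q \<in> U" "q \<in> V" "k \<in> fibre BE q" using xC by blast
    note l1 = linear_onD[OF linear_bundleD(4)[OF lb c(2) x(3)]]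
    note l2 = linear_onD[OF linear_on_inv_coord_vec[OF cbN dual_chart_atlas[OF E c x(2-4)] dual_domain_mem[OF E c x(2-4)]]]
    have "left_triv E U \<phi> V \<Phi> x (p + p') = left_triv E U \<phi> V \<Phi> x p + left_triv E U \<phi> V \<Phi> x p'"
      if "p \<in> fibre TE x" "p' \<in> fibre TE x" for p p'
      using left_fibreD[OF that(1)[unfolded x(1)]] left_fibreD[OF that(2)[unfolded x(1)]]
      by (simp add: left_triv_def x(1) case_prod_beta' l1 l2 del: dual_bundle_simps)
    moreover have "left_triv E U \<phi> V \<Phi> x (r *\<^sub>R p) = r *\<^sub>R left_triv E U \<phi> V \<Phi> x p"
      if "p \<in> fibre TE x" for p r
      using left_fibreD[OF that(1)[unfolded x(1)]]
      by (simp add: left_triv_def x(1) case_prod_beta' l1 l2 del: dual_bundle_simps)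
    ultimately show ?thesis unfolding linear_on_def by blast
  qed
  show "case T of (V, \<Phi>) \<Rightarrow> mopen (base TE) V \<and> (\<forall>q\<in>V. linear_on (fibre TE q) (\<Phi> q))"
    unfolding T using mopen_Sigma[OF dE UV] lin by (simp del: dual_bundle_simps)
qed

lemma left_sections_smoothI:
  assumes c: "(U, \<phi>) \<in> atlas (base E)" "(V, \<Phi>) \<in> trivs E" and q: "q \<in> U" "q \<in> V" and k: "k \<in> fibre BE q"
    and "smooth_at DE (\<lambda>x. \<Phi> (fst x) (fst (X x))) (q, k)"
    and "smooth_at DE (\<lambda>x. snd (inv (coord_vec DE (Sigma (U \<inter> V) (fibre BE)) (total_chart \<phi> (dual_triv E \<Phi>)) x) (snd (X x)))) (q, k)"
  shows "smooth_at DE (\<lambda>x. left_triv E U \<phi> V \<Phi> x (X x)) (q, k)"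
proof -
  note d = dual_chart_atlas[OF E c q k] dual_domain_mem[OF E c q k]
  show ?thesis using smooth_near_Pair assms(6,7)
    unfolding smooth_at_chart[OF pN d]
    by (simp add: left_triv_def case_prod_beta' del: dual_bundle_simps)
qed

text \<open>The fibre component of the horizontal lift along a frame direction \<open>b\<close> is
  its value on the linear function of the frame section, namely
  \<open>hat (D \<sigma> (frame E V \<Phi> g b))\<close>. This holds throughout the neighbourhood
  \<open>N\<close> where \<open>g\<close> is 1, and there it is visibly smooth.\<close>

lemma hsec_section:
  assumes D: "connection E \<rho>l D" and s: "\<sigma> \<in> sections E"
  shows "hsec E \<rho>l D \<sigma> \<in> sections TE"
  unfolding sections_iff[OF left_linear]
proof (intro conjI ballI allI impI)
  fix x
  show "hsec E \<rho>l D \<sigma> x = 0" if "x \<notin> pts (base TE)"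
    using that by (simp add: hsec_def)
  show "hsec E \<rho>l D \<sigma> x \<in> fibre TE x" if x: "x \<in> pts (base TE)"
  proof -
    obtain q k where x: "x = (q, k)" "q \<in> pts (base E)" "k \<in> fibre BE q"
      by (rule dual_pointE[of x E]) (use x in simp_all)
    note h = hlift_props[OF E rl D x(2,3) sections_fibre[OF s x(2)]]
    have "hsec E \<rho>l D \<sigma> x = (\<sigma> q, hlift E \<rho>l D (q, k) (\<sigma> q))" using x by (simp add: hsec_def)
    then show ?thesis using left_fibreI[OF x(2) sections_fibre[OF s x(2)] h(1,2)] x(1) by simp
  qed
next
  fix C T x assume "(C, T) \<in> trivs TE" and xC: "x \<in> C"
  then obtain U \<phi> V \<Phi> where c: "(U, \<phi>) \<in> atlas (base E)" "(V, \<Phi>) \<in> trivs E"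
    and C: "C = Sigma (U \<inter> V) (fibre BE)" and T: "T = left_triv E U \<phi> V \<Phi>" by (metis left_tangent_trivsE)
  obtain q k where x: "x = (q, k)" "q \<in> U" "q \<in> V" "k \<in> fibre BE q" using xC C by blast
  note pt = dual_point_mem[OF E c x(2-4)]
  obtain W g where W: "W \<subseteq> U \<inter> V" "bump (base E) W q g" by (rule vector_bundle_bump[OF E c x(2,3)])
  have WV: "W \<subseteq> V" using W by blast
  obtain N where N: "mopen (base E) N" "q \<in> N" "N \<subseteq> W" "\<And>p. p \<in> N \<Longrightarrow> g p = 1" using W(2) unfolding bump_def by blast
  note fs = frame_section[OF E c(2) W(2) WV]
  note Ds = connectionD(1)[OF D s fs]
  have NS: "mopen DE (Sigma N (fibre BE))" "(q, k) \<in> Sigma N (fibre BE)"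
    using mopen_Sigma[OF dE] N(1,2) x(4) by simp_all
  have "smooth_at DE (((\<lambda>q. \<Phi> q (\<sigma> q)) \<circ> fst)) (q, k)"
    by (rule smooth_at_basic[OF dE]) (use pt x(4) sections_smooth[OF lb s c(2) x(3)] in simp_all)
  then have 1: "smooth_at DE (\<lambda>x. \<Phi> (fst x) (fst (hsec E \<rho>l D \<sigma> x))) (q, k)"
    by (rule smooth_at_cong[OF pN _ mopen_pts[OF pN] pt(2)]) (simp add: hsec_def)
  have "smooth_at DE (\<lambda>x. \<Sum>b\<in>onb. hat (D \<sigma> (frame E V \<Phi> g b)) x *\<^sub>R b) (q, k)"
    by (intro smooth_at_sum smooth_at_scaleR smooth_at_const pN pt(2) CinfD[OF pN hat_Cinf[OF E Ds]])
  then have 2: "smooth_at DE (\<lambda>x. snd (inv (coord_vec DE (Sigma (U \<inter> V) (fibre BE)) (total_chart \<phi> (dual_triv E \<Phi>)) x)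
      (snd (hsec E \<rho>l D \<sigma> x)))) (q, k)"
  proof (rule smooth_at_cong[OF pN _ NS])
    fix y assume "y \<in> Sigma N (fibre BE)"
    then obtain p j where y: "y = (p, j)" "p \<in> N" "j \<in> fibre BE p" by blast
    then have p: "p \<in> U" "p \<in> V" using N(3) W(1) by auto
    note pj = dual_point_mem[OF E c p y(3)]
    note h = hlift_props[OF E rl D pj(1) y(3) sections_fibre[OF s pj(1)]]
    have hs: "snd (hsec E \<rho>l D \<sigma> y) = hlift E \<rho>l D (p, j) (\<sigma> p)" using pj(2) y(1) by (simp add: hsec_def)
    show "(\<Sum>b\<in>onb. hat (D \<sigma> (frame E V \<Phi> g b)) y *\<^sub>R b) =
      snd (inv (coord_vec DE (Sigma (U \<inter> V) (fibre BE)) (total_chart \<phi> (dual_triv E \<Phi>)) y) (snd (hsec E \<rho>l D \<sigma> y)))"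
    proof (rule onb_eqI)
      fix b :: 'f assume b: "b \<in> onb"
      have "inner (snd (inv (coord_vec DE (Sigma (U \<inter> V) (fibre BE)) (total_chart \<phi> (dual_triv E \<Phi>)) y) (snd (hsec E \<rho>l D \<sigma> y)))) b =
        hlift E \<rho>l D (p, j) (\<sigma> p) (hat (frame E V \<Phi> g b))"
        unfolding hs unfolding y(1)
        by (rule tangent_component_hat[OF E c p y(3) W(2) WV N(1) y(2) N(4) h(1)])
      also have "\<dots> = j (D \<sigma> (frame E V \<Phi> g b) p)"
        by (simp only: h(3)[OF fs] conn_at_eq[OF E D pj(1) s fs])
      finally show "inner (\<Sum>b\<in>onb. hat (D \<sigma> (frame E V \<Phi> g b)) y *\<^sub>R b) b =
        inner (snd (inv (coord_vec DE (Sigma (U \<inter> V) (fibre BE)) (total_chart \<phi> (dual_triv E \<Phi>)) y) (snd (hsec E \<rho>l D \<sigma> y)))) b"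
        by (simp only: inner_sum_onb[OF b]) (simp add: hat_def y(1))
    qed
  qed
  show "smooth_at (base TE) (\<lambda>x. T x (hsec E \<rho>l D \<sigma> x)) x"
    using left_sections_smoothI[OF c x(2-4) 1 2] T x(1) by simp
qed

text \<open>Both vectors annihilate basic functions and take the value \<nu>(\<gamma>) on linear
  functions, so they coincide. Smoothness of vertical lifts is then smoothness of \<nu> in the dual
  trivialization.\<close>

lemma vlift_coord_vec:
  assumes c: "(U, \<phi>) \<in> atlas (base E)" "(V, \<Phi>) \<in> trivs E" and q: "q \<in> U" "q \<in> V" and k: "k \<in> fibre BE q"
    and \<nu>: "\<nu> q \<in> fibre BE q"
  shows "vlift E \<nu> (q, k) = coord_vec DE (Sigma (U \<inter> V) (fibre BE)) (total_chart \<phi> (dual_triv E \<Phi>)) (q, k)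
    (0, dual_triv E \<Phi> q (\<nu> q))" (is "_ = ?c _")
proof -
  note pt = dual_point_mem[OF E c q k]
  note v = vlift_props[where \<nu> = \<nu>, OF E pt(1) k \<nu>]
  show ?thesis
  proof (rule dual_tangent_eqI[OF E pt(2) v(1)])
    show "?c (0, dual_triv E \<Phi> q (\<nu> q)) \<in> tangent DE (q, k)"
      by (rule coord_vec_tangent[OF pN dual_chart_atlas[OF E c q k] dual_domain_mem[OF E c q k]])
    show "vlift E \<nu> (q, k) (f \<circ> fst) = ?c (0, dual_triv E \<Phi> q (\<nu> q)) (f \<circ> fst)" if f: "f \<in> Cinf (base E)" for f
    proof -
      have "coord_vec (base E) U \<phi> q 0 = 0" by (rule linear_0[OF linear_coord_vec[OF pM c(1) q(1)]])
      then show ?thesis by (simp only: v(2)[OF f] coord_vec_basic[OF E c q k f] fst_conv zero_fun_apply)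
    qed
    show "vlift E \<nu> (q, k) (hat \<gamma>) = ?c (0, dual_triv E \<Phi> q (\<nu> q)) (hat \<gamma>)" if s: "\<gamma> \<in> sections E" for \<gamma>
      using v(3)[OF s] coord_vec_hat_vertical[OF E c q k s, of "dual_triv E \<Phi> q (\<nu> q)"]
        dual_triv_eq(2)[OF E c(2) q(2) dual_fibre_linear[OF E \<nu>] sections_fibre[OF s pt(1)]] by (simp only:)
  qed
qed

lemma vsec_section:
  assumes s: "\<nu> \<in> sections BE"
  shows "vsec E \<nu> \<in> sections TE"
  unfolding sections_iff[OF left_linear]
proof (intro conjI ballI allI impI)
  have \<nu>f: "\<nu> p \<in> fibre BE p" if "p \<in> pts (base E)" for p
    using sections_fibre[OF s] that by simp
  fix x
  show "vsec E \<nu> x = 0" if "x \<notin> pts (base TE)"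
    using that by (simp add: vsec_def vlift_def zero_prod_def)
  show "vsec E \<nu> x \<in> fibre TE x" if x: "x \<in> pts (base TE)"
  proof -
    obtain q k where x: "x = (q, k)" "q \<in> pts (base E)" "k \<in> fibre BE q"
      by (rule dual_pointE[of x E]) (use x in simp_all)
    show ?thesis unfolding x(1) vsec_def
      by (rule left_fibreI[OF x(2) base_zero[OF x(2)]])
        (simp_all only: vlift_props[where \<nu> = \<nu>, OF E x(2,3) \<nu>f[OF x(2)]] anchor_zero[OF x(2)] zero_fun_apply)
  qed
  fix C T assume "(C, T) \<in> trivs TE" and xC: "x \<in> C"
  then obtain U \<phi> V \<Phi> where c: "(U, \<phi>) \<in> atlas (base E)" "(V, \<Phi>) \<in> trivs E"
    and C: "C = Sigma (U \<inter> V) (fibre BE)" and T: "T = left_triv E U \<phi> V \<Phi>" by (metis left_tangent_trivsE)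
  obtain q k where x: "x = (q, k)" "q \<in> U" "q \<in> V" "k \<in> fibre BE q" using xC C by blast
  note pt = dual_point_mem[OF E c x(2-4)]
  have op: "mopen DE (Sigma (U \<inter> V) (fibre BE))"
    by (rule mopen_chart[OF pN dual_chart_atlas[OF E c x(2-4)]])
  have 1: "smooth_at DE (\<lambda>x. \<Phi> (fst x) (fst (vsec E \<nu> x))) (q, k)"
  proof (rule smooth_at_cong[OF pN smooth_at_const[OF pN pt(2), of 0] op])
    show "(q, k) \<in> Sigma (U \<inter> V) (fibre BE)" by (rule dual_domain_mem[OF E c x(2-4)])
    fix y assume "y \<in> Sigma (U \<inter> V) (fibre BE)"
    then obtain p j where y: "y = (p, j)" "p \<in> U" "p \<in> V" "j \<in> fibre BE p" by blast
    show "0 = \<Phi> (fst y) (fst (vsec E \<nu> y))"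
      using linear_on_zero[OF linear_bundleD(4)[OF lb c(2) y(3)] base_zero[OF dual_point_mem(1)[OF E c y(2-4)]]]
      by (simp add: vsec_def y(1))
  qed
  have "smooth_at DE ((\<lambda>q. dual_triv E \<Phi> q (\<nu> q)) \<circ> fst) (q, k)"
    by (rule smooth_at_basic[OF dE])
      (use pt x(4) sections_smooth[OF dlb s dual_bundle_trivsI[OF c(2)] x(3)] in simp_all)
  then have 2: "smooth_at DE (\<lambda>x. snd (inv (coord_vec DE (Sigma (U \<inter> V) (fibre BE)) (total_chart \<phi> (dual_triv E \<Phi>)) x)
      (snd (vsec E \<nu> x)))) (q, k)"
  proof (rule smooth_at_cong[OF pN _ op dual_domain_mem[OF E c x(2-4)]])
    fix y assume "y \<in> Sigma (U \<inter> V) (fibre BE)"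
    then obtain p j where y: "y = (p, j)" "p \<in> U" "p \<in> V" "j \<in> fibre BE p" by blast
    show "((\<lambda>q. dual_triv E \<Phi> q (\<nu> q)) \<circ> fst) y =
      snd (inv (coord_vec DE (Sigma (U \<inter> V) (fibre BE)) (total_chart \<phi> (dual_triv E \<Phi>)) y) (snd (vsec E \<nu> y)))"
      unfolding vsec_def snd_conv y(1)
      unfolding vlift_coord_vec[where \<nu> = \<nu>, OF c y(2-4) \<nu>f[OF dual_point_mem(1)[OF E c y(2-4)]]]
      by (simp only: inv_coord_vec(1)[OF cbN dual_chart_atlas[OF E c y(2-4)] dual_domain_mem[OF E c y(2-4)]]) simp
  qed
  show "smooth_at (base TE) (\<lambda>x. T x (vsec E \<nu> x)) x"
    using left_sections_smoothI[OF c x(2-4) 1 2] T x(1) by simp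
qed

text \<open>The module over the smooth functions generated by the lifts. The inductive form turns
  claims about operations that are additive and homogeneous into claims about the two kinds of
  generators.\<close>

inductive_set lift_span :: "('a, 'v) sec_op \<Rightarrow> ('a \<times> ('v \<Rightarrow> real) \<Rightarrow> ('a, 'v) lfib) set" for D where
  zero: "0 \<in> lift_span D"
| hsec: "\<sigma> \<in> sections E \<Longrightarrow> hsec E \<rho>l D \<sigma> \<in> lift_span D"
| vsec: "\<nu> \<in> sections BE \<Longrightarrow> vsec E \<nu> \<in> lift_span D"
| add: "X \<in> lift_span D \<Longrightarrow> Y \<in> lift_span D \<Longrightarrow> X + Y \<in> lift_span D"
| mult: "f \<in> Cinf DE \<Longrightarrow> X \<in> lift_span D \<Longrightarrow> f \<star> X \<in> lift_span D"

lemma lift_span_sections: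
  assumes D: "connection E \<rho>l D" and X: "X \<in> lift_span D"
  shows "X \<in> sections TE"
  using X
proof induction
  case (mult f X)
  then show ?case by (intro sections_fmult[OF left_linear]) simp_all
qed (rule sections_zero[OF left_linear], erule hsec_section[OF D], erule vsec_section,
  erule (1) sections_add[OF left_linear, OF _ _])

lemma lift_span_sum: "(\<And>i. i \<in> A \<Longrightarrow> X i \<in> lift_span D) \<Longrightarrow> (\<Sum>i\<in>A. X i) \<in> lift_span D"
proof (induction A rule: infinite_finite_induct)
  case (insert a A)
  then show ?case by (subst sum.insert) (auto intro: lift_span.add)
qed (auto intro: lift_span.zero)

text \<open>Near any point the horizontal lifts of a frame of \<open>E\<close> and the vertical lifts of the dual frame
  form a frame; after multiplication with a bump function the expansion becomes global.\<close>

lemma local_lift_span: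
  assumes D: "connection E \<rho>l D" and X: "X \<in> sections TE" and x0: "x0 \<in> pts DE"
  obtains f N where "f \<in> Cinf DE" "mopen DE N" "x0 \<in> N" "\<And>x. x \<in> N \<Longrightarrow> f x = 1" "f \<star> X \<in> lift_span D"
proof -
  obtain q0 k0 where x: "x0 = (q0, k0)" "q0 \<in> pts (base E)" "k0 \<in> fibre BE q0" using x0 by auto
  obtain U \<phi> V \<Phi> where c: "(U, \<phi>) \<in> atlas (base E)" "(V, \<Phi>) \<in> trivs E" and q: "q0 \<in> U" "q0 \<in> V"
    by (rule vector_bundle_cover[OF E x(2)])
  obtain W g where W: "W \<subseteq> U \<inter> V" "bump (base E) W q0 g" by (rule vector_bundle_bump[OF E c q])
  have WV: "W \<subseteq> V" using W by blast
  define G :: "'a \<times> ('v \<Rightarrow> real) \<Rightarrow> real" where "G = g \<circ> fst"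
  let ?C = "Sigma (U \<inter> V) (fibre BE)" and ?W = "Sigma W (fibre BE)"
  let ?c = "coord_vec DE ?C (total_chart \<phi> (dual_triv E \<Phi>))"
  define T where "T = left_triv E U \<phi> V \<Phi>"
  have T: "(?C, T) \<in> trivs TE" unfolding T_def by (rule left_tangent_trivsI[OF c])
  have "bump (base BE) W q0 g" using W(2) by simp
  from bump_total_space[OF dE this x(3)] have G: "bump (base TE) ?W x0 G" by (simp add: G_def x(1))
  have WC: "?W \<subseteq> ?C" using W(1) by blast
  have GC: "G \<in> Cinf DE" using bump_Cinf[OF G] by simp
  define GG where "GG x = G x * G x" for x
  have GGC: "GG \<in> Cinf DE" unfolding GG_def by (intro Cinf_mult pN GC)
  have G0: "G x = 0" if "x \<in> pts DE" "x \<notin> ?W" for x using bump_zero[OF G] that by simp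
  note fs = frame_section[OF E c(2) W(2) WV]
  define df where "df = frame BE V (dual_triv E \<Phi>) g"
  have bD: "bump (base BE) W q0 g" using W(2) by simp
  have dfs: "df b \<in> sections BE" for b
    unfolding df_def by (rule frame_section[OF dE dual_bundle_trivsI[OF c(2)] bD WV])
  define a where "a b = frame_coeff T G X (b, 0)" for b :: 'f
  have aC: "a b \<in> Cinf DE" for b
    using frame_coeff_Cinf[OF left_linear T G WC X] unfolding a_def by simp
  define H where "H = (\<Sum>b\<in>onb. a b \<star> hsec E \<rho>l D (frame E V \<Phi> g b))"
  have Hs: "H \<in> lift_span D" unfolding H_def
    by (intro lift_span_sum lift_span.mult aC lift_span.hsec fs)
  note HS = lift_span_sections[OF D Hs]
  \<comment> \<open>The coefficient and the frame section each contribute one \<open>g\<close>, so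
    \<open>H\<close> has the same component in \<open>E\<close> as \<open>GG\<close> times
    \<open>X\<close>. What remains is vertical and can be expanded in vertical lifts of the dual
    frame.\<close>
  define Y where "Y = GG \<star> X - H"
  have GX: "GG \<star> X \<in> sections TE" using sections_fmult[OF left_linear _ X] GGC by simp
  have Y: "Y \<in> sections TE" unfolding Y_def
    by (rule sections_diff[OF left_linear GX HS])
  define b' where "b' b = frame_coeff T G Y (0, b)" for b :: 'f
  have b'C: "b' b \<in> Cinf DE" for b
    using frame_coeff_Cinf[OF left_linear T G WC Y] unfolding b'_def by simp
  have "GG \<star> Y = (\<Sum>b\<in>onb. b' b \<star> vsec E (df b))"
  proof (rule sections_eqI[where E = TE])
    show "GG \<star> Y \<in> sections TE" using sections_fmult[OF left_linear _ Y] GGC by simp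
    show "(\<Sum>b\<in>onb. b' b \<star> vsec E (df b)) \<in> sections TE"
      by (intro lift_span_sections[OF D] lift_span_sum lift_span.mult b'C lift_span.vsec dfs)
    fix y assume y: "y \<in> pts (base TE)"
    have R: "(\<Sum>b\<in>onb. b' b \<star> vsec E (df b)) y = (\<Sum>b\<in>onb. b' b y *\<^sub>R vsec E (df b) y)"
      by (simp only: sum_fun_apply fmult_apply)
    show "(GG \<star> Y) y = (\<Sum>b\<in>onb. b' b \<star> vsec E (df b)) y"
    proof (cases "y \<in> ?W")
      case False
      then have "G y = 0" using G0 y by simp
      then have "GG y = 0" "b' b y = 0" for b by (simp_all add: GG_def b'_def frame_coeff_def)
      then show ?thesis unfolding R by (simp add: fmult_apply)
    next
      case True
      then obtain p j where y': "y = (p, j)" "p \<in> W" "j \<in> fibre BE p" by blast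
      then have p: "p \<in> U" "p \<in> V" using W(1) by auto
      note pj = dual_point_mem[OF E c p y'(3)]
      note d = dual_chart_atlas[OF E c p y'(3)] dual_domain_mem[OF E c p y'(3)]
      have Xf: "X y \<in> fibre TE (p, j)" using sections_fibre[OF X y] y'(1) by simp
      have Yf: "Y y \<in> fibre TE (p, j)" using sections_fibre[OF Y y] y'(1) by simp
      have av: "a b y = g p * inner (\<Phi> p (fst (X y))) b" for b
        by (simp add: a_def frame_coeff_def T_def left_triv_def case_prod_beta' y'(1) G_def)
      have "fst (H y) = (\<Sum>b\<in>onb. a b y *\<^sub>R frame E V \<Phi> g b p)"
        using pj(2) unfolding H_def sum_fun_apply fmult_apply fst_sum
        by (simp add: hsec_def y'(1))
      also have "\<dots> = (\<Sum>b\<in>onb. (g p * g p) *\<^sub>R inner (\<Phi> p (fst (X y))) b *\<^sub>R inv_into (fibre E p) (\<Phi> p) b)"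
        using p by (simp add: av frame_def mult_ac)
      also have "\<dots> = (g p * g p) *\<^sub>R fst (X y)"
        unfolding scaleR_sum_right[symmetric] vector_bundle_inv_expansion[OF E c(2) p(2), symmetric]
          vector_bundle_triv(4)[OF E c(2) p(2) left_fibreD(1)[OF Xf]] ..
      finally have Y0: "fst (Y y) = 0"
        by (simp add: Y_def fmult_apply GG_def G_def y'(1))
      define w where "w = snd (inv (?c (p, j)) (snd (Y y)))"
      have "snd (Y y) (f \<circ> fst) = 0" if "f \<in> Cinf (base E)" for f
        using left_fibreD(3)[OF Yf that] Y0 anchor_zero[OF pj(1)] by simp
      then have Yw: "snd (Y y) = ?c (p, j) (0, w)"
        unfolding w_def by (intro vertical_coord_vec[OF E c p y'(3) left_fibreD(2)[OF Yf]])
      have bv: "b' b y = g p * inner w b" for b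
        by (simp add: b'_def frame_coeff_def T_def left_triv_def case_prod_beta' y'(1) G_def w_def del: dual_bundle_simps)
      have dfp: "df b p \<in> fibre BE p" for b
        using sections_fibre[OF dfs] pj(1) by simp
      have vs: "vsec E (df b) y = (0, ?c (p, j) (0, g p *\<^sub>R b))" for b
        unfolding vsec_def y'(1) vlift_coord_vec[where \<nu> = "df b", OF c p y'(3) dfp]
        using frame_triv[OF dE dual_bundle_trivsI[OF c(2)] p(2), of g b] by (simp only: df_def)
      note lc = linear_coord_vec[OF pN d]
      have "(\<Sum>b\<in>onb. b' b y *\<^sub>R vsec E (df b) y) = (0, \<Sum>b\<in>onb. b' b y *\<^sub>R ?c (p, j) (0, g p *\<^sub>R b))"
        by (simp add: vs prod_eq_iff fst_sum snd_sum del: dual_bundle_simps)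
      also have "(\<Sum>b\<in>onb. b' b y *\<^sub>R ?c (p, j) (0, g p *\<^sub>R b)) = ?c (p, j) (\<Sum>b\<in>onb. b' b y *\<^sub>R (0, g p *\<^sub>R b))"
        by (simp only: linear_sum[OF lc] linear_scale[OF lc])
      also have "(\<Sum>b\<in>onb. b' b y *\<^sub>R (0::'m, g p *\<^sub>R b)) = (g p * g p) *\<^sub>R (0, \<Sum>b\<in>onb. inner w b *\<^sub>R b)"
        by (simp add: prod_eq_iff fst_sum snd_sum bv scaleR_sum_right mult_ac)
      also have "?c (p, j) \<dots> = (g p * g p) *\<^sub>R snd (Y y)"
        by (simp only: linear_scale[OF lc] onb_expansion Yw)
      also have "(0, (g p * g p) *\<^sub>R snd (Y y)) = (GG \<star> Y) y"
        by (simp add: fmult_apply GG_def G_def y'(1) prod_eq_iff Y0[unfolded y'(1)])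
      finally show ?thesis unfolding R by (rule sym)
    qed
  qed
  then have Ys: "GG \<star> Y \<in> lift_span D"
    using lift_span_sum[of onb "\<lambda>b. b' b \<star> vsec E (df b)"] lift_span.mult[OF b'C lift_span.vsec[OF dfs]] by simp
  \<comment> \<open>The vertical part was expanded only after another cutoff by \<open>GG\<close>,
    so the total factor is the fourth power of \<open>G\<close>, still 1 near
    \<open>x0\<close>.\<close>
  have "(\<lambda>x. GG x * GG x) \<star> X = GG \<star> Y + GG \<star> H"
    by (simp add: Y_def fun_eq_iff fmult_apply scaleR_diff_right)
  then have res: "(\<lambda>x. GG x * GG x) \<star> X \<in> lift_span D"
    using lift_span.add[OF Ys lift_span.mult[OF GGC Hs]] by simp
  obtain N where N: "mopen DE N" "x0 \<in> N" "\<And>x. x \<in> N \<Longrightarrow> G x = 1" using G unfolding bump_def by auto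
  show thesis
    by (rule that[OF _ N(1,2) _ res]) (auto simp: GG_def N(3) intro!: Cinf_mult pN GC)
qed

end

section \<open>Differentials on algebroids\<close>

lemma tangent_zero_fun:
  assumes "premanifold M" "v \<in> tangent M p" "p \<in> pts M" "f \<in> Cinf M" "\<And>x. x \<in> pts M \<Longrightarrow> f x = 0"
  shows "v f = 0"
  using tangent_eq[OF assms(1-4), of "\<lambda>_. 0"] assms(5) tangent_const[OF assms(1,2)] by simp

text \<open>Used twice: for \<open>E\<close> itself and for its left tangent bundle.\<close>

locale linear_algebroid =
  fixes F :: "('a, 'm::coordinate_space, 'v::real_vector, 'f::coordinate_space) vbundle"
    and B :: "('a, 'v) sec_op" and \<rho>l \<rho>r :: "('a, 'v) anchor"
  assumes F: "linear_bundle F" and alg: "algebroid F B \<rho>l \<rho>r"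
begin

lemma base_premanifold: "premanifold (base F)"
  by (rule linear_bundleD(1)[OF F])

lemma anchors: "anchor_map F \<rho>l" "anchor_map F \<rho>r"
  by (rule bundle_morphism_anchor_map[OF conjunct1[OF conjunct2[OF alg[unfolded algebroid_def]]]],
    rule bundle_morphism_anchor_map[OF conjunct1[OF conjunct2[OF conjunct2[OF alg[unfolded algebroid_def]]]]])

lemma act_tangent:
  assumes "X \<in> sections F" "x \<in> pts (base F)"
  shows "\<rho>l x (X x) \<in> tangent (base F) x" "\<rho>r x (X x) \<in> tangent (base F) x"
  by (rule anchor_mapD(2)[OF anchors(1) assms(2) sections_fibre[OF assms]],
    rule anchor_mapD(2)[OF anchors(2) assms(2) sections_fibre[OF assms]])

lemma act_section:
  assumes r: "anchor_map F \<rho>" and x: "x \<in> pts (base F)" and X: "X \<in> sections F" "X' \<in> sections F"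
  shows "act \<rho> (X + X') f x = act \<rho> X f x + act \<rho> X' f x" "act \<rho> (g \<star> X) f x = g x * act \<rho> X f x"
  using linear_onD[OF anchor_mapD(1)[OF r x]] sections_fibre[OF X(1) x] sections_fibre[OF X(2) x]
  by (simp_all add: act_def fmult_apply scaleR_fun_def)

lemma act_derivation:
  assumes r: "anchor_map F \<rho>" and x: "x \<in> pts (base F)" and X: "X \<in> sections F"
    and f: "f \<in> Cinf (base F)" "g \<in> Cinf (base F)"
  shows "h \<in> Cinf (base F) \<Longrightarrow> (\<And>y. y \<in> pts (base F) \<Longrightarrow> h y = f y + g y) \<Longrightarrow>
      act \<rho> X h x = act \<rho> X f x + act \<rho> X g x"
    "h \<in> Cinf (base F) \<Longrightarrow> (\<And>y. y \<in> pts (base F) \<Longrightarrow> h y = f y * g y) \<Longrightarrow>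
      act \<rho> X h x = f x * act \<rho> X g x + g x * act \<rho> X f x"
proof -
  have v: "\<rho> x (X x) \<in> tangent (base F) x" by (rule anchor_mapD(2)[OF r x sections_fibre[OF X x]])
  show "h \<in> Cinf (base F) \<Longrightarrow> (\<And>y. y \<in> pts (base F) \<Longrightarrow> h y = f y + g y) \<Longrightarrow>
      act \<rho> X h x = act \<rho> X f x + act \<rho> X g x"
    using tangent_eq[OF base_premanifold v x, of h "\<lambda>y. f y + g y"] tangent_add[OF v f] by (simp add: act_def)
  show "h \<in> Cinf (base F) \<Longrightarrow> (\<And>y. y \<in> pts (base F) \<Longrightarrow> h y = f y * g y) \<Longrightarrow>
      act \<rho> X h x = f x * act \<rho> X g x + g x * act \<rho> X f x"
    using tangent_eq[OF base_premanifold v x, of h "\<lambda>y. f y * g y"] tangent_mult[OF v f] by (simp add: act_def)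
qed

lemma bracket_bilinear:
  assumes "X \<in> sections F" "Y \<in> sections F"
  shows "B X Y \<in> sections F" "X' \<in> sections F \<Longrightarrow> B (X + X') Y = B X Y + B X' Y"
    "X' \<in> sections F \<Longrightarrow> B Y (X + X') = B Y X + B Y X'"
  using bilinear_sectionsD[OF _ assms] alg by (auto simp: algebroid_def)

text \<open>Each rule is the algebroid law with one of the two factors equal to 1. The derivative of
  the constant vanishes on the base, and off the base every section is 0.\<close>

lemma bracket_leibniz:
  assumes X: "X \<in> sections F" and Y: "Y \<in> sections F" and f: "f \<in> Cinf (base F)"
  shows "B (f \<star> X) Y = f \<star> B X Y - act \<rho>r Y f \<star> X" "B Y (f \<star> X) = act \<rho>l Y f \<star> X + f \<star> B Y X"
proof -
  have law: "B (f \<star> \<sigma>) (f' \<star> \<sigma>') = f \<star> act \<rho>l \<sigma> f' \<star> \<sigma>' - f' \<star> act \<rho>r \<sigma>' f \<star> \<sigma> + f \<star> f' \<star> B \<sigma> \<sigma>'"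
    if "f \<in> Cinf (base F)" "f' \<in> Cinf (base F)" "\<sigma> \<in> sections F" "\<sigma>' \<in> sections F" for f f' \<sigma> \<sigma>'
    using alg that by (simp add: algebroid_def)
  note one = Cinf_const[OF base_premanifold, of 1]
  have e: "(\<lambda>_. 1) \<star> Z = Z" for Z :: "'a \<Rightarrow> 'v" by (simp add: fmult_def)
  have zl: "(act \<rho>l X (\<lambda>_. 1) \<star> Y) x = 0" "(act \<rho>r X (\<lambda>_. 1) \<star> Y) x = 0"
    if "X \<in> sections F" "Y \<in> sections F" for X Y x
    using tangent_const[OF base_premanifold act_tangent(1)[OF that(1)], of x 1]
      tangent_const[OF base_premanifold act_tangent(2)[OF that(1)], of x 1] sections_outside[OF that(2), of x]
    by (cases "x \<in> pts (base F)"; simp add: fmult_apply act_def)+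
  show "B (f \<star> X) Y = f \<star> B X Y - act \<rho>r Y f \<star> X"
    using law[OF f one X Y] zl(1)[OF X Y] unfolding e by (simp add: fun_eq_iff fmult_apply)
  show "B Y (f \<star> X) = act \<rho>l Y f \<star> X + f \<star> B Y X"
    using law[OF one f Y X] zl(2)[OF X Y] unfolding e by (simp add: fun_eq_iff fmult_apply)
qed

text \<open>A factor \<open>f\<close> in the first argument is differentiated by the right anchor
  twice, in the derivative of the pairing and inside the bracket, with opposite signs. In the second
  argument the left anchor does the same. Hence the two-anchor differential is tensorial in each
  slot.\<close>

lemma dlr_linear:
  assumes k: "\<And>x. x \<in> pts (base F) \<Longrightarrow> linear_on (fibre F x) (\<kappa> x)"
    and C: "\<And>X. X \<in> sections F \<Longrightarrow> pairing \<kappa> X \<in> Cinf (base F)"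
    and x: "x \<in> pts (base F)" and X: "X \<in> sections F" and Y: "Y \<in> sections F"
  shows "X' \<in> sections F \<Longrightarrow> dlr B \<rho>l \<rho>r \<kappa> (X + X') Y x = dlr B \<rho>l \<rho>r \<kappa> X Y x + dlr B \<rho>l \<rho>r \<kappa> X' Y x"
    and "X' \<in> sections F \<Longrightarrow> dlr B \<rho>l \<rho>r \<kappa> Y (X + X') x = dlr B \<rho>l \<rho>r \<kappa> Y X x + dlr B \<rho>l \<rho>r \<kappa> Y X' x"
    and "f \<in> Cinf (base F) \<Longrightarrow> dlr B \<rho>l \<rho>r \<kappa> (f \<star> X) Y x = f x * dlr B \<rho>l \<rho>r \<kappa> X Y x"
    and "f \<in> Cinf (base F) \<Longrightarrow> dlr B \<rho>l \<rho>r \<kappa> Y (f \<star> X) x = f x * dlr B \<rho>l \<rho>r \<kappa> Y X x"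
proof -
  have pa: "pairing \<kappa> (Z + Z') y = pairing \<kappa> Z y + pairing \<kappa> Z' y"
    if "y \<in> pts (base F)" "Z \<in> sections F" "Z' \<in> sections F" for y Z Z'
    using linear_onD(1)[OF k[OF that(1)]] that by (simp add: pairing_def sections_fibre)
  have pm: "pairing \<kappa> (g \<star> Z) y = g y * pairing \<kappa> Z y"
    if "y \<in> pts (base F)" "Z \<in> sections F" for y Z g
    using linear_onD(2)[OF k[OF that(1)]] sections_fibre[OF that(2,1)] by (simp add: pairing_def fmult_apply)
  have pd: "pairing \<kappa> (Z - Z') y = pairing \<kappa> Z y - pairing \<kappa> Z' y"
    if "y \<in> pts (base F)" "Z \<in> sections F" "Z' \<in> sections F" for y Z Z'
    using pa[OF that(1) sections_diff[OF F that(2,3)] that(3)] by simp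
  note l = act_section[OF anchors(1) x] act_section[OF anchors(2) x]
  note sa = sections_add[OF F] note sf = sections_fmult[OF F]
  show "dlr B \<rho>l \<rho>r \<kappa> (X + X') Y x = dlr B \<rho>l \<rho>r \<kappa> X Y x + dlr B \<rho>l \<rho>r \<kappa> X' Y x" if X': "X' \<in> sections F"
    using act_derivation(1)[OF anchors(2) x Y C[OF X] C[OF X'] C[OF sa[OF X X']] pa[OF _ X X']]
      pa[OF x bracket_bilinear(1)[OF X Y] bracket_bilinear(1)[OF X' Y]]
    by (simp add: dlr_def l(1)[OF X X'] bracket_bilinear(2)[OF X Y X'])
  show "dlr B \<rho>l \<rho>r \<kappa> Y (X + X') x = dlr B \<rho>l \<rho>r \<kappa> Y X x + dlr B \<rho>l \<rho>r \<kappa> Y X' x" if X': "X' \<in> sections F"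
    using act_derivation(1)[OF anchors(1) x Y C[OF X] C[OF X'] C[OF sa[OF X X']] pa[OF _ X X']]
      pa[OF x bracket_bilinear(1)[OF Y X] bracket_bilinear(1)[OF Y X']]
    by (simp add: dlr_def l(3)[OF X X'] bracket_bilinear(3)[OF X Y X'])
  show "dlr B \<rho>l \<rho>r \<kappa> (f \<star> X) Y x = f x * dlr B \<rho>l \<rho>r \<kappa> X Y x" if f: "f \<in> Cinf (base F)"
  proof -
    have s: "f \<star> B X Y \<in> sections F" by (rule sf[OF f bracket_bilinear(1)[OF X Y]])
    \<comment> \<open>As a difference of two sections this product is a section, whatever is known
      of its coefficient.\<close>
    have "act \<rho>r Y f \<star> X = f \<star> B X Y - B (f \<star> X) Y" using bracket_leibniz(1)[OF X Y f] by simp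
    then have s': "act \<rho>r Y f \<star> X \<in> sections F"
      using sections_diff[OF F s bracket_bilinear(1)[OF sf[OF f X] Y]] by simp
    have "pairing \<kappa> (B (f \<star> X) Y) x = f x * pairing \<kappa> (B X Y) x - act \<rho>r Y f x * pairing \<kappa> X x"
      unfolding bracket_leibniz(1)[OF X Y f] pd[OF x s s']
      by (simp only: pm[OF x X] pm[OF x bracket_bilinear(1)[OF X Y]])
    then show ?thesis
      using act_derivation(2)[OF anchors(2) x Y f C[OF X] C[OF sf[OF f X]] pm[OF _ X]]
      by (simp add: dlr_def l(2)[OF X X] algebra_simps)
  qed
  show "dlr B \<rho>l \<rho>r \<kappa> Y (f \<star> X) x = f x * dlr B \<rho>l \<rho>r \<kappa> Y X x" if f: "f \<in> Cinf (base F)"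
  proof -
    have s: "f \<star> B Y X \<in> sections F" by (rule sf[OF f bracket_bilinear(1)[OF Y X]])
    have "act \<rho>l Y f \<star> X = B Y (f \<star> X) - f \<star> B Y X" using bracket_leibniz(2)[OF X Y f] by simp
    then have s': "act \<rho>l Y f \<star> X \<in> sections F"
      using sections_diff[OF F bracket_bilinear(1)[OF Y sf[OF f X]] s] by simp
    have "pairing \<kappa> (B Y (f \<star> X)) x = act \<rho>l Y f x * pairing \<kappa> X x + f x * pairing \<kappa> (B Y X) x"
      unfolding bracket_leibniz(2)[OF X Y f] pa[OF x s' s]
      by (simp only: pm[OF x X] pm[OF x bracket_bilinear(1)[OF Y X]])
    then show ?thesis
      using act_derivation(2)[OF anchors(1) x Y f C[OF X] C[OF sf[OF f X]] pm[OF _ X]]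
      by (simp add: dlr_def l(4)[OF X X] algebra_simps)
  qed
qed

text \<open>Homogeneity is required for arbitrary factors \<open>g\<close> for which \<open>g \<star> X\<close> is a section: it is applied
  to \<open>\<rho>(Y)(f)\<close>, whose smoothness is not at hand.\<close>

definition skew_form :: "(('a \<Rightarrow> 'v) \<Rightarrow> ('a \<Rightarrow> 'v) \<Rightarrow> 'a \<Rightarrow> real) \<Rightarrow> bool" where
  "skew_form T \<longleftrightarrow> (\<forall>X\<in>sections F. \<forall>Y\<in>sections F. T X Y \<in> Cinf (base F) \<and>
     (\<forall>x\<in>pts (base F). T X Y x = - T Y X x \<and>
        (\<forall>X'\<in>sections F. T (X + X') Y x = T X Y x + T X' Y x) \<and>
        (\<forall>g. g \<star> X \<in> sections F \<longrightarrow> T (g \<star> X) Y x = g x * T X Y x)))"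

context
  fixes T :: "('a \<Rightarrow> 'v) \<Rightarrow> ('a \<Rightarrow> 'v) \<Rightarrow> 'a \<Rightarrow> real"
  assumes T: "skew_form T"
begin

lemma form_Cinf: "X \<in> sections F \<Longrightarrow> Y \<in> sections F \<Longrightarrow> T X Y \<in> Cinf (base F)"
  and form_add: "x \<in> pts (base F) \<Longrightarrow> X \<in> sections F \<Longrightarrow> X' \<in> sections F \<Longrightarrow> Y \<in> sections F \<Longrightarrow>
      T (X + X') Y x = T X Y x + T X' Y x"
  and form_fmult: "x \<in> pts (base F) \<Longrightarrow> X \<in> sections F \<Longrightarrow> g \<star> X \<in> sections F \<Longrightarrow> Y \<in> sections F \<Longrightarrow>
      T (g \<star> X) Y x = g x * T X Y x"
  and form_skew: "x \<in> pts (base F) \<Longrightarrow> X \<in> sections F \<Longrightarrow> Y \<in> sections F \<Longrightarrow> T X Y x = - T Y X x"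
  using T unfolding skew_form_def by blast+

lemma form_diff:
  assumes "x \<in> pts (base F)" "X \<in> sections F" "X' \<in> sections F" "Y \<in> sections F"
  shows "T (X - X') Y x = T X Y x - T X' Y x"
  using form_add[OF assms(1) sections_diff[OF F assms(2,3)] assms(3,4)] by simp

text \<open>Doubling clears the halves in the mean anchor and in the skew bracket, so the later
  cancellations become linear arithmetic.\<close>

lemma dA_eq:
  assumes x: "x \<in> pts (base F)" and X: "X \<in> sections F" and Y: "Y \<in> sections F" and Z: "Z \<in> sections F"
  shows "2 * dA B \<rho>l \<rho>r T X Y Z x =
    (act \<rho>l X (T Y Z) x + act \<rho>r X (T Y Z) x) - (act \<rho>l Y (T X Z) x + act \<rho>r Y (T X Z) x)
    + (act \<rho>l Z (T X Y) x + act \<rho>r Z (T X Y) x)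
    - (T (B X Y) Z x - T (B Y X) Z x) + (T (B X Z) Y x - T (B Z X) Y x) - (T (B Y Z) X x - T (B Z Y) X x)"
proof -
  have m: "act (mean_anchor \<rho>l \<rho>r) W f x = (act \<rho>l W f x + act \<rho>r W f x) / 2" for W f
    by (simp add: act_def mean_anchor_def scaleR_fun_def)
  have b: "T (skew_bracket B W W') V x = (T (B W W') V x - T (B W' W) V x) / 2"
    if "W \<in> sections F" "W' \<in> sections F" "V \<in> sections F" for W W' V
  proof -
    note s = bracket_bilinear(1)[OF that(1,2)] bracket_bilinear(1)[OF that(2,1)]
    note d = sections_diff[OF F s]
    show ?thesis unfolding skew_bracket_def fmult_const
      using form_fmult[OF x d _ that(3), of "\<lambda>_. 1/2"] sections_fmult[OF F Cinf_const[OF base_premanifold] d]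
        form_diff[OF x s that(3)] by simp
  qed
  have ar: "2 * (a / 2 - b / 2 + c / 2 - d / 2 + e / 2 - f / 2) = a - b + c - d + e - f" for a b c d e f :: real
    by simp
  show ?thesis
    unfolding dA_def Let_def minus_apply plus_fun_apply m b[OF X Y Z] b[OF X Z Y] b[OF Y Z X]
    by (rule ar)
qed

text \<open>These two transpositions generate all permutations, so tensoriality in the first slot,
  shown next, carries over to the other two.\<close>

lemma dA_swap:
  assumes x: "x \<in> pts (base F)" and X: "X \<in> sections F" and Y: "Y \<in> sections F" and Z: "Z \<in> sections F"
  shows "dA B \<rho>l \<rho>r T Y X Z x = - dA B \<rho>l \<rho>r T X Y Z x" "dA B \<rho>l \<rho>r T X Z Y x = - dA B \<rho>l \<rho>r T X Y Z x"
proof -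
  have n: "act \<rho> W (T U V) x = - act \<rho> W (T V U) x"
    if r: "anchor_map F \<rho>" and s: "W \<in> sections F" "U \<in> sections F" "V \<in> sections F" for \<rho> W U V
  proof -
    have z: "(\<lambda>_. 0) \<in> Cinf (base F)" by (rule Cinf_const[OF base_premanifold])
    have "act \<rho> W (\<lambda>_. 0) x = act \<rho> W (T U V) x + act \<rho> W (T V U) x"
      by (rule act_derivation(1)[OF r x s(1) form_Cinf[OF s(2,3)] form_Cinf[OF s(3,2)] z]) (use form_skew[OF _ s(2,3)] in simp)
    moreover have "act \<rho> W (\<lambda>_. 0) x = 0"
      unfolding act_def by (rule tangent_const[OF base_premanifold anchor_mapD(2)[OF r x sections_fibre[OF s(1) x]]])
    ultimately show ?thesis by simp
  qed
  note nl = n[OF anchors(1)] n[OF anchors(2)]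
  have "2 * dA B \<rho>l \<rho>r T Y X Z x = - (2 * dA B \<rho>l \<rho>r T X Y Z x)"
    unfolding dA_eq[OF x X Y Z] dA_eq[OF x Y X Z] unfolding nl[OF Z X Y] by linarith
  then show "dA B \<rho>l \<rho>r T Y X Z x = - dA B \<rho>l \<rho>r T X Y Z x" by simp
  have "2 * dA B \<rho>l \<rho>r T X Z Y x = - (2 * dA B \<rho>l \<rho>r T X Y Z x)"
    unfolding dA_eq[OF x X Y Z] dA_eq[OF x X Z Y] unfolding nl[OF X Y Z] by linarith
  then show "dA B \<rho>l \<rho>r T X Z Y x = - dA B \<rho>l \<rho>r T X Y Z x" by simp
qed

lemma dA_add:
  assumes x: "x \<in> pts (base F)" and X: "X \<in> sections F" "X' \<in> sections F" and Y: "Y \<in> sections F" and Z: "Z \<in> sections F"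
  shows "dA B \<rho>l \<rho>r T (X + X') Y Z x = dA B \<rho>l \<rho>r T X Y Z x + dA B \<rho>l \<rho>r T X' Y Z x"
proof -
  note XX = sections_add[OF F X]
  have n: "act \<rho> W (T (X + X') V) x = act \<rho> W (T X V) x + act \<rho> W (T X' V) x"
    if r: "anchor_map F \<rho>" and s: "W \<in> sections F" "V \<in> sections F" for \<rho> W V
    by (rule act_derivation(1)[OF r x s(1) form_Cinf[OF X(1) s(2)] form_Cinf[OF X(2) s(2)] form_Cinf[OF XX s(2)]])
      (rule form_add[OF _ X s(2)])
  have t: "T V (X + X') x = T V X x + T V X' x" if "V \<in> sections F" for V
    using form_skew[OF x that XX] form_add[OF x X that] form_skew[OF x that X(1)] form_skew[OF x that X(2)] by simp
  note bs = bracket_bilinear(1)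
  have "2 * dA B \<rho>l \<rho>r T (X + X') Y Z x = 2 * dA B \<rho>l \<rho>r T X Y Z x + 2 * dA B \<rho>l \<rho>r T X' Y Z x"
    unfolding dA_eq[OF x XX Y Z] dA_eq[OF x X(1) Y Z] dA_eq[OF x X(2) Y Z]
    using act_section(1)[OF anchors(1) x X] act_section(1)[OF anchors(2) x X]
      n[OF anchors(1) Y Z] n[OF anchors(2) Y Z] n[OF anchors(1) Z Y] n[OF anchors(2) Z Y]
      t[OF bs[OF Y Z]] t[OF bs[OF Z Y]]
      form_add[OF x bs[OF X(1) Y] bs[OF X(2) Y] Z] form_add[OF x bs[OF Y X(1)] bs[OF Y X(2)] Z]
      form_add[OF x bs[OF X(1) Z] bs[OF X(2) Z] Y] form_add[OF x bs[OF Z X(1)] bs[OF Z X(2)] Y]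
    unfolding bracket_bilinear(2)[OF X(1) Y X(2)] bracket_bilinear(2)[OF X(1) Z X(2)]
      bracket_bilinear(3)[OF X(1) Y X(2)] bracket_bilinear(3)[OF X(1) Z X(2)]
    by simp
  then show ?thesis by simp
qed

text \<open>Derivatives of \<open>f\<close> along \<open>Y\<close> come with both anchors from the
  mean anchor. In the skew bracket, one order of the arguments yields the right anchor and the other
  the left one, with signs that cancel them; the same happens along \<open>Z\<close>.\<close>

lemma dA_fmult:
  assumes x: "x \<in> pts (base F)" and X: "X \<in> sections F" and Y: "Y \<in> sections F" and Z: "Z \<in> sections F"
    and f: "f \<in> Cinf (base F)"
  shows "dA B \<rho>l \<rho>r T (f \<star> X) Y Z x = f x * dA B \<rho>l \<rho>r T X Y Z x"
proof -
  note fX = sections_fmult[OF F f X]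
  note bs = bracket_bilinear(1)
  have n: "act \<rho> W (T (f \<star> X) V) x = f x * act \<rho> W (T X V) x + T X V x * act \<rho> W f x"
    if r: "anchor_map F \<rho>" and s: "W \<in> sections F" "V \<in> sections F" for \<rho> W V
    by (rule act_derivation(2)[OF r x s(1) f form_Cinf[OF X s(2)] form_Cinf[OF fX s(2)]])
      (rule form_fmult[OF _ X fX s(2)])
  have t: "T V (f \<star> X) x = f x * T V X x" if "V \<in> sections F" for V
    using form_skew[OF x that fX] form_fmult[OF x X fX that] form_skew[OF x that X] by simp
  have b1: "T (B (f \<star> X) W) V x = f x * T (B X W) V x - act \<rho>r W f x * T X V x"
    if s: "W \<in> sections F" "V \<in> sections F" for W V
  proof -
    have 1: "f \<star> B X W \<in> sections F" by (rule sections_fmult[OF F f bs[OF X s(1)]])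
    have "act \<rho>r W f \<star> X = f \<star> B X W - B (f \<star> X) W" using bracket_leibniz(1)[OF X s(1) f] by simp
    then have 2: "act \<rho>r W f \<star> X \<in> sections F" using sections_diff[OF F 1 bs[OF fX s(1)]] by simp
    show ?thesis unfolding bracket_leibniz(1)[OF X s(1) f] form_diff[OF x 1 2 s(2)]
      by (simp only: form_fmult[OF x X 2 s(2)] form_fmult[OF x bs[OF X s(1)] 1 s(2)])
  qed
  have b2: "T (B W (f \<star> X)) V x = act \<rho>l W f x * T X V x + f x * T (B W X) V x"
    if s: "W \<in> sections F" "V \<in> sections F" for W V
  proof -
    have 1: "f \<star> B W X \<in> sections F" by (rule sections_fmult[OF F f bs[OF s(1) X]])
    have "act \<rho>l W f \<star> X = B W (f \<star> X) - f \<star> B W X" using bracket_leibniz(2)[OF X s(1) f] by simp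
    then have 2: "act \<rho>l W f \<star> X \<in> sections F" using sections_diff[OF F bs[OF s(1) fX] 1] by simp
    show ?thesis unfolding bracket_leibniz(2)[OF X s(1) f] form_add[OF x 2 1 s(2)]
      by (simp only: form_fmult[OF x X 2 s(2)] form_fmult[OF x bs[OF s(1) X] 1 s(2)])
  qed
  have "2 * dA B \<rho>l \<rho>r T (f \<star> X) Y Z x = f x * (2 * dA B \<rho>l \<rho>r T X Y Z x)"
    unfolding dA_eq[OF x fX Y Z] dA_eq[OF x X Y Z]
      n[OF anchors(1) Y Z] n[OF anchors(2) Y Z] n[OF anchors(1) Z Y] n[OF anchors(2) Z Y]
      t[OF bs[OF Y Z]] t[OF bs[OF Z Y]] b1[OF Y Z] b1[OF Z Y] b2[OF Y Z] b2[OF Z Y]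
      act_section(2)[OF anchors(1) x X X] act_section(2)[OF anchors(2) x X X]
    by (simp add: algebra_simps)
  then show ?thesis by simp
qed

end

end

section \<open>The symplectic section\<close>

locale associated_structure =
  fixes E :: "('q, 'm::coordinate_space, 'v::real_vector, 'f::coordinate_space) vbundle"
    and B Dl Dr :: "('q, 'v) sec_op"
    and \<rho>l \<rho>r :: "('q, 'v) anchor"
    and R :: "('q \<Rightarrow> 'v) \<Rightarrow> ('q, 'v) sec_op"
    and BT :: "('q \<times> ('v \<Rightarrow> real), ('q, 'v) lfib) sec_op"
  assumes E: "vector_bundle E"
    and alg: "algebroid E B \<rho>l \<rho>r"
    and Dl: "connection E \<rho>l Dl"
    and Dr: "connection E \<rho>r Dr"
    and B_eq: "\<forall>\<sigma>\<in>sections E. \<forall>\<tau>\<in>sections E. B \<sigma> \<tau> = Dl \<sigma> \<tau> - Dr \<tau> \<sigma>"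
    and R: "tensor13 E R"
    and BT: "associated_bracket E B \<rho>l \<rho>r Dl Dr R BT"
begin

abbreviation "RA \<equiv> right_anchor E \<rho>l \<rho>r Dl Dr"
abbreviation "Om \<equiv> Omega E \<rho>l \<rho>r Dl Dr BT"
abbreviation "lam \<equiv> liouville E \<rho>l"
abbreviation "hl \<equiv> hsec E \<rho>l Dl"
abbreviation "vl \<equiv> vsec E"

end

text \<open>Facts about the algebroid \<open>E\<close> carry the prefix \<open>base\<close>; the
  unprefixed ones below refer to the left tangent bundle.\<close>

sublocale associated_structure \<subseteq> base: linear_algebroid E B \<rho>l \<rho>r
  by (rule linear_algebroid.intro[OF vector_bundle_linear[OF E] alg])

sublocale associated_structure \<subseteq> lifted_bundle E \<rho>l
  by (rule lifted_bundle.intro[OF E base.anchors(1)])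

sublocale associated_structure \<subseteq> linear_algebroid "left_tangent E \<rho>l" BT left_anchor "right_anchor E \<rho>l \<rho>r Dl Dr"
  by (rule linear_algebroid.intro[OF left_linear]) (use BT in \<open>simp add: associated_bracket_def\<close>)

context associated_structure
begin

lemmas hl_section = hsec_section[OF Dl]
lemmas const_Cinf = Cinf_const[OF pN]
lemmas left_fmult = sections_fmult[OF left_linear, unfolded left_tangent_base]
lemmas left_tangent_act = act_tangent[unfolded left_tangent_base]

text \<open>Reduces a pointwise identity between tensorial expressions to lifts: some multiple of
  \<open>X\<close> by a function equal to 1 at \<open>x\<close> lies in the span, and both sides
  ignore that factor at \<open>x\<close>.\<close>

lemma lift_span_unique:
  fixes L K :: "_ \<Rightarrow> 'w::real_vector"
  assumes x: "x \<in> pts DE"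
    and L: "\<And>X Y. X \<in> sections TE \<Longrightarrow> Y \<in> sections TE \<Longrightarrow> L (X + Y) = L X + L Y"
      "\<And>f X. f \<in> Cinf DE \<Longrightarrow> X \<in> sections TE \<Longrightarrow> L (f \<star> X) = f x *\<^sub>R L X"
    and K: "\<And>X Y. X \<in> sections TE \<Longrightarrow> Y \<in> sections TE \<Longrightarrow> K (X + Y) = K X + K Y"
      "\<And>f X. f \<in> Cinf DE \<Longrightarrow> X \<in> sections TE \<Longrightarrow> K (f \<star> X) = f x *\<^sub>R K X"
    and h: "\<And>\<sigma>. \<sigma> \<in> sections E \<Longrightarrow> L (hl \<sigma>) = K (hl \<sigma>)"
    and v: "\<And>\<nu>. \<nu> \<in> sections BE \<Longrightarrow> L (vl \<nu>) = K (vl \<nu>)"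
    and X: "X \<in> sections TE"
  shows "L X = K X"
proof -
  obtain f N where f: "f \<in> Cinf DE" "f x = 1" "f \<star> X \<in> lift_span Dl"
    by (rule local_lift_span[OF Dl X x]) metis
  have "L Y = K Y" if "Y \<in> lift_span Dl" for Y
    using that
  proof induction
    case zero
    have "L 0 = 0" by (rule additive_zero[OF left_linear L(1)])
    moreover have "K 0 = 0" by (rule additive_zero[OF left_linear K(1)])
    ultimately have "L 0 = K 0" by simp
    then show ?case .
  next
    case (add X Y)
    then show ?case using L(1) K(1) lift_span_sections[OF Dl] by metis
  next
    case (mult f X)
    then show ?case using L(2) K(2) lift_span_sections[OF Dl] by metis
  qed (rule h v, assumption)+
  from this[OF f(3)] show ?thesis using L(2)[OF f(1) X] K(2)[OF f(1) X] f(2) by simp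
qed

text \<open>The smooth counterpart: here the factor has to be 1 on a whole neighbourhood of
  \<open>x\<close>, so that \<open>L X\<close> agrees there with the smooth function
  \<open>L (f \<star> X)\<close>.\<close>

lemma lift_span_Cinf:
  fixes L :: "_ \<Rightarrow> _ \<Rightarrow> real"
  assumes L: "\<And>X Y x. x \<in> pts DE \<Longrightarrow> X \<in> sections TE \<Longrightarrow> Y \<in> sections TE \<Longrightarrow> L (X + Y) x = L X x + L Y x"
      "\<And>f X x. x \<in> pts DE \<Longrightarrow> f \<in> Cinf DE \<Longrightarrow> X \<in> sections TE \<Longrightarrow> L (f \<star> X) x = f x * L X x"
    and h: "\<And>\<sigma>. \<sigma> \<in> sections E \<Longrightarrow> L (hl \<sigma>) \<in> Cinf DE"
    and v: "\<And>\<nu>. \<nu> \<in> sections BE \<Longrightarrow> L (vl \<nu>) \<in> Cinf DE"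
    and X: "X \<in> sections TE"
  shows "L X \<in> Cinf DE"
proof (rule CinfI[OF pN])
  fix x assume x: "x \<in> pts DE"
  obtain f N where f: "f \<in> Cinf DE" "mopen DE N" "x \<in> N" "\<forall>y\<in>N. f y = 1" "f \<star> X \<in> lift_span Dl"
    by (rule local_lift_span[OF Dl X x]) metis
  have "L Y \<in> Cinf DE" if "Y \<in> lift_span Dl" for Y
    using that
  proof induction
    case zero
    have "L 0 x = 0" if "x \<in> pts DE" for x
      by (rule additive_zero[OF left_linear, of "\<lambda>X. L X x"]) (rule L(1)[OF that])
    then have "L 0 \<in> Cinf DE" by (intro Cinf_cong[OF pN Cinf_const[OF pN, of 0]]) simp
    then show ?case .
  next
    case (add X Y)
    show ?case
      by (rule Cinf_cong[OF pN Cinf_add[OF pN add.IH]])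
        (rule L(1)[symmetric, OF _ lift_span_sections[OF Dl add.hyps(1)] lift_span_sections[OF Dl add.hyps(2)]])
  next
    case (mult f X)
    show ?case
      by (rule Cinf_cong[OF pN Cinf_mult[OF pN mult.hyps(1) mult.IH]])
        (rule L(2)[symmetric, OF _ mult.hyps(1) lift_span_sections[OF Dl mult.hyps(2)]])
  qed (rule h v, assumption)+
  from CinfD[OF pN this[OF f(5)] x] show "smooth_at DE (L X) x"
  proof (rule smooth_at_cong[OF pN _ f(2,3)])
    fix y assume y: "y \<in> N"
    then have "y \<in> pts DE" using mopen_subset[OF f(2)] by blast
    then show "L (f \<star> X) y = L X y" using L(2)[OF _ f(1) X] f(4) y by simp
  qed
qed

section \<open>The Liouville section and the definition of the symplectic section\<close>

lemma pairing_liouville: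
  assumes X: "X \<in> sections TE" and q: "q \<in> pts (base E)" and k: "k \<in> fibre BE q"
  shows "pairing lam X (q, k) = k (fst (X (q, k)))"
proof -
  have x: "(q, k) \<in> pts DE" using q k by simp
  have "X (q, k) \<in> fibre TE (q, k)" using sections_fibre[OF X] x by simp
  then show ?thesis using x by (simp add: pairing_def liouville_def case_prod_beta')
qed

lemma liouville_linear:
  assumes x: "x \<in> pts DE"
  shows "linear_on (fibre TE x) (lam x)"
proof -
  obtain q k where qk: "x = (q, k)" "q \<in> pts (base E)" "k \<in> fibre BE q" by (rule dual_pointE[OF x])
  have s: "subspace (fibre TE x)" using linear_bundleD(2)[OF left_linear] x by simp
  have l: "lam x p = k (fst p)" if "p \<in> fibre TE x" for p
    using that x by (simp add: liouville_def case_prod_beta' qk(1))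
  note kl = linear_onD[OF dual_fibre_linear[OF E qk(3)]]
  have f: "fst p \<in> fibre E q" if "p \<in> fibre TE x" for p using left_fibreD(1) that qk(1) by blast
  show ?thesis unfolding linear_on_def
    using l kl f subspace_add[OF s] subspace_scale[OF s] by simp
qed

lemma pairing_liouville_linear:
  assumes x: "x \<in> pts DE" and X: "X \<in> sections TE" "Y \<in> sections TE"
  shows "pairing lam (X + Y) x = pairing lam X x + pairing lam Y x" "pairing lam (f \<star> X) x = f x * pairing lam X x"
proof -
  have "X x \<in> fibre TE x" "Y x \<in> fibre TE x" using sections_fibre[OF X(1)] sections_fibre[OF X(2)] x by simp_all
  then show "pairing lam (X + Y) x = pairing lam X x + pairing lam Y x" "pairing lam (f \<star> X) x = f x * pairing lam X x"
    using linear_onD[OF liouville_linear[OF x]] by (simp_all add: pairing_def fmult_apply)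
qed

lemma hl_apply: "x \<in> pts DE \<Longrightarrow> hl \<sigma> x = (\<sigma> (fst x), hlift E \<rho>l Dl x (\<sigma> (fst x)))"
  by (simp only: hsec_def if_True)

lemma pairing_liouville_hl:
  assumes "\<sigma> \<in> sections E" "x \<in> pts DE"
  shows "pairing lam (hl \<sigma>) x = hat \<sigma> x"
  by (rule dual_pointE[OF assms(2)])
    (use assms(2) in \<open>simp only: pairing_liouville[OF hl_section[OF assms(1)]] hl_apply fst_conv hat_def prod.case\<close>)

lemma pairing_liouville_vl:
  assumes "\<nu> \<in> sections BE" "x \<in> pts DE"
  shows "pairing lam (vl \<nu>) x = 0"
proof -
  obtain q k where qk: "x = (q, k)" "q \<in> pts (base E)" "k \<in> fibre BE q" by (rule dual_pointE[OF assms(2)])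
  have "fst (vl \<nu> (q, k)) = 0" by (simp add: vsec_def)
  then show ?thesis
    using pairing_liouville[OF vsec_section[OF assms(1)] qk(2,3)] dual_fibre_zero[OF E qk(3,2)] qk(1) by simp
qed

lemma pairing_liouville_Cinf:
  assumes X: "X \<in> sections TE"
  shows "pairing lam X \<in> Cinf DE"
proof (rule lift_span_Cinf[OF _ _ _ _ X])
  show "pairing lam (hl \<sigma>) \<in> Cinf DE" if "\<sigma> \<in> sections E" for \<sigma>
    by (rule Cinf_cong[OF pN hat_Cinf[OF E that] pairing_liouville_hl[OF that, symmetric]])
  show "pairing lam (vl \<nu>) \<in> Cinf DE" if "\<nu> \<in> sections BE" for \<nu>
    by (rule Cinf_cong[OF pN const_Cinf pairing_liouville_vl[OF that, symmetric]])
qed (rule pairing_liouville_linear, assumption+)+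

lemma Om_dlr: "Om X Y x = - dlr BT left_anchor RA lam X Y x"
  by (simp add: Omega_def)

lemma Om_linear:
  assumes x: "x \<in> pts DE" and X: "X \<in> sections TE" and Y: "Y \<in> sections TE"
  shows "X' \<in> sections TE \<Longrightarrow> Om (X + X') Y x = Om X Y x + Om X' Y x"
    and "X' \<in> sections TE \<Longrightarrow> Om Y (X + X') x = Om Y X x + Om Y X' x"
    and "f \<in> Cinf DE \<Longrightarrow> Om (f \<star> X) Y x = f x * Om X Y x"
    and "f \<in> Cinf DE \<Longrightarrow> Om Y (f \<star> X) x = f x * Om Y X x"
  using dlr_linear[OF _ _ _ X Y, of lam x] liouville_linear pairing_liouville_Cinf x
  by (simp_all add: Om_dlr)

lemma act_left: "act left_anchor X f x = snd (X x) f"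
  by (simp add: act_def left_anchor_def case_prod_beta')

lemma act_right_hl:
  assumes "x \<in> pts DE"
  shows "act RA (hl \<sigma>) f x = hlift E \<rho>r Dr x (\<sigma> (fst x)) f"
  by (simp add: act_def right_anchor_def case_prod_beta' hl_apply[OF assms])

text \<open>The component in \<open>E\<close> of a vertical lift is 0, so both horizontal
  corrections in the right anchor disappear and the two anchors agree on it.\<close>

lemma act_right_vl:
  assumes x: "x \<in> pts DE"
  shows "act RA (vl \<nu>) f x = vlift E \<nu> x f"
proof -
  obtain q k where qk: "x = (q, k)" "q \<in> pts (base E)" "k \<in> fibre BE q" by (rule dual_pointE[OF x])
  show ?thesis
    unfolding act_def right_anchor_def vsec_def prod.case qk(1)
      hlift_zero[OF E base.anchors(1) Dl qk(2,3)] hlift_zero[OF E base.anchors(2) Dr qk(2,3)] by simp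
qed

lemma Om_eq:
  assumes X: "X \<in> sections TE" and Y: "Y \<in> sections TE" and q: "q \<in> pts (base E)" and k: "k \<in> fibre BE q"
  shows "Om X Y (q, k) = act RA Y (pairing lam X) (q, k) - snd (X (q, k)) (pairing lam Y) + k (fst (BT X Y (q, k)))"
  using pairing_liouville[OF bracket_bilinear(1)[OF X Y] q k]
  by (simp add: Om_dlr dlr_def act_left)

lemmas hlift_l = hlift_props[OF E base.anchors(1) Dl]
lemmas hlift_r = hlift_props[OF E base.anchors(2) Dr]

lemma tangent_liouville_hl:
  assumes x: "x \<in> pts DE" and v: "v \<in> tangent DE x" and s: "\<sigma> \<in> sections E"
  shows "v (pairing lam (hl \<sigma>)) = v (hat \<sigma>)"
  by (rule tangent_eq[OF pN v x pairing_liouville_Cinf[OF hl_section[OF s]] pairing_liouville_hl[OF s]])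

lemma tangent_liouville_vl:
  assumes x: "x \<in> pts DE" and v: "v \<in> tangent DE x" and s: "\<nu> \<in> sections BE"
  shows "v (pairing lam (vl \<nu>)) = 0"
  by (rule tangent_zero_fun[OF pN v x pairing_liouville_Cinf[OF vsec_section[OF s]] pairing_liouville_vl[OF s]])

lemma bracket_generators:
  shows "\<sigma> \<in> sections E \<Longrightarrow> \<tau> \<in> sections E \<Longrightarrow> BT (hl \<sigma>) (hl \<tau>) = hl (B \<sigma> \<tau>) + vsec_tensor E (R \<sigma> \<tau>)"
    "\<sigma> \<in> sections E \<Longrightarrow> \<nu> \<in> sections BE \<Longrightarrow> BT (hl \<sigma>) (vl \<nu>) = vl (dual_conn E \<rho>l Dl \<sigma> \<nu>)"
    "\<kappa> \<in> sections BE \<Longrightarrow> \<tau> \<in> sections E \<Longrightarrow> BT (vl \<kappa>) (hl \<tau>) = - vl (dual_conn E \<rho>r Dr \<tau> \<kappa>)"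
    "\<kappa> \<in> sections BE \<Longrightarrow> \<nu> \<in> sections BE \<Longrightarrow> BT (vl \<kappa>) (vl \<nu>) = 0"
  using BT unfolding associated_bracket_def by blast+

section \<open>Values of the symplectic section on lifts\<close>

context
  fixes q k
  assumes q: "q \<in> pts (base E)" and k: "k \<in> fibre BE q"
begin

lemma point_mem: "(q, k) \<in> pts DE"
  using q k by simp

lemma k_linear:
  "e \<in> fibre E q \<Longrightarrow> e' \<in> fibre E q \<Longrightarrow> k (e + e') = k e + k e'"
  "e \<in> fibre E q \<Longrightarrow> k (c *\<^sub>R e) = c * k e"
  "e \<in> fibre E q \<Longrightarrow> e' \<in> fibre E q \<Longrightarrow> k (e - e') = k e - k e'"
  "k 0 = 0"
proof -
  note kl = linear_onD[OF dual_fibre_linear[OF E k]]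
  note s = linear_bundleD(2)[OF lb q]
  show "e \<in> fibre E q \<Longrightarrow> e' \<in> fibre E q \<Longrightarrow> k (e + e') = k e + k e'"
    "e \<in> fibre E q \<Longrightarrow> k (c *\<^sub>R e) = c * k e" using kl by simp_all
  show "e \<in> fibre E q \<Longrightarrow> e' \<in> fibre E q \<Longrightarrow> k (e - e') = k e - k e'"
    using kl(1)[of "e - e'" e'] subspace_diff[OF s] by simp
  show "k 0 = 0" by (rule dual_fibre_zero[OF E k q])
qed

lemma dual_section_fibre: "\<nu> \<in> sections BE \<Longrightarrow> \<nu> q \<in> fibre BE q"
  using sections_fibre[of \<nu> BE q] q by simp

lemma hl_at: "hl \<sigma> (q, k) = (\<sigma> q, hlift E \<rho>l Dl (q, k) (\<sigma> q))"
  using hl_apply[OF point_mem] by simp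

lemma vl_at: "vl \<nu> (q, k) = (0, vlift E \<nu> (q, k))"
  by (simp add: vsec_def)

lemma vlift_at:
  assumes n: "\<nu> \<in> sections BE"
  shows "vlift E \<nu> (q, k) \<in> tangent DE (q, k)" "f \<in> Cinf (base E) \<Longrightarrow> vlift E \<nu> (q, k) (f \<circ> fst) = 0"
    "\<gamma> \<in> sections E \<Longrightarrow> vlift E \<nu> (q, k) (hat \<gamma>) = \<nu> q (\<gamma> q)"
  by (rule vlift_props[where \<nu> = \<nu>, OF E q k dual_section_fibre[OF n]]; assumption)+

lemma hlift_l_section:
  assumes s: "\<sigma> \<in> sections E"
  shows "hlift E \<rho>l Dl (q, k) (\<sigma> q) \<in> tangent DE (q, k)"
    "f \<in> Cinf (base E) \<Longrightarrow> hlift E \<rho>l Dl (q, k) (\<sigma> q) (f \<circ> fst) = act \<rho>l \<sigma> f q"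
    "\<gamma> \<in> sections E \<Longrightarrow> hlift E \<rho>l Dl (q, k) (\<sigma> q) (hat \<gamma>) = k (Dl \<sigma> \<gamma> q)"
  using hlift_l[OF q k sections_fibre[OF s q]] conn_at_eq[OF E Dl q s] by (simp_all add: act_def)

lemma hlift_r_section:
  assumes s: "\<sigma> \<in> sections E"
  shows "hlift E \<rho>r Dr (q, k) (\<sigma> q) \<in> tangent DE (q, k)"
    "f \<in> Cinf (base E) \<Longrightarrow> hlift E \<rho>r Dr (q, k) (\<sigma> q) (f \<circ> fst) = act \<rho>r \<sigma> f q"
    "\<gamma> \<in> sections E \<Longrightarrow> hlift E \<rho>r Dr (q, k) (\<sigma> q) (hat \<gamma>) = k (Dr \<sigma> \<gamma> q)"
  using hlift_r[OF q k sections_fibre[OF s q]] conn_at_eq[OF E Dr q s] by (simp_all add: act_def)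

text \<open>The Liouville section turns a horizontal lift into a linear function, whose derivatives
  are given by the connections: \<open>k (Dr \<tau> \<sigma> q) - k (Dl \<sigma> \<tau> q)\<close>.
  The bracket adds \<open>k (B \<sigma> \<tau> q)\<close>, which cancels this by
  \<open>B_eq\<close>. The term with \<open>R\<close> is vertical and invisible to the Liouville
  section.\<close>

lemma Om_hh:
  assumes s: "\<sigma> \<in> sections E" and t: "\<tau> \<in> sections E"
  shows "Om (hl \<sigma>) (hl \<tau>) (q, k) = 0"
proof -
  note x = point_mem
  have B: "B \<sigma> \<tau> q = Dl \<sigma> \<tau> q - Dr \<tau> \<sigma> q" using B_eq s t by simp
  have f: "Dl \<sigma> \<tau> q \<in> fibre E q" "Dr \<tau> \<sigma> q \<in> fibre E q"
    by (rule sections_fibre[OF connectionD(1)[OF Dl s t] q], rule sections_fibre[OF connectionD(1)[OF Dr t s] q])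
  have 1: "act RA (hl \<tau>) (pairing lam (hl \<sigma>)) (q, k) = k (Dr \<tau> \<sigma> q)"
    using tangent_liouville_hl[OF x hlift_r_section(1)[OF t] s] hlift_r_section(3)[OF t s]
    by (simp only: act_right_hl[OF x] fst_conv)
  have 2: "snd (hl \<sigma> (q, k)) (pairing lam (hl \<tau>)) = k (Dl \<sigma> \<tau> q)"
    using tangent_liouville_hl[OF x hlift_l_section(1)[OF s] t] hlift_l_section(3)[OF s t]
    by (simp only: hl_at snd_conv)
  have 3: "fst (BT (hl \<sigma>) (hl \<tau>) (q, k)) = Dl \<sigma> \<tau> q - Dr \<tau> \<sigma> q"
    by (simp add: bracket_generators(1)[OF s t] hl_at vsec_tensor_def B)
  show ?thesis unfolding Om_eq[OF hl_section[OF s] hl_section[OF t] q k] 1 2 3 by (simp add: k_linear(3)[OF f])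
qed

lemma Om_hv:
  assumes s: "\<sigma> \<in> sections E" and n: "\<nu> \<in> sections BE"
  shows "Om (hl \<sigma>) (vl \<nu>) (q, k) = \<nu> q (\<sigma> q)"
proof -
  note x = point_mem and v = vlift_at[OF n]
  have 1: "act RA (vl \<nu>) (pairing lam (hl \<sigma>)) (q, k) = \<nu> q (\<sigma> q)"
    using tangent_liouville_hl[OF x v(1) s] v(3)[OF s] by (simp only: act_right_vl[OF x])
  have 2: "snd (hl \<sigma> (q, k)) (pairing lam (vl \<nu>)) = 0"
    using tangent_liouville_vl[OF x hlift_l_section(1)[OF s] n] by (simp only: hl_at snd_conv)
  have 3: "fst (BT (hl \<sigma>) (vl \<nu>) (q, k)) = 0"
    by (simp add: bracket_generators(2)[OF s n] vl_at)
  show ?thesis unfolding Om_eq[OF hl_section[OF s] vsec_section[OF n] q k] 1 2 3 by (simp add: k_linear(4))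
qed

lemma Om_vh:
  assumes s: "\<sigma> \<in> sections E" and n: "\<nu> \<in> sections BE"
  shows "Om (vl \<nu>) (hl \<sigma>) (q, k) = - \<nu> q (\<sigma> q)"
proof -
  note x = point_mem and v = vlift_at[OF n]
  have 1: "act RA (hl \<sigma>) (pairing lam (vl \<nu>)) (q, k) = 0"
    using tangent_liouville_vl[OF x hlift_r_section(1)[OF s] n] by (simp only: act_right_hl[OF x] fst_conv)
  have 2: "snd (vl \<nu> (q, k)) (pairing lam (hl \<sigma>)) = \<nu> q (\<sigma> q)"
    using tangent_liouville_hl[OF x v(1) s] v(3)[OF s] by (simp only: vl_at snd_conv)
  have 3: "fst (BT (vl \<nu>) (hl \<sigma>) (q, k)) = 0"
    by (simp add: bracket_generators(3)[OF n s] vl_at)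
  show ?thesis unfolding Om_eq[OF vsec_section[OF n] hl_section[OF s] q k] 1 2 3 by (simp add: k_linear(4))
qed

lemma Om_vv:
  assumes n: "\<nu> \<in> sections BE" and m: "\<kappa> \<in> sections BE"
  shows "Om (vl \<nu>) (vl \<kappa>) (q, k) = 0"
proof -
  note x = point_mem
  have 1: "act RA (vl \<kappa>) (pairing lam (vl \<nu>)) (q, k) = 0"
    using tangent_liouville_vl[OF x vlift_at(1)[OF m] n] by (simp only: act_right_vl[OF x])
  have 2: "snd (vl \<nu> (q, k)) (pairing lam (vl \<kappa>)) = 0"
    using tangent_liouville_vl[OF x vlift_at(1)[OF n] m] by (simp only: vl_at snd_conv)
  have 3: "fst (BT (vl \<nu>) (vl \<kappa>) (q, k)) = 0"
    by (simp add: bracket_generators(4)[OF n m])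
  show ?thesis unfolding Om_eq[OF vsec_section[OF n] vsec_section[OF m] q k] 1 2 3 by (simp add: k_linear(4))
qed

lemma left_section_fst:
  assumes "X \<in> sections TE"
  shows "fst (X (q, k)) \<in> fibre E q" "snd (X (q, k)) \<in> tangent DE (q, k)"
proof -
  have "X (q, k) \<in> fibre TE (q, k)" using sections_fibre[OF assms] point_mem by simp
  then show "fst (X (q, k)) \<in> fibre E q" "snd (X (q, k)) \<in> tangent DE (q, k)" by (rule left_fibreD)+
qed

text \<open>These two formulas show that \<open>Om X Y x\<close> depends on \<open>X\<close> only through \<open>X x\<close>.\<close>

lemma Om_hl_right:
  assumes t: "\<tau> \<in> sections E" and X: "X \<in> sections TE"
  shows "Om X (hl \<tau>) (q, k) = k (conn_at E Dl q (fst (X (q, k))) \<tau>) - snd (X (q, k)) (hat \<tau>)"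
proof (rule lift_span_unique[OF point_mem, where L = "\<lambda>X. Om X (hl \<tau>) (q, k)"
      and K = "\<lambda>X. k (conn_at E Dl q (fst (X (q, k))) \<tau>) - snd (X (q, k)) (hat \<tau>)"])
  note O = Om_linear[OF point_mem _ hl_section[OF t]]
  note c = conn_at_linear[OF E Dl q t]
  note kc = k_linear(1)[OF c(3) c(3)] k_linear(2)[OF c(3)]
  fix Y Z f
  assume Y: "Y \<in> sections TE"
  note y = left_section_fst(1)[OF Y]
  show "Om (f \<star> Y) (hl \<tau>) (q, k) = f (q, k) *\<^sub>R Om Y (hl \<tau>) (q, k)" if "f \<in> Cinf DE"
    using O(3)[OF Y that] by simp
  show "k (conn_at E Dl q (fst ((f \<star> Y) (q, k))) \<tau>) - snd ((f \<star> Y) (q, k)) (hat \<tau>) =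
    f (q, k) *\<^sub>R (k (conn_at E Dl q (fst (Y (q, k))) \<tau>) - snd (Y (q, k)) (hat \<tau>))"
    by (simp add: fmult_apply c(2)[OF y y] kc(2)[OF y y] scaleR_fun_def right_diff_distrib)
  assume Z: "Z \<in> sections TE"
  note z = left_section_fst(1)[OF Z]
  show "Om (Y + Z) (hl \<tau>) (q, k) = Om Y (hl \<tau>) (q, k) + Om Z (hl \<tau>) (q, k)" by (rule O(1)[OF Y Z])
  show "k (conn_at E Dl q (fst ((Y + Z) (q, k))) \<tau>) - snd ((Y + Z) (q, k)) (hat \<tau>) =
    k (conn_at E Dl q (fst (Y (q, k))) \<tau>) - snd (Y (q, k)) (hat \<tau>) +
    (k (conn_at E Dl q (fst (Z (q, k))) \<tau>) - snd (Z (q, k)) (hat \<tau>))"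
    by (simp add: c(1)[OF y z] kc(1)[OF y y z z])
next
  fix \<sigma> assume s: "\<sigma> \<in> sections E"
  show "Om (hl \<sigma>) (hl \<tau>) (q, k) = k (conn_at E Dl q (fst (hl \<sigma> (q, k))) \<tau>) - snd (hl \<sigma> (q, k)) (hat \<tau>)"
    by (simp add: Om_hh[OF s t] hl_at hlift_l_section(3)[OF s t] conn_at_eq[OF E Dl q s t])
next
  fix \<nu> assume n: "\<nu> \<in> sections BE"
  have "conn_at E Dl q 0 \<tau> = 0"
    using conn_at_linear(2)[OF E Dl q t base_zero[OF q] base_zero[OF q], of 0] by simp
  then show "Om (vl \<nu>) (hl \<tau>) (q, k) = k (conn_at E Dl q (fst (vl \<nu> (q, k))) \<tau>) - snd (vl \<nu> (q, k)) (hat \<tau>)"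
    by (simp add: Om_vh[OF t n] vl_at vlift_at(3)[OF n t] k_linear(4))
qed (rule X)

lemma Om_vl_right:
  assumes n: "\<nu> \<in> sections BE" and X: "X \<in> sections TE"
  shows "Om X (vl \<nu>) (q, k) = \<nu> q (fst (X (q, k)))"
proof (rule lift_span_unique[OF point_mem, where L = "\<lambda>X. Om X (vl \<nu>) (q, k)"
      and K = "\<lambda>X. \<nu> q (fst (X (q, k)))"])
  note O = Om_linear[OF point_mem _ vsec_section[OF n]]
  note l = linear_onD[OF dual_fibre_linear[OF E dual_section_fibre[OF n]]]
  fix Y Z f
  assume Y: "Y \<in> sections TE"
  note y = left_section_fst(1)[OF Y]
  show "Om (f \<star> Y) (vl \<nu>) (q, k) = f (q, k) *\<^sub>R Om Y (vl \<nu>) (q, k)" if "f \<in> Cinf DE"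
    using O(3)[OF Y that] by simp
  show "\<nu> q (fst ((f \<star> Y) (q, k))) = f (q, k) *\<^sub>R \<nu> q (fst (Y (q, k)))"
    by (simp add: fmult_apply l(2)[OF y])
  assume Z: "Z \<in> sections TE"
  note z = left_section_fst(1)[OF Z]
  show "Om (Y + Z) (vl \<nu>) (q, k) = Om Y (vl \<nu>) (q, k) + Om Z (vl \<nu>) (q, k)" by (rule O(1)[OF Y Z])
  show "\<nu> q (fst ((Y + Z) (q, k))) = \<nu> q (fst (Y (q, k))) + \<nu> q (fst (Z (q, k)))"
    by (simp add: l(1)[OF y z])
next
  show "Om (hl \<sigma>) (vl \<nu>) (q, k) = \<nu> q (fst (hl \<sigma> (q, k)))" if "\<sigma> \<in> sections E" for \<sigma>
    by (simp add: Om_hv[OF that n] hl_at)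
  show "Om (vl \<kappa>) (vl \<nu>) (q, k) = \<nu> q (fst (vl \<kappa> (q, k)))" if "\<kappa> \<in> sections BE" for \<kappa>
    by (simp add: Om_vv[OF that n] vl_at dual_fibre_zero[OF E dual_section_fibre[OF n] q])
qed (rule X)

end

text \<open>Tested against lifts in the second argument, \<open>Om_hl_right\<close> and
  \<open>Om_vl_right\<close> involve the first argument only at \<open>x\<close>.\<close>

lemma Om_pointwise:
  assumes x: "x \<in> pts DE" and X: "X \<in> sections TE" "X' \<in> sections TE" and eq: "X x = X' x" and Y: "Y \<in> sections TE"
  shows "Om X Y x = Om X' Y x"
proof -
  obtain q k where qk: "x = (q, k)" "q \<in> pts (base E)" "k \<in> fibre BE q" by (rule dual_pointE[OF x])
  show ?thesis
  proof (rule lift_span_unique[OF x, where L = "\<lambda>Y. Om X Y x" and K = "\<lambda>Y. Om X' Y x"])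
    show "Om X (hl \<sigma>) x = Om X' (hl \<sigma>) x" if "\<sigma> \<in> sections E" for \<sigma>
      using Om_hl_right[OF qk(2,3) that X(1)] Om_hl_right[OF qk(2,3) that X(2)] eq by (simp add: qk(1))
    show "Om X (vl \<nu>) x = Om X' (vl \<nu>) x" if "\<nu> \<in> sections BE" for \<nu>
      using Om_vl_right[OF qk(2,3) that X(1)] Om_vl_right[OF qk(2,3) that X(2)] eq by (simp add: qk(1))
  qed (use Y Om_linear(2,4)[OF x _ X(1)] Om_linear(2,4)[OF x _ X(2)] in simp_all)
qed

text \<open>At \<open>x\<close> the factor \<open>g\<close> may be exchanged for the constant
  \<open>g x\<close>, which is smooth, so linearity over smooth functions applies to any factor for
  which the product is a section.\<close>

lemma Om_fmult:
  assumes x: "x \<in> pts DE" and X: "X \<in> sections TE" and gX: "g \<star> X \<in> sections TE" and Y: "Y \<in> sections TE"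
  shows "Om (g \<star> X) Y x = g x * Om X Y x"
proof -
  have "Om (g \<star> X) Y x = Om ((\<lambda>_. g x) \<star> X) Y x"
    by (rule Om_pointwise[OF x gX left_fmult[OF const_Cinf X] _ Y]) (simp add: fmult_apply)
  then show ?thesis using Om_linear(3)[OF x X Y const_Cinf] by simp
qed

text \<open>Neither the bracket nor the pair of anchors is skew, so the symmetry has to be found on
  pairs of lifts. \<open>step\<close> reduces the first argument to lifts; it is applied with a lift
  in the second place and then with an arbitrary section there.\<close>

lemma Om_skew:
  assumes x: "x \<in> pts DE" and X: "X \<in> sections TE" and Y: "Y \<in> sections TE"
  shows "Om X Y x = - Om Y X x"
proof -
  obtain q k where qk: "x = (q, k)" "q \<in> pts (base E)" "k \<in> fibre BE q" by (rule dual_pointE[OF x])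
  have step: "Om X Y x = - Om Y X x" if X: "X \<in> sections TE" and Y: "Y \<in> sections TE"
    and h: "\<And>\<sigma>. \<sigma> \<in> sections E \<Longrightarrow> Om (hl \<sigma>) Y x = - Om Y (hl \<sigma>) x"
    and v: "\<And>\<nu>. \<nu> \<in> sections BE \<Longrightarrow> Om (vl \<nu>) Y x = - Om Y (vl \<nu>) x" for X Y
    by (rule lift_span_unique[OF x, where L = "\<lambda>X. Om X Y x" and K = "\<lambda>X. - Om Y X x"])
      (use h v X Om_linear[OF x _ Y] in simp_all)
  have h: "Om X (hl \<sigma>) x = - Om (hl \<sigma>) X x" if X: "X \<in> sections TE" and s: "\<sigma> \<in> sections E" for X \<sigma>
    by (rule step[OF X hl_section[OF s]])
      (simp_all only: qk(1) Om_hh[OF qk(2,3)] Om_vh[OF qk(2,3)] Om_hv[OF qk(2,3)] s minus_zero)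
  have v: "Om X (vl \<nu>) x = - Om (vl \<nu>) X x" if X: "X \<in> sections TE" and s: "\<nu> \<in> sections BE" for X \<nu>
    by (rule step[OF X vsec_section[OF s]])
      (simp_all only: qk(1) Om_vv[OF qk(2,3)] Om_vh[OF qk(2,3)] Om_hv[OF qk(2,3)] s minus_zero minus_minus)
  show ?thesis
  proof (rule step[OF X Y])
    show "Om (hl \<sigma>) Y x = - Om Y (hl \<sigma>) x" if "\<sigma> \<in> sections E" for \<sigma> using h[OF Y that] by simp
    show "Om (vl \<nu>) Y x = - Om Y (vl \<nu>) x" if "\<nu> \<in> sections BE" for \<nu> using v[OF Y that] by simp
  qed
qed

text \<open>On pairs of lifts the values are 0 or, up to sign, the basic function \<nu>(\<sigma>).
  \<open>step\<close> frees the first argument, and skewness makes this enough for the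
  second.\<close>

lemma Om_Cinf:
  assumes X: "X \<in> sections TE" and Y: "Y \<in> sections TE"
  shows "Om X Y \<in> Cinf DE"
proof -
  have z: "f \<in> Cinf DE" if "\<And>q k. q \<in> pts (base E) \<Longrightarrow> k \<in> fibre BE q \<Longrightarrow> f (q, k) = 0" for f
    by (rule Cinf_cong[OF pN const_Cinf[of 0]]) (metis dual_pointE that)
  have p: "f \<in> Cinf DE" if "\<And>q k. q \<in> pts (base E) \<Longrightarrow> k \<in> fibre BE q \<Longrightarrow> f (q, k) = c * g q" "g \<in> Cinf (base E)" for f g c
  proof -
    have "g \<circ> fst \<in> Cinf DE" using Cinf_basic[OF dE] that(2) by simp
    from Cinf_mult[OF pN const_Cinf[of c] this] show ?thesis
    proof (rule Cinf_cong[OF pN])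
      fix x assume x: "x \<in> pts DE"
      show "c * (g \<circ> fst) x = f x" by (rule dual_pointE[OF x]) (simp add: that(1) del: dual_bundle_simps(2))
    qed
  qed
  have step: "Om X Y \<in> Cinf DE" if X: "X \<in> sections TE" and Y: "Y \<in> sections TE"
    and h: "\<And>\<sigma>. \<sigma> \<in> sections E \<Longrightarrow> Om (hl \<sigma>) Y \<in> Cinf DE"
    and v: "\<And>\<nu>. \<nu> \<in> sections BE \<Longrightarrow> Om (vl \<nu>) Y \<in> Cinf DE" for X Y
    by (rule lift_span_Cinf[of "\<lambda>X. Om X Y", OF Om_linear(1)[OF _ _ Y] Om_linear(3)[OF _ _ Y] h v X])
  have flip: "Om Y X \<in> Cinf DE" if "Om X Y \<in> Cinf DE" "X \<in> sections TE" "Y \<in> sections TE" for X Y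
    by (rule Cinf_cong[OF pN Cinf_mult[OF pN const_Cinf[of "-1"] that(1)]])
      (use Om_skew[OF _ that(2,3)] in simp)
  have hh: "Om (hl \<sigma>) (hl \<tau>) \<in> Cinf DE" if "\<sigma> \<in> sections E" "\<tau> \<in> sections E" for \<sigma> \<tau>
    by (rule z) (rule Om_hh[OF _ _ that])
  have vv: "Om (vl \<nu>) (vl \<kappa>) \<in> Cinf DE" if "\<nu> \<in> sections BE" "\<kappa> \<in> sections BE" for \<nu> \<kappa>
    by (rule z) (rule Om_vv[OF _ _ that])
  have hv: "Om (hl \<sigma>) (vl \<nu>) \<in> Cinf DE" if "\<sigma> \<in> sections E" "\<nu> \<in> sections BE" for \<sigma> \<nu>
    by (rule p[of _ 1, OF _ pairing_Cinf[OF E that(2,1)]])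
      (simp add: Om_hv that pairing_def del: dual_bundle_simps(2))
  have vh: "Om (vl \<nu>) (hl \<sigma>) \<in> Cinf DE" if "\<sigma> \<in> sections E" "\<nu> \<in> sections BE" for \<sigma> \<nu>
    by (rule flip[OF hv[OF that] hl_section[OF that(1)] vsec_section[OF that(2)]])
  have h: "Om X (hl \<sigma>) \<in> Cinf DE" if "X \<in> sections TE" "\<sigma> \<in> sections E" for X \<sigma>
    by (rule step[OF that(1) hl_section[OF that(2)] hh[OF _ that(2)] vh[OF that(2)]])
  have v: "Om X (vl \<nu>) \<in> Cinf DE" if "X \<in> sections TE" "\<nu> \<in> sections BE" for X \<nu>
    by (rule step[OF that(1) vsec_section[OF that(2)] hv[OF _ that(2)] vv[OF _ that(2)]])
  show ?thesis
    by (rule step[OF X Y])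
      (rule flip[OF h[OF Y] Y hl_section] flip[OF v[OF Y] Y vsec_section]; assumption)+
qed

abbreviation "dOm \<equiv> dA BT left_anchor RA Om"

lemma Om_form: "skew_form Om"
  unfolding skew_form_def left_tangent_base
proof (intro ballI conjI allI impI)
  fix X Y assume X: "X \<in> sections TE" and Y: "Y \<in> sections TE"
  show "Om X Y \<in> Cinf DE" by (rule Om_Cinf[OF X Y])
  fix x assume x: "x \<in> pts DE"
  show "Om X Y x = - Om Y X x" by (rule Om_skew[OF x X Y])
  show "Om (X + X') Y x = Om X Y x + Om X' Y x" if "X' \<in> sections TE" for X'
    by (rule Om_linear(1)[OF x X Y that])
  show "Om (g \<star> X) Y x = g x * Om X Y x" if "g \<star> X \<in> sections TE" for g
    by (rule Om_fmult[OF x X that Y])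
qed

lemmas dOm_eq = dA_eq[OF Om_form, unfolded left_tangent_base]
lemmas dOm_swap = dA_swap[OF Om_form, unfolded left_tangent_base]
lemmas dOm_add = dA_add[OF Om_form, unfolded left_tangent_base]
lemmas dOm_fmult = dA_fmult[OF Om_form, unfolded left_tangent_base]

end

section \<open>Closedness\<close>

context associated_structure
begin

context
  fixes q k
  assumes q: "q \<in> pts (base E)" and k: "k \<in> fibre BE q"
begin

private lemmas x = point_mem[OF q k]

lemma act_Om_zero:
  assumes X: "X \<in> sections TE" and Y: "Y \<in> sections TE" and Z: "Z \<in> sections TE"
    and z: "\<And>q k. q \<in> pts (base E) \<Longrightarrow> k \<in> fibre BE q \<Longrightarrow> Om Y Z (q, k) = 0"
  shows "act left_anchor X (Om Y Z) (q, k) = 0" "act RA X (Om Y Z) (q, k) = 0"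
proof -
  have "Om Y Z y = 0" if "y \<in> pts DE" for y
    by (rule dual_pointE[OF that]) (simp only: z)
  note z0 = this
  show "act left_anchor X (Om Y Z) (q, k) = 0" "act RA X (Om Y Z) (q, k) = 0"
    unfolding act_def
    by (rule tangent_zero_fun[OF pN left_tangent_act(1)[OF X x] x Om_Cinf[OF Y Z] z0], assumption,
      rule tangent_zero_fun[OF pN left_tangent_act(2)[OF X x] x Om_Cinf[OF Y Z] z0], assumption)
qed

lemma tangent_Om_hv:
  assumes v: "v \<in> tangent DE (q, k)" and s: "\<sigma> \<in> sections E" and n: "\<nu> \<in> sections BE"
  shows "v (Om (hl \<sigma>) (vl \<nu>)) = v (pairing \<nu> \<sigma> \<circ> fst)"
proof (rule tangent_eq[OF pN v x Om_Cinf[OF hl_section[OF s] vsec_section[OF n]]])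
  fix y assume y: "y \<in> pts DE"
  show "Om (hl \<sigma>) (vl \<nu>) y = (pairing \<nu> \<sigma> \<circ> fst) y"
    by (rule dual_pointE[OF y]) (simp add: Om_hv s n pairing_def del: dual_bundle_simps(2))
qed

lemma act_Om_hv:
  assumes s: "\<sigma> \<in> sections E" and t: "\<tau> \<in> sections E" and n: "\<nu> \<in> sections BE" and m: "\<kappa> \<in> sections BE"
  shows "act left_anchor (hl \<tau>) (Om (hl \<sigma>) (vl \<nu>)) (q, k) = act \<rho>l \<tau> (pairing \<nu> \<sigma>) q"
    "act RA (hl \<tau>) (Om (hl \<sigma>) (vl \<nu>)) (q, k) = act \<rho>r \<tau> (pairing \<nu> \<sigma>) q"
    "act left_anchor (vl \<kappa>) (Om (hl \<sigma>) (vl \<nu>)) (q, k) = 0"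
    "act RA (vl \<kappa>) (Om (hl \<sigma>) (vl \<nu>)) (q, k) = 0"
proof -
  note p = pairing_Cinf[OF E n s]
  note l = hlift_l_section[OF q k t] and r = hlift_r_section[OF q k t] and v = vlift_at[OF q k m]
  show "act left_anchor (hl \<tau>) (Om (hl \<sigma>) (vl \<nu>)) (q, k) = act \<rho>l \<tau> (pairing \<nu> \<sigma>) q"
    by (simp only: act_left hl_at[OF q k] snd_conv tangent_Om_hv[OF l(1) s n] l(2)[OF p])
  show "act RA (hl \<tau>) (Om (hl \<sigma>) (vl \<nu>)) (q, k) = act \<rho>r \<tau> (pairing \<nu> \<sigma>) q"
    by (simp only: act_right_hl[OF x] fst_conv tangent_Om_hv[OF r(1) s n] r(2)[OF p])
  show "act left_anchor (vl \<kappa>) (Om (hl \<sigma>) (vl \<nu>)) (q, k) = 0"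
    by (simp only: act_left vl_at[OF q k] snd_conv tangent_Om_hv[OF v(1) s n] v(2)[OF p])
  show "act RA (vl \<kappa>) (Om (hl \<sigma>) (vl \<nu>)) (q, k) = 0"
    by (simp only: act_right_vl[OF x] tangent_Om_hv[OF v(1) s n] v(2)[OF p])
qed

lemma vlift_dual_conn:
  assumes r: "anchor_map E \<rho>" and D: "connection E \<rho> D"
    and s: "\<sigma> \<in> sections E" and n: "\<nu> \<in> sections BE" and t: "\<tau> \<in> sections E"
  shows "vlift E (dual_conn E \<rho> D \<sigma> \<nu>) (q, k) (hat \<tau>) = act \<rho> \<sigma> (pairing \<nu> \<tau>) q - \<nu> q (D \<sigma> \<tau> q)"
proof -
  note d = dual_conn_props[OF E r D q s n]
  show ?thesis
    using vlift_props(3)[where \<nu> = "dual_conn E \<rho> D \<sigma> \<nu>", OF E q k d(1) t] d(2)[OF t]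
    by (simp add: pairing_def)
qed

lemma conn_zero: "\<tau> \<in> sections E \<Longrightarrow> k (conn_at E Dl q 0 \<tau>) = 0"
  using conn_at_linear(2)[OF E Dl q _ base_zero[OF q] base_zero[OF q], of \<tau> 0] k_linear(4)[OF q k] by simp

text \<open>Such a bracket is, up to sign, the vertical lift of a dual derivative of \<nu>, and
  pairing it with a horizontal lift evaluates minus that covector on \<tau>.\<close>

lemma Om_bracket_hv_h:
  assumes s: "\<sigma> \<in> sections E" and t: "\<tau> \<in> sections E" and n: "\<nu> \<in> sections BE"
  shows "Om (BT (hl \<sigma>) (vl \<nu>)) (hl \<tau>) (q, k) = \<nu> q (Dl \<sigma> \<tau> q) - act \<rho>l \<sigma> (pairing \<nu> \<tau>) q"
    "Om (BT (vl \<nu>) (hl \<sigma>)) (hl \<tau>) (q, k) = act \<rho>r \<sigma> (pairing \<nu> \<tau>) q - \<nu> q (Dr \<sigma> \<tau> q)"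
proof -
  note h = hl_section[OF s] and v = vsec_section[OF n]
  show "Om (BT (hl \<sigma>) (vl \<nu>)) (hl \<tau>) (q, k) = \<nu> q (Dl \<sigma> \<tau> q) - act \<rho>l \<sigma> (pairing \<nu> \<tau>) q"
    unfolding Om_hl_right[OF q k t bracket_bilinear(1)[OF h v]] unfolding bracket_generators(2)[OF s n]
    by (simp add: vl_at[OF q k] conn_zero t vlift_dual_conn[OF base.anchors(1) Dl s n t])
  show "Om (BT (vl \<nu>) (hl \<sigma>)) (hl \<tau>) (q, k) = act \<rho>r \<sigma> (pairing \<nu> \<tau>) q - \<nu> q (Dr \<sigma> \<tau> q)"
    unfolding Om_hl_right[OF q k t bracket_bilinear(1)[OF v h]] unfolding bracket_generators(3)[OF n s]
    by (simp add: vl_at[OF q k] conn_zero t vlift_dual_conn[OF base.anchors(2) Dr s n t])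
qed

lemma R_section:
  assumes "\<sigma> \<in> sections E" "\<tau> \<in> sections E" "\<upsilon> \<in> sections E"
  shows "R \<sigma> \<tau> \<upsilon> \<in> sections E" "\<upsilon>' \<in> sections E \<Longrightarrow> R \<sigma> \<tau> (\<upsilon> + \<upsilon>') = R \<sigma> \<tau> \<upsilon> + R \<sigma> \<tau> \<upsilon>'"
    "f \<in> Cinf (base E) \<Longrightarrow> R \<sigma> \<tau> (f \<star> \<upsilon>) = f \<star> R \<sigma> \<tau> \<upsilon>"
  using R assms unfolding tensor13_def by blast+

text \<open>The horizontal part of the bracket pairs to 0 with the horizontal lift: its two
  contributions \<open>k (Dl (B \<sigma> \<tau>) \<upsilon> q)\<close> cancel. Only the vertical
  part given by \<open>R\<close> survives.\<close>

lemma Om_bracket_hh_h: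
  assumes s: "\<sigma> \<in> sections E" and t: "\<tau> \<in> sections E" and u: "\<upsilon> \<in> sections E"
  shows "Om (BT (hl \<sigma>) (hl \<tau>)) (hl \<upsilon>) (q, k) = - k (R \<sigma> \<tau> \<upsilon> q)"
proof -
  note B = base.bracket_bilinear(1)[OF s t]
  have 1: "vlift_tensor E (R \<sigma> \<tau>) (q, k) (hat \<upsilon>) = k (R \<sigma> \<tau> \<upsilon> q)"
    by (rule vlift_tensor_hat[OF E q k R_section(1)[OF s t] R_section(2)[OF s t] R_section(3)[OF s t] u])
  have 2: "(hl (B \<sigma> \<tau>) + vsec_tensor E (R \<sigma> \<tau>)) (q, k) =
      (B \<sigma> \<tau> q, hlift E \<rho>l Dl (q, k) (B \<sigma> \<tau> q) + vlift_tensor E (R \<sigma> \<tau>) (q, k))"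
    by (simp add: hl_at[OF q k] vsec_tensor_def)
  show ?thesis
    unfolding Om_hl_right[OF q k u bracket_bilinear(1)[OF hl_section[OF s] hl_section[OF t]]]
    unfolding bracket_generators(1)[OF s t] unfolding 2 unfolding fst_conv snd_conv plus_fun_apply
      hlift_l_section(3)[OF q k B u] conn_at_eq[OF E Dl q B u] 1
    by simp
qed

lemma Om_bracket_hh_v:
  assumes s: "\<sigma> \<in> sections E" and t: "\<tau> \<in> sections E" and n: "\<nu> \<in> sections BE"
  shows "Om (BT (hl \<sigma>) (hl \<tau>)) (vl \<nu>) (q, k) = \<nu> q (Dl \<sigma> \<tau> q) - \<nu> q (Dr \<tau> \<sigma> q)"
proof -
  have f: "Dl \<sigma> \<tau> q \<in> fibre E q" "Dr \<tau> \<sigma> q \<in> fibre E q"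
    by (rule sections_fibre[OF connectionD(1)[OF Dl s t] q], rule sections_fibre[OF connectionD(1)[OF Dr t s] q])
  have "fst ((hl (B \<sigma> \<tau>) + vsec_tensor E (R \<sigma> \<tau>)) (q, k)) = Dl \<sigma> \<tau> q - Dr \<tau> \<sigma> q"
    using B_eq s t by (simp add: hl_at[OF q k] vsec_tensor_def)
  then show ?thesis
    unfolding Om_vl_right[OF q k n bracket_bilinear(1)[OF hl_section[OF s] hl_section[OF t]]]
    unfolding bracket_generators(1)[OF s t]
    by (simp only: k_linear(3)[OF q dual_section_fibre[OF q k n] f])
qed

lemma dOm_hhh:
  assumes skew: "\<forall>\<sigma>\<in>sections E. \<forall>\<tau>\<in>sections E. \<forall>\<upsilon>\<in>sections E. R \<sigma> \<tau> \<upsilon> = - R \<tau> \<sigma> \<upsilon>"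
    and cyc: "\<forall>\<sigma>\<in>sections E. \<forall>\<tau>\<in>sections E. \<forall>\<upsilon>\<in>sections E. R \<sigma> \<tau> \<upsilon> + R \<tau> \<upsilon> \<sigma> + R \<upsilon> \<sigma> \<tau> = 0"
    and s: "\<sigma> \<in> sections E" and t: "\<tau> \<in> sections E" and u: "\<upsilon> \<in> sections E"
  shows "dOm (hl \<sigma>) (hl \<tau>) (hl \<upsilon>) (q, k) = 0"
proof -
  note h = hl_section
  have z: "act left_anchor (hl \<alpha>) (Om (hl \<beta>) (hl \<gamma>)) (q, k) = 0" "act RA (hl \<alpha>) (Om (hl \<beta>) (hl \<gamma>)) (q, k) = 0"
    if "\<alpha> \<in> sections E" "\<beta> \<in> sections E" "\<gamma> \<in> sections E" for \<alpha> \<beta> \<gamma>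
    using that Om_hh by (auto intro!: act_Om_zero h simp del: dual_bundle_simps(2))
  have n: "k (R \<alpha> \<beta> \<gamma> q) = - k (R \<beta> \<alpha> \<gamma> q)"
    if a: "\<alpha> \<in> sections E" "\<beta> \<in> sections E" "\<gamma> \<in> sections E" for \<alpha> \<beta> \<gamma>
  proof -
    have "R \<alpha> \<beta> \<gamma> = - R \<beta> \<alpha> \<gamma>" using skew a by blast
    then have "R \<alpha> \<beta> \<gamma> q = (-1) *\<^sub>R R \<beta> \<alpha> \<gamma> q" by simp
    then show ?thesis using k_linear(2)[OF q k sections_fibre[OF R_section(1)[OF a(2,1,3)] q], of "-1"] by simp
  qed
  note f = sections_fibre[OF R_section(1) q]
  have "R \<sigma> \<tau> \<upsilon> + R \<tau> \<upsilon> \<sigma> + R \<upsilon> \<sigma> \<tau> = 0" using cyc s t u by blast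
  then have c0: "R \<sigma> \<tau> \<upsilon> q + R \<tau> \<upsilon> \<sigma> q + R \<upsilon> \<sigma> \<tau> q = 0" by (metis plus_fun_apply zero_fun_apply)
  have "k (R \<sigma> \<tau> \<upsilon> q + R \<tau> \<upsilon> \<sigma> q + R \<upsilon> \<sigma> \<tau> q) = k (R \<sigma> \<tau> \<upsilon> q) + k (R \<tau> \<upsilon> \<sigma> q) + k (R \<upsilon> \<sigma> \<tau> q)"
    using k_linear(1)[OF q k subspace_add[OF linear_bundleD(2)[OF lb q] f[OF s t u] f[OF t u s]] f[OF u s t]]
      k_linear(1)[OF q k f[OF s t u] f[OF t u s]] by simp
  then have c: "k (R \<sigma> \<tau> \<upsilon> q) + k (R \<tau> \<upsilon> \<sigma> q) + k (R \<upsilon> \<sigma> \<tau> q) = 0"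
    unfolding c0 k_linear(4)[OF q k] by simp
  \<comment> \<open>The anchor terms differentiate functions that vanish identically. Of the six
    bracket terms three form the cyclic sum, and by skewness the other three form it once
    more.\<close>
  have "2 * dOm (hl \<sigma>) (hl \<tau>) (hl \<upsilon>) (q, k) = 0"
    unfolding dOm_eq[OF x h[OF s] h[OF t] h[OF u]] z[OF s t u] z[OF t s u] z[OF u s t]
      Om_bracket_hh_h[OF s t u] Om_bracket_hh_h[OF t s u] Om_bracket_hh_h[OF s u t]
      Om_bracket_hh_h[OF u s t] Om_bracket_hh_h[OF t u s] Om_bracket_hh_h[OF u t s]
    using c n[OF t s u] n[OF s u t] n[OF u t s] by linarith
  then show ?thesis by simp
qed

text \<open>The anchor derivatives of \<nu>(\<tau>) and \<nu>(\<sigma>) cancel against those inside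
  the dual connections. The remaining terms \<nu>(Dl) and \<nu>(Dr) from these connections cancel
  against \<nu> applied to the skew bracket of \<sigma> and \<tau>, because \<open>B\<close> is the
  difference of the two connections.\<close>

lemma dOm_hhv:
  assumes s: "\<sigma> \<in> sections E" and t: "\<tau> \<in> sections E" and n: "\<nu> \<in> sections BE"
  shows "dOm (hl \<sigma>) (hl \<tau>) (vl \<nu>) (q, k) = 0"
proof -
  note h = hl_section and v = vsec_section[OF n]
  have z: "act left_anchor (vl \<nu>) (Om (hl \<sigma>) (hl \<tau>)) (q, k) = 0" "act RA (vl \<nu>) (Om (hl \<sigma>) (hl \<tau>)) (q, k) = 0"
    by (rule act_Om_zero[OF v h[OF s] h[OF t]], rule Om_hh[OF _ _ s t], assumption+)+
  have "2 * dOm (hl \<sigma>) (hl \<tau>) (vl \<nu>) (q, k) = 0"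
    unfolding dOm_eq[OF x h[OF s] h[OF t] v] z
      act_Om_hv(1)[OF t s n n] act_Om_hv(2)[OF t s n n] act_Om_hv(1)[OF s t n n] act_Om_hv(2)[OF s t n n]
      Om_bracket_hh_v[OF s t n] Om_bracket_hh_v[OF t s n]
      Om_bracket_hv_h[OF s t n] Om_bracket_hv_h[OF t s n]
    by simp
  then show ?thesis by simp
qed

lemma Om_bracket_v:
  assumes s: "\<sigma> \<in> sections E" and n: "\<nu> \<in> sections BE" and m: "\<kappa> \<in> sections BE"
  shows "Om (BT (hl \<sigma>) (vl \<nu>)) (vl \<kappa>) (q, k) = 0" "Om (BT (vl \<nu>) (hl \<sigma>)) (vl \<kappa>) (q, k) = 0"
proof -
  note h = hl_section[OF s] and v = vsec_section[OF n]
  note z = k_linear(4)[OF q dual_section_fibre[OF q k m]]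
  show "Om (BT (hl \<sigma>) (vl \<nu>)) (vl \<kappa>) (q, k) = 0"
    unfolding Om_vl_right[OF q k m bracket_bilinear(1)[OF h v]] unfolding bracket_generators(2)[OF s n]
    by (simp add: vl_at[OF q k] z)
  show "Om (BT (vl \<nu>) (hl \<sigma>)) (vl \<kappa>) (q, k) = 0"
    unfolding Om_vl_right[OF q k m bracket_bilinear(1)[OF v h]] unfolding bracket_generators(3)[OF n s]
    by (simp add: vl_at[OF q k] z)
qed

lemma Om_bracket_vv:
  assumes n: "\<nu> \<in> sections BE" and m: "\<kappa> \<in> sections BE" and X: "X \<in> sections TE"
  shows "Om (BT (vl \<nu>) (vl \<kappa>)) X (q, k) = 0"
  unfolding bracket_generators(4)[OF n m]
  by (rule additive_zero[OF left_linear, of "\<lambda>Y. Om Y X (q, k)"]) (rule Om_linear(1)[OF x _ X])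

text \<open>Vertical lifts annihilate the basic functions \<nu>(\<sigma>) and \<kappa>(\<sigma>).
  The brackets with the horizontal lift are vertical, so they pair to 0 with a vertical lift, and
  the bracket of the two vertical lifts is 0.\<close>

lemma dOm_hvv:
  assumes s: "\<sigma> \<in> sections E" and n: "\<nu> \<in> sections BE" and m: "\<kappa> \<in> sections BE"
  shows "dOm (hl \<sigma>) (vl \<nu>) (vl \<kappa>) (q, k) = 0"
proof -
  note h = hl_section[OF s] and v = vsec_section
  have z: "act left_anchor (hl \<sigma>) (Om (vl \<nu>) (vl \<kappa>)) (q, k) = 0" "act RA (hl \<sigma>) (Om (vl \<nu>) (vl \<kappa>)) (q, k) = 0"
    by (rule act_Om_zero[OF h v[OF n] v[OF m]], rule Om_vv[OF _ _ n m], assumption+)+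
  have "2 * dOm (hl \<sigma>) (vl \<nu>) (vl \<kappa>) (q, k) = 0"
    unfolding dOm_eq[OF x h v[OF n] v[OF m]] z
      act_Om_hv(3)[OF s s m n] act_Om_hv(4)[OF s s m n] act_Om_hv(3)[OF s s n m] act_Om_hv(4)[OF s s n m]
      Om_bracket_v[OF s n m] Om_bracket_v[OF s m n] Om_bracket_vv[OF n m h] Om_bracket_vv[OF m n h]
    by simp
  then show ?thesis by simp
qed

lemma dOm_vvv:
  assumes n: "\<nu> \<in> sections BE" and m: "\<kappa> \<in> sections BE" and l: "\<mu> \<in> sections BE"
  shows "dOm (vl \<nu>) (vl \<kappa>) (vl \<mu>) (q, k) = 0"
proof -
  note v = vsec_section
  have z: "act left_anchor (vl \<alpha>) (Om (vl \<beta>) (vl \<gamma>)) (q, k) = 0" "act RA (vl \<alpha>) (Om (vl \<beta>) (vl \<gamma>)) (q, k) = 0"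
    if "\<alpha> \<in> sections BE" "\<beta> \<in> sections BE" "\<gamma> \<in> sections BE" for \<alpha> \<beta> \<gamma>
    using that Om_vv by (auto intro!: act_Om_zero v simp del: dual_bundle_simps(2))
  have "2 * dOm (vl \<nu>) (vl \<kappa>) (vl \<mu>) (q, k) = 0"
    unfolding dOm_eq[OF x v[OF n] v[OF m] v[OF l]] z[OF n m l] z[OF m n l] z[OF l n m]
      Om_bracket_vv[OF n m v[OF l]] Om_bracket_vv[OF m n v[OF l]] Om_bracket_vv[OF n l v[OF m]]
      Om_bracket_vv[OF l n v[OF m]] Om_bracket_vv[OF m l v[OF n]] Om_bracket_vv[OF l m v[OF n]]
    by simp
  then show ?thesis by simp
qed

text \<open>Linearity is available in the first slot only. So after the generators are settled, the
  arguments are freed one at a time, each being brought to the front by transpositions.\<close>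

lemma dOm_zero:
  assumes skew: "\<forall>\<sigma>\<in>sections E. \<forall>\<tau>\<in>sections E. \<forall>\<upsilon>\<in>sections E. R \<sigma> \<tau> \<upsilon> = - R \<tau> \<sigma> \<upsilon>"
    and cyc: "\<forall>\<sigma>\<in>sections E. \<forall>\<tau>\<in>sections E. \<forall>\<upsilon>\<in>sections E. R \<sigma> \<tau> \<upsilon> + R \<tau> \<upsilon> \<sigma> + R \<upsilon> \<sigma> \<tau> = 0"
    and X: "X \<in> sections TE" and Y: "Y \<in> sections TE" and Z: "Z \<in> sections TE"
  shows "dOm X Y Z (q, k) = 0"
proof -
  define G where "G = hl ` sections E \<union> vl ` sections BE"
  have GS: "g \<in> sections TE" if "g \<in> G" for g
    using that hl_section vsec_section by (auto simp: G_def simp del: dual_bundle_simps(2))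
  have GE: P if "g \<in> G" "\<And>\<sigma>. \<sigma> \<in> sections E \<Longrightarrow> g = hl \<sigma> \<Longrightarrow> P" "\<And>\<nu>. \<nu> \<in> sections BE \<Longrightarrow> g = vl \<nu> \<Longrightarrow> P" for g P
    using that unfolding G_def by blast
  have s1: "dOm Y X Z (q, k) = 0" if "dOm X Y Z (q, k) = 0" "X \<in> sections TE" "Y \<in> sections TE" "Z \<in> sections TE" for X Y Z
    using dOm_swap(1)[OF x that(2-4)] that(1) by simp
  have s2: "dOm X Z Y (q, k) = 0" if "dOm X Y Z (q, k) = 0" "X \<in> sections TE" "Y \<in> sections TE" "Z \<in> sections TE" for X Y Z
    using dOm_swap(2)[OF x that(2-4)] that(1) by simp
  have step: "dOm X Y Z (q, k) = 0"
    if X: "X \<in> sections TE" and Y: "Y \<in> sections TE" and Z: "Z \<in> sections TE"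
      and g: "\<And>g. g \<in> G \<Longrightarrow> dOm g Y Z (q, k) = 0" for X Y Z
    by (rule lift_span_unique[OF x, where L = "\<lambda>X. dOm X Y Z (q, k)" and K = "\<lambda>_. 0"])
      (use dOm_add[OF x _ _ Y Z] dOm_fmult[OF x _ Y Z] X g in \<open>simp_all add: G_def\<close>)
  have hh: "dOm g (hl \<sigma>) (hl \<tau>) (q, k) = 0" if "g \<in> G" "\<sigma> \<in> sections E" "\<tau> \<in> sections E" for g \<sigma> \<tau>
    by (rule GE[OF that(1)])
      (auto intro!: dOm_hhh[OF skew cyc] s1[OF s2[OF dOm_hhv]] hl_section vsec_section that simp del: dual_bundle_simps(2))
  have hv: "dOm g (hl \<sigma>) (vl \<nu>) (q, k) = 0" if "g \<in> G" "\<sigma> \<in> sections E" "\<nu> \<in> sections BE" for g \<sigma> \<nu>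
    by (rule GE[OF that(1)])
      (auto intro!: dOm_hhv s1[OF dOm_hvv] hl_section vsec_section that simp del: dual_bundle_simps(2))
  have vv: "dOm g (vl \<nu>) (vl \<kappa>) (q, k) = 0" if "g \<in> G" "\<nu> \<in> sections BE" "\<kappa> \<in> sections BE" for g \<nu> \<kappa>
    by (rule GE[OF that(1)])
      (auto intro!: dOm_hvv dOm_vvv that simp del: dual_bundle_simps(2))
  have ggg: "dOm g g' g'' (q, k) = 0" if g: "g \<in> G" "g' \<in> G" "g'' \<in> G" for g g' g''
  \<comment> \<open>Of the four cases only a vertical lift followed by a horizontal one is not among
    \<open>hh\<close>, \<open>hv\<close> and \<open>vv\<close>; a transposition turns it into
    \<open>hv\<close>.\<close>
  proof (rule GE[OF g(2)]; rule GE[OF g(3)])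
    fix \<nu> \<sigma> assume "\<nu> \<in> sections BE" "g' = vl \<nu>" "\<sigma> \<in> sections E" "g'' = hl \<sigma>"
    then show ?thesis using s2[OF hv[OF g(1)]] GS[OF g(1)] hl_section vsec_section by blast
  qed (use hh hv vv g(1) in blast)+
  have gg: "dOm X g' g'' (q, k) = 0" if "X \<in> sections TE" "g' \<in> G" "g'' \<in> G" for X g' g''
    by (rule step[OF that(1) GS GS ggg]) (use that in auto)
  have "dOm X Y g (q, k) = 0" if X: "X \<in> sections TE" and Y: "Y \<in> sections TE" and g: "g \<in> G" for X Y g
    by (rule step[OF X Y GS[OF g]]) (rule s1[OF gg[OF Y _ g] Y GS GS[OF g]])
  note one = this
  \<comment> \<open>Here the third slot is freed: \<open>one\<close> has arbitrary sections in the
    first two slots and a generator in the third, and two transpositions move that generator to the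
    front.\<close>
  show ?thesis
    by (rule step[OF X Y Z]) (rule s1[OF s2[OF one[OF Y Z] Y Z GS] Y GS Z])
qed

end

end

theorem theorem5p1:
  fixes E :: "('q, 'm::coordinate_space, 'v::real_vector, 'f::coordinate_space) vbundle"
    and B Dl Dr :: "('q, 'v) sec_op"
    and \<rho>l \<rho>r :: "('q, 'v) anchor"
    and R :: "('q \<Rightarrow> 'v) \<Rightarrow> ('q, 'v) sec_op"
    and BT :: "('q \<times> ('v \<Rightarrow> real), ('q, 'v) lfib) sec_op"
  assumes "vector_bundle E"
    and "algebroid E B \<rho>l \<rho>r"
    and "connection E \<rho>l Dl"
    and "connection E \<rho>r Dr"
    and "\<forall>\<sigma>\<in>sections E. \<forall>\<tau>\<in>sections E. B \<sigma> \<tau> = Dl \<sigma> \<tau> - Dr \<tau> \<sigma>"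
    and "tensor13 E R"
    and "associated_bracket E B \<rho>l \<rho>r Dl Dr R BT"
    and "\<forall>\<sigma>\<in>sections E. \<forall>\<tau>\<in>sections E. \<forall>\<upsilon>\<in>sections E. R \<sigma> \<tau> \<upsilon> = - R \<tau> \<sigma> \<upsilon>"
    and "\<forall>\<sigma>\<in>sections E. \<forall>\<tau>\<in>sections E. \<forall>\<upsilon>\<in>sections E. R \<sigma> \<tau> \<upsilon> + R \<tau> \<upsilon> \<sigma> + R \<upsilon> \<sigma> \<tau> = 0"
  shows "\<forall>X\<in>sections (left_tangent E \<rho>l). \<forall>Y\<in>sections (left_tangent E \<rho>l).
      \<forall>Z\<in>sections (left_tangent E \<rho>l). \<forall>x\<in>pts (dual_total E).
        dA BT left_anchor (right_anchor E \<rho>l \<rho>r Dl Dr) (Omega E \<rho>l \<rho>r Dl Dr BT) X Y Z x = 0"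
proof (intro ballI)
  interpret associated_structure E B Dl Dr \<rho>l \<rho>r R BT
    by (rule associated_structure.intro[OF assms(1-7)])
  fix X Y Z x
  assume s: "X \<in> sections TE" "Y \<in> sections TE" "Z \<in> sections TE" and x: "x \<in> pts DE"
  obtain q k where qk: "x = (q, k)" "q \<in> pts (base E)" "k \<in> fibre BE q" by (rule dual_pointE[OF x])
  show "dOm X Y Z x = 0" unfolding qk(1) by (rule dOm_zero[OF qk(2,3) assms(8,9) s])
qed

end
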